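(* Let $h \in \mathbb{R}[x_0,\ldots,x_n]$ be a homogeneous polynomial that is hyperbolic with respect to $e \in \mathbb{R}^{n+1}$. Assume that $h$ has no real singularities, i.e. $\nabla h(v) \neq 0$ for all $0 \neq v \in \mathbb{R}^{n+1}$. Then there is a hyperbolic polynomial $q \in \mathbb{R}[x_0,\ldots,x_n]$ such that $q \cdot h$ has a definite determinantal representation.
   Context: A homogeneous polynomial $h \in \mathbb{R}[x_0,\ldots,x_n]$ is hyperbolic with respect to $e \in \mathbb{R}^{n+1}$ if $h(e) \neq 0$ and for every $v \in \mathbb{R}^{n+1}$ the univariate polynomial $h(te+v) \in \mathbb{R}[t]$ has only real roots. A homogeneous polynomial is called hyperbolic if it is hyperbolic with respect to some point of $\mathbb{R}^{n+1}$. A homogeneous polynomial $f \in \mathbb{R}[x_0,\ldots,x_n]$ has a definite determinantal representation if there are real symmetric matrices $A_0,\ldots,A_n$ (all of the same size $N\times N$ for some $N$) with $f = \det(x_0 A_0 + \cdots + x_n A_n)$ and such that $A(u) = u_0 A_0 + \cdots + u_n A_n$ is positive definite for some $u \in \mathbb{R}^{n+1}$. *)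

theory Defs
  imports
    "HOL-Analysis.Analysis"
    "HOL-Library.Poly_Mapping"
    "HOL-Computational_Algebra.Polynomial"
    "Jordan_Normal_Form.Determinant"
begin

text \<open>
  Real polynomials in finitely many variables, as finitely supported maps from exponent
  vectors to coefficients; the ring structure is the convolution product of
  \<^type>\<open>poly_mapping\<close>. The variables \<open>x\<^sub>0, \<dots>, x\<^sub>n\<close> are indexed by a finite type \<open>'n\<close>
  with \<open>n + 1\<close> elements, and points of the affine space are vectors in \<open>real ^ 'n\<close>.
\<close>

type_synonym 'n rpoly = "('n \<Rightarrow>\<^sub>0 nat) \<Rightarrow>\<^sub>0 real"

text \<open>The value \<open>\<Sum>\<^sub>m \<phi>(c\<^sub>m) \<Prod>\<^sub>i (x i)\<^bsup>m i\<^esup>\<close> of \<open>f\<close> in a ring \<open>'b\<close>, with coefficients mapped by \<open>\<phi>\<close>.\<close>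

definition subst_poly ::
    "(real \<Rightarrow> 'b) \<Rightarrow> ('n::finite \<Rightarrow> 'b) \<Rightarrow> 'n rpoly \<Rightarrow> 'b::comm_ring_1" where
  "subst_poly \<phi> x f =
     (\<Sum>m\<in>Poly_Mapping.keys f. \<phi> (Poly_Mapping.lookup f m) *
        (\<Prod>i\<in>UNIV. x i ^ Poly_Mapping.lookup m i))"

definition mpoly_eval :: "'n::finite rpoly \<Rightarrow> real ^ 'n \<Rightarrow> real" where
  "mpoly_eval f v = subst_poly (\<lambda>c. c) (vec_nth v) f"

text \<open>The univariate polynomial \<open>f(t e + v)\<close> in the indeterminate \<open>t\<close>.\<close>

definition line_poly :: "'n::finite rpoly \<Rightarrow> real ^ 'n \<Rightarrow> real ^ 'n \<Rightarrow> real poly" where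
  "line_poly f e v = subst_poly (\<lambda>c. [:c:]) (\<lambda>i. [:vec_nth v i, vec_nth e i:]) f"

definition partial_deriv :: "'n \<Rightarrow> 'n::finite rpoly \<Rightarrow> 'n rpoly" where
  "partial_deriv i f =
     (\<Sum>m\<in>Poly_Mapping.keys f. Poly_Mapping.single (m - Poly_Mapping.single i 1)
        (real (Poly_Mapping.lookup m i) * Poly_Mapping.lookup f m))"

definition gradient :: "'n::finite rpoly \<Rightarrow> real ^ 'n \<Rightarrow> real ^ 'n" where
  "gradient f v = (\<chi> i. mpoly_eval (partial_deriv i f) v)"

definition homogeneous_poly :: "'n::finite rpoly \<Rightarrow> bool" where
  "homogeneous_poly f \<longleftrightarrow>
     (\<exists>d. \<forall>m\<in>Poly_Mapping.keys f. (\<Sum>i\<in>UNIV. Poly_Mapping.lookup m i) = d)"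

definition real_rooted :: "real poly \<Rightarrow> bool" where
  "real_rooted p \<longleftrightarrow> (\<forall>z::complex. poly (map_poly complex_of_real p) z = 0 \<longrightarrow> z \<in> \<real>)"

definition hyperbolic_wrt :: "'n::finite rpoly \<Rightarrow> real ^ 'n \<Rightarrow> bool" where
  "hyperbolic_wrt f e \<longleftrightarrow>
     homogeneous_poly f \<and> mpoly_eval f e \<noteq> 0 \<and> (\<forall>v. real_rooted (line_poly f e v))"

definition hyperbolic :: "'n::finite rpoly \<Rightarrow> bool" where
  "hyperbolic f \<longleftrightarrow> (\<exists>e. hyperbolic_wrt f e)"

definition pos_def_mat :: "nat \<Rightarrow> real mat \<Rightarrow> bool" where
  "pos_def_mat N A \<longleftrightarrow> A \<in> carrier_mat N N \<and> transpose_mat A = A \<and>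
     (\<forall>x\<in>carrier_vec N. x \<noteq> 0\<^sub>v N \<longrightarrow> scalar_prod x (A *\<^sub>v x) > 0)"

text \<open>
  The matrix \<open>x\<^sub>0 A\<^sub>0 + \<dots> + x\<^sub>n A\<^sub>n\<close> over the polynomial ring; the monomial \<open>a x\<^sub>i\<close> is
  \<open>single (single i 1) a\<close>.
\<close>

definition linear_matrix :: "nat \<Rightarrow> ('n::finite \<Rightarrow> real mat) \<Rightarrow> 'n rpoly mat" where
  "linear_matrix N A = mat N N (\<lambda>(r, c).
     \<Sum>i\<in>UNIV. Poly_Mapping.single (Poly_Mapping.single i 1) (A i $$ (r, c)))"

definition linear_matrix_at :: "nat \<Rightarrow> ('n::finite \<Rightarrow> real mat) \<Rightarrow> real ^ 'n \<Rightarrow> real mat" where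
  "linear_matrix_at N A u = mat N N (\<lambda>(r, c). \<Sum>i\<in>UNIV. vec_nth u i * A i $$ (r, c))"

definition has_definite_det_rep :: "'n::finite rpoly \<Rightarrow> bool" where
  "has_definite_det_rep f \<longleftrightarrow>
     (\<exists>N (A :: 'n \<Rightarrow> real mat).
        (\<forall>i. A i \<in> carrier_mat N N \<and> transpose_mat (A i) = A i) \<and>
        f = Determinant.det (linear_matrix N A) \<and>
        (\<exists>u. pos_def_mat N (linear_matrix_at N A u)))"

end

theory Submission
  imports Defs "HOL-Probability.Distributions" "HOL-Computational_Algebra.Fundamental_Theorem_Algebra"
begin

text \<open>
  Write points as \<open>x + t e\<close> with \<open>x\<close> in a coordinate hyperplane that does not contain \<open>e\<close>, and
  \<open>h(x + t e) = H\<^sub>x(t) = \<Sum>\<^sub>a \<eta>\<^sub>a(x) t\<^sup>a\<close>, a polynomial of degree \<open>d\<close> in \<open>t\<close> with constant leading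
  coefficient \<open>h(e)\<close>.  Since \<open>h\<close> is smooth, the \<open>d\<close> real roots of \<open>H\<^sub>x\<close> are distinct for \<open>x \<noteq> 0\<close>
  (\<open>hyperbolic_smooth_split\<close>).

  It suffices to find a pencil \<open>t K - \<Sum>\<^sub>i x\<^sub>i L\<^sub>i\<close> of real symmetric matrices with \<open>K\<close> positive definite
  that is singular at all real zeros of \<open>h\<close>.  On every line parallel to \<open>e\<close>, except the one through
  the origin, its determinant then vanishes at the \<open>d\<close> simple roots of \<open>h\<close>, so division by \<open>h\<close>, which
  is monic in the direction \<open>e\<close> up to a constant, leaves no remainder (\<open>form_dvd_of_zeros\<close>).  The
  quotient is hyperbolic because it divides a determinant that is real-rooted in the direction \<open>e\<close>
  (\<open>hyperbolic_factor_of_det\<close>).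

  The kernel vector at a zero \<open>(x, t)\<close> consists of all monomials \<open>t\<^sup>a x\<^bsup>\<alpha>\<^esup>\<close> with \<open>a < d\<close> and
  \<open>a + \<bar>\<alpha>\<bar> = k\<close>, for a large \<open>k\<close>.  Read \<open>K\<close> as a form \<open>\<Sum> t\<^sup>a s\<^sup>b K\<^sub>a\<^sub>b(x, y)\<close> in two points.  Symmetric
  matrices \<open>L\<^sub>i\<close> with \<open>t K = \<Sum>\<^sub>i x\<^sub>i L\<^sub>i\<close> modulo \<open>H\<^sub>x(t)\<close> exist as soon as the restriction of \<open>K\<close> to the
  diagonal \<open>x = y\<close> is annihilated by \<open>t - s\<close> modulo \<open>H\<^sub>x(t)\<close> and \<open>H\<^sub>x(s)\<close> (\<open>bisplit_exists\<close>).  The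
  Bezoutian of \<open>H\<^sub>x\<close> and its derivative has this property, and it is positive definite because the roots
  are real and simple (\<open>bezoutian_companion_sym\<close>, \<open>bezoutian_pos\<close>).

  What remains is a positive definite Gram matrix whose restriction to the diagonal is a scalar
  function times the Bezoutian \<open>B(x)\<close>.  This is a matrix version of Reznick's theorem that positive
  definite forms become sums of powers of linear forms after multiplication by a power of the norm.
  Take \<open>K\<^sub>a\<^sub>b(x, y)\<close> proportional to the Gaussian average over \<open>u\<close> of
  \<open>M\<^sub>a\<^sub>b(u) (u \<bullet> x)\<^bsup>k-a\<^esup> (u \<bullet> y)\<^bsup>k-b\<^esup>\<close>, where \<open>M\<^sub>a\<^sub>b\<close> is a correction of \<open>B\<^sub>a\<^sub>b\<close> that makes
  the diagonal exactly right (\<open>gauss_corrected\<close>).  The correction tends to zero on the unit sphere as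
  \<open>k\<close> grows, so \<open>M(u)\<close> is positive definite for large \<open>k\<close> (\<open>corrected_pos_def\<close>), and then so is \<open>K\<close>
  (\<open>gram_pos\<close>).
\<close>

section \<open>Polynomials in several variables\<close>

abbreviation (input) lookup :: "('a \<Rightarrow>\<^sub>0 'b::zero) \<Rightarrow> 'a \<Rightarrow> 'b" where
  "lookup \<equiv> Poly_Mapping.lookup"

abbreviation (input) single :: "'a \<Rightarrow> 'b::zero \<Rightarrow> ('a \<Rightarrow>\<^sub>0 'b)" where
  "single \<equiv> Poly_Mapping.single"

abbreviation (input) keys :: "('a \<Rightarrow>\<^sub>0 'b::zero) \<Rightarrow> 'a set" where
  "keys \<equiv> Poly_Mapping.keys"

abbreviation (input) unit_exp :: "'a \<Rightarrow> ('a \<Rightarrow>\<^sub>0 nat)" where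
  "unit_exp i \<equiv> single i 1"

lemma rpoly_induct [case_names single add]:
  fixes f :: "'n::finite rpoly"
  assumes "\<And>m c. P (single m c)" and "\<And>f g. P f \<Longrightarrow> P g \<Longrightarrow> P (f + g)"
  shows "P f"
proof (induction f rule: update_induct)
  case const
  have "P (single 0 0)" by (rule assms)
  then show ?case by simp
next
  case (update f a b)
  have "Poly_Mapping.update a b f = f + single a b"
    using update(1) by (intro poly_mapping_eqI)
      (auto simp: lookup_update lookup_add lookup_single in_keys_iff when_def)
  then show ?case using update assms by simp
qed

lemma exponent_induct [case_names zero add]:
  fixes m :: "'n::finite \<Rightarrow>\<^sub>0 nat"
  assumes "P 0" and "\<And>m i. P m \<Longrightarrow> P (m + single i 1)"
  shows "P m"
proof (induction "\<Sum>i\<in>UNIV. lookup m i" arbitrary: m)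
  case 0
  then have "m = 0" by (intro poly_mapping_eqI) auto
  then show ?case using assms by simp
next
  case (Suc n)
  then obtain i where i: "lookup m i > 0"
    by (metis gr0I sum.neutral nat.simps(3))
  let ?m = "m - single i 1"
  have eq: "m = ?m + single i 1"
    using i by (intro poly_mapping_eqI) (auto simp: lookup_add lookup_minus lookup_single when_def)
  have "(\<Sum>j\<in>UNIV. lookup m j) = (\<Sum>j\<in>UNIV. lookup ?m j) + 1"
    by (subst eq) (simp add: lookup_add lookup_single sum.distrib when_def)
  then have "P ?m" using Suc by auto
  then show ?case using assms(2) eq by metis
qed

lemma sum_keys_superset:
  assumes "\<And>m. T m 0 = 0" "finite A" "keys f \<subseteq> A"
  shows "(\<Sum>m\<in>keys f. T m (lookup f m)) = (\<Sum>m\<in>A. T m (lookup f m))"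
  by (rule sum.mono_neutral_left) (use assms in \<open>auto simp: in_keys_iff\<close>)

text \<open>
  Evaluation, the Gaussian expectation and the homogeneous components below are all sums over the
  support of a term that is additive in the coefficient.  This lemma gives their additivity.
\<close>

lemma sum_keys_add:
  fixes T :: "'k \<Rightarrow> 'c::monoid_add \<Rightarrow> 'b::comm_monoid_add"
  assumes "\<And>m. T m 0 = 0" and "\<And>m a b. T m (a + b) = T m a + T m b"
  shows "(\<Sum>m\<in>keys (f + g). T m (lookup (f + g) m)) =
    (\<Sum>m\<in>keys f. T m (lookup f m)) + (\<Sum>m\<in>keys g. T m (lookup g m))"
proof -
  let ?A = "keys f \<union> keys g"
  have s: "(\<Sum>m\<in>keys h. T m (lookup h m)) = (\<Sum>m\<in>?A. T m (lookup h m))"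
    if "keys h \<subseteq> ?A" for h
    by (rule sum_keys_superset) (use that assms in auto)
  have "(\<Sum>m\<in>?A. T m (lookup (f + g) m)) =
      (\<Sum>m\<in>?A. T m (lookup f m)) + (\<Sum>m\<in>?A. T m (lookup g m))"
    by (simp only: lookup_add assms(2) sum.distrib)
  then show ?thesis
    using s[of "f + g", OF keys_add] s[of f] s[of g] by simp
qed

lemma sum_keys_single:
  assumes "\<And>m. T m 0 = 0"
  shows "(\<Sum>m\<in>keys (single k c). T m (lookup (single k c) m)) = T k c"
  using assms by auto

definition xpow :: "('n::finite \<Rightarrow>\<^sub>0 nat) \<Rightarrow> 'n rpoly" where
  "xpow m = single m 1"

definition Const :: "real \<Rightarrow> 'n::finite rpoly" where
  "Const c = single 0 c"

definition Var :: "'n::finite \<Rightarrow> 'n rpoly" where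
  "Var i = xpow (single i 1)"

lemma Const_hom: "comm_ring_hom (Const :: real \<Rightarrow> 'n::finite rpoly)"
  by unfold_locales (auto simp: Const_def single_add mult_single)

interpretation Const_hom: comm_ring_hom "Const :: real \<Rightarrow> 'n::finite rpoly"
  by (rule Const_hom)

lemma xpow_0 [simp]: "xpow 0 = 1"
  by (simp add: xpow_def)

lemma xpow_add: "xpow (m + n) = xpow m * xpow n"
  by (simp add: xpow_def mult_single)

lemma single_eq_Const_xpow: "single m c = Const c * xpow m"
  by (simp add: Const_def xpow_def mult_single)

lemma single_Var: "single (single i 1) c = Const c * Var i"
  by (simp add: Var_def single_eq_Const_xpow)

lemma lookup_Const_mult: "lookup (Const c * f) m = c * lookup f m"
proof (induction f rule: rpoly_induct)
  case (single k b)
  then show ?case by (simp add: Const_def mult_single lookup_single when_def)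
next
  case (add f g)
  then show ?case by (simp add: distrib_left lookup_add)
qed

lemma rpoly_expand: "f = (\<Sum>m\<in>keys f. Const (lookup f m) * xpow m)"
proof (rule poly_mapping_eqI)
  fix k
  have "(\<Sum>m\<in>keys f. lookup f m when m = k) = lookup f k"
    by (simp add: when_def in_keys_iff)
  then show "lookup f k
      = lookup (\<Sum>m\<in>keys f. Const (lookup f m) * xpow m) k"
    by (simp add: lookup_sum flip: single_eq_Const_xpow) (simp add: lookup_single)
qed

lemma rpoly_expand_superset:
  assumes "finite A" "keys f \<subseteq> A"
  shows "f = (\<Sum>m\<in>A. Const (lookup f m) * xpow m)"
  using rpoly_expand[of f] sum_keys_superset[OF _ assms, of "\<lambda>m c. Const c * xpow m"] by simp

lemma subst_poly_single:
  assumes "comm_ring_hom \<phi>"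
  shows "subst_poly \<phi> x (single m c) = \<phi> c * (\<Prod>i\<in>UNIV. x i ^ lookup m i)"
proof -
  interpret comm_ring_hom \<phi> by fact
  show ?thesis unfolding subst_poly_def by (subst sum_keys_single) auto
qed

lemma subst_poly_add:
  assumes "comm_ring_hom \<phi>"
  shows "subst_poly \<phi> x (f + g) = subst_poly \<phi> x f + subst_poly \<phi> x g"
proof -
  interpret comm_ring_hom \<phi> by fact
  show ?thesis unfolding subst_poly_def by (rule sum_keys_add) (auto simp: hom_add algebra_simps)
qed

text \<open>
  Evaluation at a point, restriction to a line and restriction to a generic line parallel to a given
  direction are all instances, which makes their ring laws available at once.
\<close>

lemma subst_poly_hom:
  assumes "comm_ring_hom \<phi>"
  shows "comm_ring_hom (subst_poly \<phi> x)"
proof -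
  interpret comm_ring_hom \<phi> by fact
  note add = subst_poly_add[OF assms] and single = subst_poly_single[OF assms]
  have mult: "subst_poly \<phi> x (f * g) = subst_poly \<phi> x f * subst_poly \<phi> x g" for f g
  proof (induction f rule: rpoly_induct)
    case (single m c)
    show ?case
    proof (induction g rule: rpoly_induct)
      case (single n b)
      show ?case
        by (simp add: mult_single subst_poly_single[OF assms] hom_mult lookup_add power_add prod.distrib)
    qed (simp add: distrib_left add)
  qed (simp add: distrib_right add)
  show ?thesis
    by unfold_locales
      (use add mult single[of x 0 1] in \<open>auto simp: subst_poly_def[of _ _ 0]\<close>)
qed

lemma subst_poly_Const: "comm_ring_hom \<phi> \<Longrightarrow> subst_poly \<phi> x (Const c) = \<phi> c"
  by (simp add: Const_def subst_poly_single)

lemma subst_poly_Var: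
  assumes "comm_ring_hom \<phi>"
  shows "subst_poly \<phi> x (Var i) = x i"
proof -
  interpret comm_ring_hom \<phi> by fact
  have "(\<Prod>j\<in>UNIV. x j ^ lookup (single i 1) j) = (\<Prod>j\<in>UNIV. if j = i then x j else 1)"
    by (rule prod.cong) (auto simp: lookup_single when_def)
  then show ?thesis by (simp add: Var_def xpow_def subst_poly_single[OF assms])
qed

lemma subst_poly_compose:
  assumes "comm_ring_hom \<psi>"
  shows "\<psi> (subst_poly \<phi> x f) = subst_poly (\<lambda>c. \<psi> (\<phi> c)) (\<lambda>i. \<psi> (x i)) f"
proof -
  interpret comm_ring_hom \<psi> by fact
  show ?thesis by (simp add: subst_poly_def hom_sum hom_mult hom_prod hom_power)
qed

definition peval :: "'n::finite rpoly \<Rightarrow> ('n \<Rightarrow> real) \<Rightarrow> real" where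
  "peval f x = subst_poly (\<lambda>c. c) x f"

lemma mpoly_eval_peval: "mpoly_eval f v = peval f (vec_nth v)"
  by (simp add: mpoly_eval_def peval_def)

lemma id_hom: "comm_ring_hom (\<lambda>c::'a::comm_ring_1. c)"
  by unfold_locales auto

interpretation peval_hom: comm_ring_hom "\<lambda>f. peval f x" for x
  unfolding peval_def by (rule subst_poly_hom[OF id_hom])

lemma peval_Const [simp]: "peval (Const c) x = c"
  by (simp add: peval_def subst_poly_Const[OF id_hom])

lemma peval_Var [simp]: "peval (Var i) x = x i"
  by (simp add: peval_def subst_poly_Var[OF id_hom])

lemma peval_xpow: "peval (xpow m) x = (\<Prod>i\<in>UNIV. x i ^ lookup m i)"
  by (simp add: peval_def xpow_def subst_poly_single[OF id_hom])

lemmas peval_simps = peval_hom.hom_add peval_hom.hom_mult peval_hom.hom_sum peval_hom.hom_prod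
  peval_hom.hom_power peval_hom.hom_minus peval_hom.hom_uminus

lemma pCons_const_hom: "comm_ring_hom (\<lambda>c::'a::comm_ring_1. [:c:])"
  by unfold_locales (auto simp: one_pCons)

interpretation line_poly_hom: comm_ring_hom "\<lambda>f. line_poly f e v" for e v
  unfolding line_poly_def by (rule subst_poly_hom[OF pCons_const_hom])

lemma line_poly_Const [simp]: "line_poly (Const c) e v = [:c:]"
  by (simp add: line_poly_def subst_poly_Const[OF pCons_const_hom])

lemma line_poly_Var [simp]: "line_poly (Var i) e v = [:vec_nth v i, vec_nth e i:]"
  by (simp add: line_poly_def subst_poly_Var[OF pCons_const_hom])

lemma poly_hom: "comm_ring_hom (\<lambda>p::'a::comm_ring_1 poly. poly p t)"
  by unfold_locales auto

lemma poly_line_poly: "poly (line_poly f e v) t = mpoly_eval f (v + t *\<^sub>R e)"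
  unfolding line_poly_def mpoly_eval_def
  by (subst subst_poly_compose[OF poly_hom]) (auto intro!: arg_cong2[of _ _ _ _ "\<lambda>x f. subst_poly _ x f"])

section \<open>Partial derivatives\<close>

lemma lookup_partial_deriv:
  "lookup (partial_deriv i f) m
     = real (lookup m i + 1) * lookup f (m + single i 1)"
proof -
  let ?k = "m + single i 1"
  have "lookup (partial_deriv i f) m =
    (\<Sum>n\<in>keys f. real (lookup n i) * lookup f n when n - single i 1 = m)"
    by (simp add: partial_deriv_def lookup_sum lookup_single)
  also have "\<dots> = (\<Sum>n\<in>keys f. real (lookup n i) * lookup f n when n = ?k)"
  proof (rule sum.cong[OF refl])
    fix n :: "'a \<Rightarrow>\<^sub>0 nat"
    show "(real (lookup n i) * lookup f n when n - single i 1 = m) =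
       (real (lookup n i) * lookup f n when n = ?k)"
    proof (cases "lookup n i = 0")
      case False
      then have "n = (n - single i 1) + single i 1"
        by (intro poly_mapping_eqI) (auto simp: lookup_add lookup_minus lookup_single when_def)
      then have "n - single i 1 = m \<longleftrightarrow> n = ?k"
        using add_diff_cancel_right'[of m "single i 1"] by auto
      then show ?thesis by simp
    qed simp
  qed
  also have "\<dots> = real (lookup ?k i) * lookup f ?k"
    by (simp add: when_def in_keys_iff)
  finally show ?thesis by (simp add: lookup_add)
qed

lemma partial_deriv_add: "partial_deriv i (f + g) = partial_deriv i f + partial_deriv i g"
  by (intro poly_mapping_eqI) (simp add: lookup_partial_deriv lookup_add algebra_simps)

lemma partial_deriv_0 [simp]: "partial_deriv i 0 = 0"
  by (intro poly_mapping_eqI) (simp add: lookup_partial_deriv)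

lemma partial_deriv_sum: "partial_deriv i (\<Sum>a\<in>A. f a) = (\<Sum>a\<in>A. partial_deriv i (f a))"
  by (induction A rule: infinite_finite_induct) (auto simp: partial_deriv_add)

lemma partial_deriv_single:
  "partial_deriv i (single m c)
     = single (m - single i 1) (real (lookup m i) * c)"
  unfolding partial_deriv_def by (subst sum_keys_single) auto

lemma partial_deriv_commute: "partial_deriv i (partial_deriv j f) = partial_deriv j (partial_deriv i f)"
  by (intro poly_mapping_eqI, cases "i = j")
    (auto simp: lookup_partial_deriv lookup_add lookup_single add_ac)

lemma partial_deriv_mult:
  "partial_deriv i (f * g) = partial_deriv i f * g + f * partial_deriv i g"
proof (induction f rule: rpoly_induct)
  case (single m c)
  show ?case
  proof (induction g rule: rpoly_induct)
    case (single n b)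
    let ?e = "single i (1::nat)"
    have 1: "m - ?e + n = m + n - ?e" if "lookup m i > 0"
      using that by (intro poly_mapping_eqI) (auto simp: lookup_add lookup_minus lookup_single when_def)
    have 2: "m + (n - ?e) = m + n - ?e" if "lookup n i > 0"
      using that by (intro poly_mapping_eqI) (auto simp: lookup_add lookup_minus lookup_single when_def)
    have 3: "single (m - ?e + n) (real (lookup m i) * c * b)
        = single (m + n - ?e) (real (lookup m i) * c * b)"
      using 1 by (cases "lookup m i > 0") auto
    have 4: "single (m + (n - ?e)) (c * (real (lookup n i) * b))
        = single (m + n - ?e) (c * (real (lookup n i) * b))"
      using 2 by (cases "lookup n i > 0") auto
    show ?case
      by (simp only: mult_single partial_deriv_single 3 4 flip: single_add)
        (simp add: lookup_add algebra_simps)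
  qed (simp add: algebra_simps partial_deriv_add)
qed (simp add: algebra_simps partial_deriv_add)

lemma partial_deriv_Const [simp]: "partial_deriv i (Const c) = 0"
  by (simp add: Const_def partial_deriv_single)

lemma partial_deriv_1 [simp]: "partial_deriv i 1 = 0"
  using partial_deriv_Const[of i 1] by (simp del: partial_deriv_Const)

lemma partial_deriv_Var: "partial_deriv i (Var j) = (if i = j then 1 else 0)"
  by (auto simp: Var_def xpow_def partial_deriv_single lookup_single)

lemma partial_deriv_power: "partial_deriv i (f ^ Suc n) = of_nat (Suc n) * f ^ n * partial_deriv i f"
  by (induction n) (simp_all add: partial_deriv_mult algebra_simps)

lemma pderiv_line_poly:
  "pderiv (line_poly f a v) = (\<Sum>i\<in>UNIV. Polynomial.smult (vec_nth a i) (line_poly (partial_deriv i f) a v))"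
proof (induction f rule: rpoly_induct)
  case (single m c)
  show ?case unfolding single_eq_Const_xpow
  proof (induction m rule: exponent_induct)
    case zero
    then show ?case by (simp add: pderiv_pCons)
  next
    case (add m j)
    define F where "F = Const c * xpow m"
    note IH = add[folded F_def]
    have "pderiv (line_poly (F * Var j) a v) = pderiv (line_poly F a v) * line_poly (Var j) a v
        + line_poly F a v * [:vec_nth a j:]"
      by (simp only: line_poly_hom.hom_mult pderiv_mult line_poly_Var) (simp add: pderiv_pCons)
    also have "\<dots> = (\<Sum>i\<in>UNIV. Polynomial.smult (vec_nth a i) (line_poly (partial_deriv i (F * Var j)) a v))"
    proof -
      have "Polynomial.smult (vec_nth a i) (line_poly (partial_deriv i (F * Var j)) a v) =
          Polynomial.smult (vec_nth a i) (line_poly (partial_deriv i F) a v) * line_poly (Var j) a v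
          + (if i = j then line_poly F a v * [:vec_nth a j:] else 0)" for i
        by (simp add: partial_deriv_mult partial_deriv_Var line_poly_hom.hom_add line_poly_hom.hom_mult
            smult_add_right del: line_poly_Var)
      then show ?thesis
        by (simp add: IH sum.distrib sum_distrib_right del: line_poly_Var mult_pCons_right)
    qed
    finally show ?case by (simp add: F_def xpow_add Var_def mult.assoc)
  qed
next
  case (add f g)
  then show ?case
    by (simp add: line_poly_hom.hom_add pderiv_add partial_deriv_add smult_add_right sum.distrib)
qed

lemma coeff_1_line_poly: "coeff (line_poly f a v) 1 = gradient f v \<bullet> a"
proof -
  have "coeff (line_poly f a v) 1 = poly (pderiv (line_poly f a v)) 0"
    by (simp add: poly_0_coeff_0 coeff_pderiv)
  also have "\<dots> = gradient f v \<bullet> a"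
    by (simp add: pderiv_line_poly poly_sum poly_line_poly gradient_def inner_vec_def mult.commute)
  finally show ?thesis .
qed

text \<open>
  Taylor's formula at the origin: the coefficients are iterated partial derivatives up to nonzero
  factors, and the partial derivatives of a polynomial that vanishes everywhere vanish everywhere, as
  the linear coefficients of its restrictions to lines.
\<close>

lemma mpoly_eval_0_imp_0:
  fixes f :: "'n::finite rpoly"
  assumes "\<And>v. mpoly_eval f v = 0"
  shows "f = 0"
proof (rule poly_mapping_eqI)
  fix m
  show "lookup f m = lookup 0 m"
    using assms
  proof (induction m arbitrary: f rule: exponent_induct)
    case (zero f)
    have "mpoly_eval f 0 = lookup f 0"
    proof (induction f rule: rpoly_induct)
      case (single m c)
      have "(\<Prod>i\<in>UNIV. (0::real) ^ lookup m i) = 0" if "m \<noteq> 0"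
      proof -
        obtain i where "lookup m i \<noteq> 0" using \<open>m \<noteq> 0\<close>
          by (metis lookup_zero poly_mapping_eqI)
        then show ?thesis by (intro prod_zero) (auto intro!: bexI[of _ i])
      qed
      then have "(\<Prod>i\<in>UNIV. (0::real) ^ lookup m i) = (if m = 0 then 1 else 0)"
        by (cases "m = 0") auto
      then show ?case
        by (simp add: mpoly_eval_def subst_poly_single[OF id_hom] lookup_single when_def)
    qed (simp add: mpoly_eval_peval peval_simps lookup_add)
    then show ?case using zero by simp
  next
    case (add m i f)
    have "mpoly_eval (partial_deriv i f) v = 0" for v
    proof -
      have "\<forall>t. poly (line_poly f (axis i 1) v) t = 0"
        using add.prems by (simp add: poly_line_poly)
      then have "line_poly f (axis i 1) v = 0" using poly_all_0_iff_0 by blast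
      then have "gradient f v \<bullet> axis i 1 = 0" using coeff_1_line_poly[of f "axis i 1" v] by simp
      then show ?thesis by (simp add: gradient_def inner_axis)
    qed
    from add.IH[OF this] show ?case by (simp add: lookup_partial_deriv)
  qed
qed

lemma peval_eq_imp_eq:
  fixes f g :: "'n::finite rpoly"
  assumes "\<And>x. peval f x = peval g x"
  shows "f = g"
  using mpoly_eval_0_imp_0[of "f - g"] assms by (simp add: mpoly_eval_peval peval_simps)

section \<open>Forms in a subset of the variables\<close>

definition mdeg :: "('n::finite \<Rightarrow>\<^sub>0 nat) \<Rightarrow> nat" where
  "mdeg m = (\<Sum>i\<in>UNIV. lookup m i)"

lemma mdeg_0 [simp]: "mdeg 0 = 0" by (simp add: mdeg_def)
lemma mdeg_add [simp]: "mdeg (m + n) = mdeg m + mdeg n" by (simp add: mdeg_def lookup_add sum.distrib)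
lemma mdeg_single [simp]: "mdeg (single i k) = k"
  by (simp add: mdeg_def lookup_single when_def)

definition Mon :: "'n::finite set \<Rightarrow> nat \<Rightarrow> ('n \<Rightarrow>\<^sub>0 nat) set" where
  "Mon I d = {m. mdeg m = d \<and> keys m \<subseteq> I}"

text \<open>
  The support bound \<open>I\<close> allows forms on a coordinate hyperplane to be treated as elements of the same
  polynomial ring.  The zero polynomial is a form of every degree.
\<close>

definition form_in :: "'n::finite set \<Rightarrow> nat \<Rightarrow> 'n rpoly \<Rightarrow> bool" where
  "form_in I d f \<longleftrightarrow> keys f \<subseteq> Mon I d"

lemma homogeneous_poly_iff: "homogeneous_poly f \<longleftrightarrow> (\<exists>d. form_in UNIV d f)"
  by (auto simp: homogeneous_poly_def form_in_def Mon_def mdeg_def)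

lemma finite_Mon [simp]: "finite (Mon I d)"
proof -
  have "Mon I d \<subseteq> Poly_Mapping.Abs_poly_mapping ` (UNIV \<rightarrow>\<^sub>E {..d})"
  proof
    fix m assume "m \<in> Mon I d"
    then have "lookup m i \<le> d" for i
      unfolding Mon_def mdeg_def using member_le_sum[of i UNIV "lookup m"] by simp
    then have "lookup m \<in> UNIV \<rightarrow>\<^sub>E {..d}" by auto
    then show "m \<in> Poly_Mapping.Abs_poly_mapping ` (UNIV \<rightarrow>\<^sub>E {..d})"
      by (metis image_eqI lookup_inverse)
  qed
  then show ?thesis 
    by (rule finite_subset) (intro finite_imageI finite_PiE, simp_all)
qed

lemma Mon_add: "m \<in> Mon I d \<Longrightarrow> n \<in> Mon I d' \<Longrightarrow> m + n \<in> Mon I (d + d')"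
  using keys_add[of m n] by (auto simp: Mon_def)

lemma Mon_single: "i \<in> I \<Longrightarrow> single i k \<in> Mon I k"
  by (auto simp: Mon_def)

lemma Mon_0 [simp]: "0 \<in> Mon I 0" by (simp add: Mon_def)

lemma form_in_0 [simp]: "form_in I d 0" by (simp add: form_in_def)

lemma form_in_add: "form_in I d f \<Longrightarrow> form_in I d g \<Longrightarrow> form_in I d (f + g)"
  using keys_add[of f g] by (auto simp: form_in_def)

lemma form_in_sum: "(\<And>a. a \<in> A \<Longrightarrow> form_in I d (f a)) \<Longrightarrow> form_in I d (\<Sum>a\<in>A. f a)"
  by (induction A rule: infinite_finite_induct) (auto intro: form_in_add)

lemma form_in_mult: "form_in I d f \<Longrightarrow> form_in I d' g \<Longrightarrow> form_in I (d + d') (f * g)"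
  using keys_mult[of f g] Mon_add[of _ I d _ d'] unfolding form_in_def by blast

lemma form_in_Const [simp]: "form_in I 0 (Const c)"
  by (auto simp: form_in_def Const_def)

lemma form_in_1 [simp]: "form_in I 0 1"
  using form_in_Const[of I 1] by (simp del: form_in_Const)

lemma form_in_Const_mult: "form_in I d f \<Longrightarrow> form_in I d (Const c * f)"
  using form_in_mult[OF form_in_Const, of I d f c] by simp

lemma form_in_uminus: "form_in I d f \<Longrightarrow> form_in I d (- f)"
  by (simp add: form_in_def)

lemma form_in_diff: "form_in I d f \<Longrightarrow> form_in I d g \<Longrightarrow> form_in I d (f - g)"
  using form_in_add[of I d f "- g"] form_in_uminus by auto

lemma form_in_xpow: "m \<in> Mon I d \<Longrightarrow> form_in I d (xpow m)"
  by (simp add: form_in_def xpow_def)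

lemma form_in_Var: "i \<in> I \<Longrightarrow> form_in I 1 (Var i)"
  unfolding Var_def by (intro form_in_xpow Mon_single)

lemma form_in_power: "form_in I d f \<Longrightarrow> form_in I (d * k) (f ^ k)"
  by (induction k) (auto simp: form_in_mult)

lemma form_in_prod: "(\<And>a. a \<in> A \<Longrightarrow> form_in I (d a) (f a)) \<Longrightarrow> form_in I (\<Sum>a\<in>A. d a) (\<Prod>a\<in>A. f a)"
  by (induction A rule: infinite_finite_induct) (auto intro: form_in_mult)

text \<open>
  Degree zero is excluded because there the predecessor \<open>0 - 1 = 0\<close> would be the wrong degree; the
  derivative then vanishes, which is the next lemma.
\<close>

lemma form_in_partial_deriv: "form_in I (Suc d) f \<Longrightarrow> form_in I d (partial_deriv i f)"
  unfolding form_in_def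
proof
  fix m assume f: "keys f \<subseteq> Mon I (Suc d)" and "m \<in> keys (partial_deriv i f)"
  then have "m + single i 1 \<in> keys f"
    by (auto simp: in_keys_iff lookup_partial_deriv)
  then have "m + single i 1 \<in> Mon I (Suc d)" using f by blast
  moreover have "keys m \<subseteq> keys (m + single i 1)"
    by (auto simp: in_keys_iff lookup_add)
  ultimately show "m \<in> Mon I d" by (auto simp: Mon_def)
qed

lemma form_in_partial_deriv_0: "form_in I 0 f \<Longrightarrow> partial_deriv i f = 0"
proof (rule poly_mapping_eqI)
  fix m assume "form_in I 0 f"
  then have "m + single i 1 \<notin> keys f"
    by (auto simp: form_in_def Mon_def)
  then show "lookup (partial_deriv i f) m = lookup 0 m"
    by (simp add: lookup_partial_deriv in_keys_iff)
qed

lemma form_in_expand: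
  "form_in I d f \<Longrightarrow> f = (\<Sum>m\<in>Mon I d. Const (lookup f m) * xpow m)"
  by (rule rpoly_expand_superset) (auto simp: form_in_def)

lemma peval_xpow_scale: "peval (xpow m) (\<lambda>i. r * x i) = r ^ mdeg m * peval (xpow m) x"
  by (simp add: peval_xpow mdeg_def power_mult_distrib prod.distrib power_sum)

lemma peval_form_scale: "form_in I d f \<Longrightarrow> peval f (\<lambda>i. r * x i) = r ^ d * peval f x"
  by (subst (1 2) form_in_expand, assumption+)
    (auto simp: peval_simps sum_distrib_left peval_xpow_scale Mon_def intro!: sum.cong)

lemma peval_xpow_cong:
  "keys m \<subseteq> I \<Longrightarrow> (\<And>i. i \<in> I \<Longrightarrow> x i = y i) \<Longrightarrow> peval (xpow m) x = peval (xpow m) y"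
  unfolding peval_xpow by (rule prod.cong) (auto simp: in_keys_iff, metis in_keys_iff in_mono power_0)

lemma peval_form_cong:
  "form_in I d f \<Longrightarrow> (\<And>i. i \<in> I \<Longrightarrow> x i = y i) \<Longrightarrow> peval f x = peval f y"
  by (subst (1 2) form_in_expand, assumption+)
    (auto simp: peval_simps Mon_def intro!: sum.cong peval_xpow_cong)

lemma peval_form_zero:
  assumes "form_in I d f" "d > 0" "\<And>i. i \<in> I \<Longrightarrow> x i = 0"
  shows "peval f x = 0"
proof -
  have "peval f x = peval f (\<lambda>i. 0 * x i)"
    by (rule peval_form_cong[OF assms(1)]) (simp add: assms(3))
  also have "\<dots> = 0" using assms by (subst peval_form_scale) auto
  finally show ?thesis .
qed

section \<open>Gaussian expectation of polynomials\<close>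

definition moment :: "nat \<Rightarrow> real" where
  "moment n = (\<integral>x. std_normal_density x * x ^ n \<partial>lborel)"

lemma moment_0 [simp]: "moment 0 = 1"
  unfolding moment_def using integral_std_normal_moment_even[of 0] by simp

lemma moment_Suc: "moment (Suc n) = real n * moment (n - 1)"
proof (cases "even n")
  case True
  then obtain k where n: "n = 2 * k" by (elim evenE)
  have "moment (Suc n) = 0"
    unfolding moment_def n using integral_std_normal_moment_odd[of k] by simp
  moreover have "real n * moment (n - 1) = 0"
  proof (cases k)
    case (Suc l)
    then have "n - 1 = 2 * l + 1" using n by simp
    then show ?thesis unfolding moment_def using integral_std_normal_moment_odd[of l] by simp
  qed (simp add: n)
  ultimately show ?thesis by simp
next
  case False
  then obtain k where n: "n = 2 * k + 1" by (elim oddE)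
  have *: "moment (2 * j) = fact (2 * j) / (2 ^ j * fact j)" for j
    unfolding moment_def by (rule integral_std_normal_moment_even)
  have "moment (Suc n) = fact (2 * Suc k) / (2 ^ Suc k * fact (Suc k))"
    using *[of "Suc k"] by (simp add: n)
  also have "\<dots> = (2 * k + 1) * (fact (2 * k) / (2 ^ k * fact k))"
    by (simp add: divide_simps)
  finally show ?thesis using *[of k] by (simp add: n)
qed

text \<open>
  The expectation of \<open>f(u)\<close> for a vector \<open>u\<close> of independent standard normal variables, given by its
  moments.  The algebraic identities follow from the moments alone; the integral is only needed for
  positivity.
\<close>

definition gauss :: "'n::finite rpoly \<Rightarrow> real" where
  "gauss f = (\<Sum>m\<in>keys f. lookup f m * (\<Prod>i\<in>UNIV. moment (lookup m i)))"

lemma gauss_add: "gauss (f + g) = gauss f + gauss g"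
  unfolding gauss_def by (rule sum_keys_add) (auto simp: algebra_simps)

lemma gauss_single: "gauss (single m c) = c * (\<Prod>i\<in>UNIV. moment (lookup m i))"
  unfolding gauss_def by (subst sum_keys_single) auto

lemma gauss_0 [simp]: "gauss 0 = 0" by (simp add: gauss_def)

lemma gauss_sum: "gauss (\<Sum>a\<in>A. f a) = (\<Sum>a\<in>A. gauss (f a))"
  by (induction A rule: infinite_finite_induct) (auto simp: gauss_add)

lemma gauss_Const_mult: "gauss (Const c * f) = c * gauss f"
  by (induction f rule: rpoly_induct)
    (auto simp: Const_def mult_single gauss_single distrib_left gauss_add)

lemma gauss_uminus: "gauss (- f) = - gauss f"
  using gauss_Const_mult[of "-1" f] by (simp add: Const_hom.hom_uminus)

lemma gauss_diff: "gauss (f - g) = gauss f - gauss g"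
  using gauss_add[of f "- g"] by (simp add: gauss_uminus)

text \<open>
  Stein's identity, that is, Gaussian integration by parts.
\<close>

lemma gauss_Var_mult: "gauss (Var i * f) = gauss (partial_deriv i f)"
proof (induction f rule: rpoly_induct)
  case (single m c)
  let ?e = "single i (1::nat)"
  have split: "(\<Prod>j\<in>UNIV. moment (lookup k j)) =
      moment (lookup k i) * (\<Prod>j\<in>UNIV - {i}. moment (lookup k j))" for k
    by (rule prod.remove) auto
  have "(\<Prod>j\<in>UNIV - {i}. moment (lookup (?e + m) j)) =
      (\<Prod>j\<in>UNIV - {i}. moment (lookup (m - ?e) j))"
    by (rule prod.cong) (auto simp: lookup_add lookup_minus lookup_single)
  note eq = this
  have "Var i * single m c = single (?e + m) c"
    by (simp add: Var_def xpow_def mult_single)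
  then show ?case
    by (simp only: gauss_single partial_deriv_single split[of "?e + m"] split[of "m - ?e"] eq)
      (simp add: lookup_add lookup_minus moment_Suc)
qed (auto simp: distrib_left gauss_add partial_deriv_add)

lemma Var_mult_partial_deriv_xpow:
  "Var i * partial_deriv i (xpow m) = Const (real (lookup m i)) * xpow m"
proof (cases "lookup m i = 0")
  case False
  then have "single i 1 + (m - single i 1) = m"
    by (intro poly_mapping_eqI) (auto simp: lookup_add lookup_minus lookup_single when_def)
  then show ?thesis
    by (simp add: Var_def xpow_def partial_deriv_single mult_single Const_def del: single_of_nat)
qed (simp add: xpow_def partial_deriv_single)

lemma euler_form:
  assumes "form_in I d f"
  shows "(\<Sum>i\<in>I. Var i * partial_deriv i f) = Const (real d) * f"
proof -
  have m: "(\<Sum>i\<in>I. Var i * partial_deriv i (xpow m)) = Const (real d) * xpow m" if "m \<in> Mon I d" for m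
  proof -
    have "(\<Sum>i\<in>I. real (lookup m i)) = (\<Sum>i\<in>UNIV. real (lookup m i))"
      by (rule sum.mono_neutral_left) (use that in \<open>auto simp: Mon_def in_keys_iff\<close>)
    also have "\<dots> = real d" using that by (simp add: Mon_def mdeg_def flip: of_nat_sum)
    finally show ?thesis
      by (simp add: Var_mult_partial_deriv_xpow flip: sum_distrib_right Const_hom.hom_sum)
  qed
  have "(\<Sum>i\<in>I. Var i * partial_deriv i f) =
     (\<Sum>m\<in>Mon I d. Const (lookup f m) * (\<Sum>i\<in>I. Var i * partial_deriv i (xpow m)))"
    by (subst form_in_expand[OF assms])
      (simp add: partial_deriv_sum partial_deriv_mult sum_distrib_left sum_distrib_right mult_ac sum.swap[of _ I])
  also have "\<dots> = Const (real d) * (\<Sum>m\<in>Mon I d. Const (lookup f m) * xpow m)"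
    by (simp add: m sum_distrib_left mult_ac)
  finally show ?thesis using form_in_expand[OF assms] by simp
qed

definition sumsq :: "'n::finite set \<Rightarrow> 'n rpoly" where
  "sumsq I = (\<Sum>i\<in>I. Var i * Var i)"

lemma form_in_sumsq: "form_in I 2 (sumsq I)"
proof -
  have "form_in I (1 + 1) (Var i * Var i)" if "i \<in> I" for i
    by (intro form_in_mult form_in_Var that)
  then show ?thesis unfolding sumsq_def one_add_one by (intro form_in_sum)
qed

text \<open>
  Stein's identity combined with Euler's identity.  It allows a homogeneous polynomial to be multiplied
  by a power of the squared norm at the cost of a known factor, so that terms of different degrees can
  be brought to the same degree.
\<close>

lemma gauss_sumsq_mult:
  assumes "form_in I d f"
  shows "gauss (sumsq I * f) = real (card I + d) * gauss f"
proof -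
  have "gauss (sumsq I * f) = (\<Sum>i\<in>I. gauss (Var i * (Var i * f)))"
    by (simp add: sumsq_def sum_distrib_right gauss_sum mult.assoc)
  also have "\<dots> = (\<Sum>i\<in>I. gauss f + gauss (Var i * partial_deriv i f))"
    by (simp add: gauss_Var_mult partial_deriv_mult partial_deriv_Var gauss_add)
  also have "\<dots> = real (card I) * gauss f + gauss (\<Sum>i\<in>I. Var i * partial_deriv i f)"
    by (simp add: sum.distrib gauss_sum)
  finally show ?thesis
    by (simp only: euler_form[OF assms] gauss_Const_mult) (simp add: algebra_simps)
qed

lemma gauss_sumsq_power_mult:
  assumes "form_in I d f"
  shows "gauss (sumsq I ^ l * f) = (\<Prod>q<l. real (card I + d + 2 * q)) * gauss f"
proof (induction l)
  case (Suc l)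
  have "form_in I (2 * l + d) (sumsq I ^ l * f)"
    by (intro form_in_mult form_in_power form_in_sumsq assms)
  from gauss_sumsq_mult[OF this] show ?case
    by (simp add: mult.assoc Suc)
qed simp

section \<open>Positivity of the Gaussian expectation\<close>

definition normal_measure :: "real measure" where
  "normal_measure = density lborel (\<lambda>x. ennreal (std_normal_density x))"

definition gauss_measure :: "('n::finite \<Rightarrow> real) measure" where
  "gauss_measure = PiM UNIV (\<lambda>_. normal_measure)"

lemma prob_space_normal_measure: "prob_space normal_measure"
  unfolding normal_measure_def by (rule prob_space_normal_density) simp

interpretation normal: prob_space normal_measure
  by (rule prob_space_normal_measure)

interpretation normals: product_sigma_finite "\<lambda>_::'n::finite. normal_measure"
  by unfold_locales

lemma sets_normal_measure [measurable_cong, simp]: "sets normal_measure = sets borel"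
  by (simp add: normal_measure_def)

lemma space_normal_measure [simp]: "space normal_measure = UNIV"
  by (simp add: normal_measure_def)

lemma
  shows integrable_normal_power: "integrable normal_measure (\<lambda>x. x ^ n)"
    and integral_normal_power: "(\<integral>x. x ^ n \<partial>normal_measure) = moment n"
  unfolding normal_measure_def moment_def
  by (simp_all add: integrable_density integral_density integrable_std_normal_moment)

lemma peval_conv_sum:
  "peval f x = (\<Sum>m\<in>keys f. lookup f m * (\<Prod>i\<in>UNIV. x i ^ lookup m i))"
  by (simp add: peval_def subst_poly_def)

lemma
  fixes f :: "'n::finite rpoly"
  shows integrable_peval: "integrable gauss_measure (peval f)"
    and integral_peval: "(\<integral>x. peval f x \<partial>gauss_measure) = gauss f"
proof -
  have *: "integrable gauss_measure (\<lambda>x::'n \<Rightarrow> real. \<Prod>i\<in>UNIV. x i ^ m i)" for m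
    unfolding gauss_measure_def
    by (rule normals.product_integrable_prod) (auto intro: integrable_normal_power)
  have **: "(\<integral>x. (\<Prod>i\<in>UNIV. x i ^ m i) \<partial>gauss_measure) = (\<Prod>i\<in>(UNIV::'n set). moment (m i))" for m
    unfolding gauss_measure_def
    by (subst normals.product_integral_prod) (auto intro: integrable_normal_power simp: integral_normal_power)
  show "integrable gauss_measure (peval f)"
    unfolding peval_conv_sum by (intro Bochner_Integration.integrable_sum integrable_mult_right *)
  show "(\<integral>x. peval f x \<partial>gauss_measure) = gauss f"
    unfolding peval_conv_sum gauss_def
    by (subst Bochner_Integration.integral_sum) (auto intro!: integrable_mult_right * simp: **)
qed

lemma emeasure_normal_open:
  assumes "open U" "x \<in> U"
  shows "emeasure normal_measure U > 0"
proof (rule ccontr)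
  assume "\<not> ?thesis"
  then have "emeasure normal_measure U = 0" by simp
  then have "U \<in> null_sets normal_measure" using assms by (auto intro!: null_setsI)
  then have "AE y in lborel. y \<in> U \<longrightarrow> ennreal (std_normal_density y) = 0"
    unfolding normal_measure_def by (subst (asm) null_sets_density_iff) auto
  then have "AE y in lborel. y \<notin> U"
    by eventually_elim (use normal_density_pos[of 1 0] in \<open>auto simp: ennreal_eq_0_iff dest: leD\<close>)
  then have U: "emeasure lborel U = 0"
    using assms by (subst (asm) AE_iff_measurable[of U]) auto
  obtain e where e: "e > 0" "ball x e \<subseteq> U" using assms open_contains_ball by blast
  have "{x - e<..<x + e} \<subseteq> U" using e by (auto simp: ball_eq_greaterThanLessThan)
  then have "emeasure lborel {x - e<..<x + e} \<le> emeasure lborel U"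
    by (rule emeasure_mono) (use assms in auto)
  then show False using U e by simp
qed

lemma prod_ennreal_pos: "(\<And>i. i \<in> A \<Longrightarrow> f i > 0) \<Longrightarrow> (\<Prod>i\<in>A. f i :: ennreal) > 0"
  by (induction A rule: infinite_finite_induct) (auto simp: ennreal_zero_less_mult_iff)

lemma continuous_on_peval: "continuous_on A (\<lambda>x. peval f x)"
  unfolding peval_conv_sum
  by (intro continuous_intros continuous_on_product_coordinates continuous_on_subset[OF _ subset_UNIV])

lemma gauss_nonneg:
  assumes "\<And>x. peval f x \<ge> 0"
  shows "gauss f \<ge> 0"
  unfolding integral_peval[symmetric] using assms by (intro integral_nonneg_AE) auto

text \<open>
  The normal distribution charges every nonempty open set, and the set where a polynomial does not
  vanish contains an open box.
\<close>

lemma gauss_pos: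
  fixes f :: "'n::finite rpoly"
  assumes nonneg: "\<And>x. peval f x \<ge> 0" and x: "peval f x \<noteq> 0"
  shows "gauss f > 0"
proof (rule ccontr)
  assume "\<not> ?thesis"
  then have "gauss f = 0" using gauss_nonneg[OF nonneg] by simp
  then have AE0: "AE y in gauss_measure. peval f y = 0"
    using integral_nonneg_eq_0_iff_AE[OF integrable_peval[of f]] nonneg by (simp add: integral_peval)
  have "open ((\<lambda>y. peval f y) -` (- {0}))"
    using continuous_on_peval[of UNIV f] by (intro open_vimage) auto
  then have "openin (product_topology (\<lambda>_. euclidean) UNIV) ((\<lambda>y. peval f y) -` (- {0}))"
    by (simp add: euclidean_product_topology)
  from product_topology_open_contains_basis[OF this, of x] x
  obtain X where X: "x \<in> Pi\<^sub>E UNIV X" "\<And>i. open (X i)" "Pi\<^sub>E UNIV X \<subseteq> (\<lambda>y. peval f y) -` (- {0})"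
    by auto
  have "emeasure gauss_measure (Pi\<^sub>E UNIV X) = (\<Prod>i\<in>UNIV. emeasure normal_measure (X i))"
    unfolding gauss_measure_def by (rule normals.emeasure_PiM) (use X in auto)
  moreover have "emeasure normal_measure (X i) > 0" for i
    by (rule emeasure_normal_open[OF X(2), of "x i"]) (use X in auto)
  then have "(\<Prod>i\<in>UNIV. emeasure normal_measure (X i)) \<noteq> 0"
    by (intro prod_ennreal_pos[THEN less_imp_neq, THEN not_sym])
  moreover have "emeasure gauss_measure (Pi\<^sub>E UNIV X) = 0"
  proof -
    have "Pi\<^sub>E UNIV X \<in> sets gauss_measure"
      unfolding gauss_measure_def by (rule sets_PiM_I_finite) (use X in auto)
    moreover have "AE y in gauss_measure. y \<notin> Pi\<^sub>E UNIV X"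
      using AE0 by eventually_elim (use X in auto)
    ultimately show ?thesis
      by (subst (asm) AE_iff_measurable[of "Pi\<^sub>E UNIV X"]) (auto dest: sets.sets_into_space)
  qed
  ultimately show False by simp
qed

section \<open>Hermite polynomials under the Gaussian expectation\<close>

text \<open>
  The linear form \<open>u \<mapsto> \<Sum>\<^sub>i\<^sub>\<in>\<^sub>I x\<^sub>i u\<^sub>i\<close> with parameter \<open>x\<close>; the variables of the polynomial are
  those of \<open>u\<close>.
\<close>

definition lin :: "'n::finite set \<Rightarrow> ('n \<Rightarrow> real) \<Rightarrow> 'n rpoly" where
  "lin I x = (\<Sum>i\<in>I. Const (x i) * Var i)"

lemma form_in_lin: "form_in I 1 (lin I x)"
  unfolding lin_def by (intro form_in_sum form_in_Const_mult form_in_Var)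

lemma form_in_lin_power: "form_in I j (lin I x ^ j)"
  using form_in_power[OF form_in_lin, where k=j] by simp

lemma partial_deriv_lin: "i \<in> I \<Longrightarrow> partial_deriv i (lin I x) = Const (x i)"
  by (simp add: lin_def partial_deriv_sum partial_deriv_mult partial_deriv_Var if_distrib cong: if_cong)

lemma gauss_Var_lin_power:
  assumes "i \<in> I"
  shows "gauss (Var i * f * lin I x ^ j)
    = gauss (partial_deriv i f * lin I x ^ j) + real j * x i * gauss (f * lin I x ^ (j - 1))"
proof (cases j)
  case 0
  then show ?thesis by (simp add: gauss_Var_mult)
next
  case (Suc k)
  have "gauss (Var i * f * lin I x ^ j) = gauss (partial_deriv i (f * lin I x ^ j))"
    by (simp only: mult.assoc gauss_Var_mult)
  also have "partial_deriv i (f * lin I x ^ j)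
      = partial_deriv i f * lin I x ^ j + Const (real j * x i) * (f * lin I x ^ k)"
    using assms unfolding Suc
    by (simp only: partial_deriv_mult[of i f] partial_deriv_power partial_deriv_lin Const_hom.hom_mult
        Const_hom.hom_of_nat mult_ac)
  finally show ?thesis by (simp only: gauss_add gauss_Const_mult) (simp add: Suc)
qed

definition laplacian :: "'n::finite set \<Rightarrow> 'n rpoly \<Rightarrow> 'n rpoly" where
  "laplacian I f = (\<Sum>i\<in>I. partial_deriv i (partial_deriv i f))"

lemma laplacian_add: "laplacian I (f + g) = laplacian I f + laplacian I g"
  by (simp add: laplacian_def partial_deriv_add sum.distrib)

lemma laplacian_Const_mult: "laplacian I (Const c * f) = Const c * laplacian I f"
  by (simp add: laplacian_def partial_deriv_mult sum_distrib_left)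

lemma laplacian_pow_add: "(laplacian I ^^ l) (f + g) = (laplacian I ^^ l) f + (laplacian I ^^ l) g"
  by (induction l) (auto simp: laplacian_add)

lemma laplacian_pow_Const_mult: "(laplacian I ^^ l) (Const c * f) = Const c * (laplacian I ^^ l) f"
  by (induction l) (auto simp: laplacian_Const_mult)

lemma laplacian_0 [simp]: "laplacian I 0 = 0"
  by (simp add: laplacian_def)

lemma partial_deriv_laplacian: "partial_deriv j (laplacian I f) = laplacian I (partial_deriv j f)"
  by (simp add: laplacian_def partial_deriv_sum partial_deriv_commute[of j])

lemma laplacian_Var_mult:
  assumes "i \<in> I"
  shows "laplacian I (Var i * f) = Var i * laplacian I f + Const 2 * partial_deriv i f"
proof -
  have "partial_deriv k (partial_deriv k (Var i * f))
      = Var i * partial_deriv k (partial_deriv k f) + (if k = i then Const 2 * partial_deriv i f else 0)" for k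
  proof -
    have "Const 2 = (1 + 1 :: 'a rpoly)"
      by (metis Const_hom.hom_add Const_hom.hom_one one_add_one)
    then show ?thesis
      by (simp add: partial_deriv_mult partial_deriv_Var partial_deriv_add distrib_right)
  qed
  then show ?thesis using assms by (simp add: laplacian_def sum.distrib sum_distrib_left)
qed

text \<open>
  The commutator of a power of the Laplacian with multiplication by a variable.
\<close>

lemma laplacian_pow_Var_mult:
  assumes "i \<in> I"
  shows "(laplacian I ^^ l) (Var i * f)
    = Var i * (laplacian I ^^ l) f + Const (2 * real l) * partial_deriv i ((laplacian I ^^ (l - 1)) f)"
proof (induction l)
  case (Suc l)
  have l: "Const (2 * real l) * laplacian I (partial_deriv i ((laplacian I ^^ (l - 1)) f))
      = Const (2 * real l) * partial_deriv i ((laplacian I ^^ l) f)"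
  proof (cases l)
    case (Suc k)
    then show ?thesis by (simp add: partial_deriv_laplacian)
  qed simp
  have "(laplacian I ^^ Suc l) (Var i * f) = Var i * (laplacian I ^^ Suc l) f
      + Const 2 * partial_deriv i ((laplacian I ^^ l) f) + Const (2 * real l) * partial_deriv i ((laplacian I ^^ l) f)"
    using Suc by (simp only: funpow.simps comp_apply laplacian_add laplacian_Var_mult[OF assms] laplacian_Const_mult l)
  also have "\<dots> = Var i * (laplacian I ^^ Suc l) f + Const (2 + 2 * real l) * partial_deriv i ((laplacian I ^^ l) f)"
    by (simp only: Const_hom.hom_add distrib_right add.assoc)
  finally show ?case by (simp add: distrib_left)
qed simp

text \<open>
  The term of index \<open>l\<close> of \<open>exp(-\<Delta>/2) f\<close>.  Applied to a monomial the whole series gives a product of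
  Hermite polynomials, and \<open>herm\<close> isolates its part of degree \<open>2 l\<close> below the top.
\<close>

definition herm :: "'n::finite set \<Rightarrow> nat \<Rightarrow> 'n rpoly \<Rightarrow> 'n rpoly" where
  "herm I l f = Const ((- 1 / 2) ^ l / fact l) * (laplacian I ^^ l) f"

lemma herm_0 [simp]: "herm I 0 f = f"
  by (simp add: herm_def)

lemma herm_add: "herm I l (f + g) = herm I l f + herm I l g"
  by (simp add: herm_def laplacian_pow_add distrib_left)

lemma herm_Const_mult: "herm I l (Const c * f) = Const c * herm I l f"
  unfolding herm_def laplacian_pow_Const_mult by (rule mult.left_commute)

lemma herm_sum: "herm I l (\<Sum>a\<in>A. f a) = (\<Sum>a\<in>A. herm I l (f a))"
  using herm_Const_mult[of I l 0 0]
  by (induction A rule: infinite_finite_induct) (auto simp: herm_add)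

text \<open>
  The three-term recursion of the Hermite polynomials.
\<close>

lemma herm_Suc_Var_mult:
  assumes "i \<in> I"
  shows "herm I (Suc l) (Var i * f) = Var i * herm I (Suc l) f - partial_deriv i (herm I l f)"
proof -
  let ?c = "\<lambda>l. (- 1 / 2 :: real) ^ l / fact l"
  have c: "?c (Suc l) * (2 * real (Suc l)) = - ?c l"
    by (simp add: divide_simps)
  have "herm I (Suc l) (Var i * f) = Var i * herm I (Suc l) f
      + Const (?c (Suc l) * (2 * real (Suc l))) * partial_deriv i ((laplacian I ^^ l) f)"
    unfolding herm_def laplacian_pow_Var_mult[OF assms] Const_hom.hom_mult
    by (simp only: distrib_left mult_ac diff_Suc_1)
  also have "Const (?c (Suc l) * (2 * real (Suc l))) * partial_deriv i ((laplacian I ^^ l) f)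
      = - partial_deriv i (herm I l f)"
    unfolding c herm_def by (simp add: partial_deriv_mult Const_hom.hom_uminus)
  finally show ?thesis by simp
qed

lemma form_in_laplacian: "form_in I d f \<Longrightarrow> form_in I (d - 2) (laplacian I f)"
proof -
  assume f: "form_in I d f"
  have "form_in I (d - 2) (partial_deriv i (partial_deriv i f))" for i
  proof (cases "d \<ge> 2")
    case True
    then obtain k where d: "d = Suc (Suc k)" by (metis add_2_eq_Suc le_Suc_ex)
    show ?thesis using f unfolding d by (auto intro!: form_in_partial_deriv)
  next
    case False
    then have "d = 0 \<or> d = Suc 0" by linarith
    then have "partial_deriv i (partial_deriv i f) = 0"
      using f by (metis form_in_partial_deriv form_in_partial_deriv_0 partial_deriv_0)
    then show ?thesis by simp
  qed
  then show ?thesis unfolding laplacian_def by (intro form_in_sum)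
qed

lemma form_in_laplacian_pow: "form_in I d f \<Longrightarrow> form_in I (d - 2 * l) ((laplacian I ^^ l) f)"
proof (induction l)
  case (Suc l)
  have "d - 2 * Suc l = d - 2 * l - 2" by simp
  then show ?case using form_in_laplacian[of I "d - 2 * l" "(laplacian I ^^ l) f"] Suc by simp
qed simp

lemma laplacian_small: "form_in I d f \<Longrightarrow> d < 2 \<Longrightarrow> laplacian I f = 0"
proof -
  assume f: "form_in I d f" and "d < 2"
  then have "d = 0 \<or> d = Suc 0" by linarith
  then have "partial_deriv i (partial_deriv i f) = 0" for i
    using f by (metis form_in_partial_deriv form_in_partial_deriv_0 partial_deriv_0)
  then show ?thesis by (simp add: laplacian_def)
qed

lemma laplacian_pow_vanish: "form_in I d f \<Longrightarrow> d < 2 * l \<Longrightarrow> (laplacian I ^^ l) f = 0"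
proof (induction l)
  case (Suc l)
  show ?case
  proof (cases "d < 2 * l")
    case True
    then show ?thesis using Suc by simp
  next
    case False
    then have "d - 2 * l < 2" using Suc by simp
    then show ?thesis using laplacian_small[OF form_in_laplacian_pow[OF Suc.prems(1)]] by simp
  qed
qed simp

lemma form_in_herm: "form_in I d f \<Longrightarrow> form_in I (d - 2 * l) (herm I l f)"
  unfolding herm_def by (intro form_in_Const_mult form_in_laplacian_pow)

lemma herm_vanish: "form_in I d f \<Longrightarrow> d < 2 * l \<Longrightarrow> herm I l f = 0"
  by (simp add: herm_def laplacian_pow_vanish)

text \<open>
  This is \<open>E[He\<^sub>m(u) exp(u \<bullet> x)] = x\<^sup>m E[exp(u \<bullet> x)]\<close>, separated by degree in \<open>x\<close>.  By the recursion and
  Stein's identity, a further variable \<open>u\<^sub>i\<close> in the Hermite polynomial only differentiates the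
  exponential, which produces the factor \<open>x\<^sub>i\<close>.  The sum may run beyond the degree because the extra
  terms vanish; the induction needs this slack.
\<close>

lemma gauss_herm_xpow:
  assumes "m \<in> Mon I d" "d \<le> L" "d \<le> j"
  shows "(\<Sum>l\<le>L. gauss (herm I l (xpow m) * lin I x ^ j)) / fact j
    = peval (xpow m) x * (gauss (lin I x ^ (j - d)) / fact (j - d))"
  using assms
proof (induction m arbitrary: d j L rule: exponent_induct)
  case zero
  then have d: "d = 0" by (simp add: Mon_def)
  have "(\<Sum>l\<le>L. gauss (herm I l (xpow 0) * lin I x ^ j)) = (\<Sum>l\<in>{0}. gauss (herm I l (xpow 0) * lin I x ^ j))"
    by (rule sum.mono_neutral_right) (auto simp: herm_vanish[of I 0])
  then show ?case by (simp add: d)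
next
  case (add m i)
  let ?g = "xpow m" and ?p = "lin I x"
  have i: "i \<in> I" and m: "m \<in> Mon I (d - 1)" and d: "d > 0"
    using add.prems(1) by (auto simp: Mon_def in_keys_iff lookup_add lookup_single subset_eq)
  obtain L' where L: "L = Suc L'" using add.prems d by (cases L) auto
  obtain k where j: "j = Suc k" using add.prems d by (cases j) auto
  have g: "form_in I (d - 1) ?g" using m by (rule form_in_xpow)
  have "(\<Sum>l\<le>L. gauss (herm I l (Var i * ?g) * ?p ^ j)) =
     gauss (Var i * ?g * ?p ^ j) + (\<Sum>l\<le>L'. gauss (Var i * herm I (Suc l) ?g * ?p ^ j))
       - (\<Sum>l\<le>L'. gauss (partial_deriv i (herm I l ?g) * ?p ^ j))"
    unfolding L sum.atMost_Suc_shift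
    by (simp add: herm_Suc_Var_mult[OF i] left_diff_distrib gauss_diff sum_subtractf)
  also have "gauss (Var i * ?g * ?p ^ j) + (\<Sum>l\<le>L'. gauss (Var i * herm I (Suc l) ?g * ?p ^ j))
      = (\<Sum>l\<le>L. gauss (Var i * herm I l ?g * ?p ^ j))"
    unfolding L sum.atMost_Suc_shift by simp
  also have "\<dots> = (\<Sum>l\<le>L. gauss (partial_deriv i (herm I l ?g) * ?p ^ j))
      + real j * x i * (\<Sum>l\<le>L. gauss (herm I l ?g * ?p ^ k))"
    by (simp only: gauss_Var_lin_power[OF i] sum.distrib sum_distrib_left j diff_Suc_1)
  also have "(\<Sum>l\<le>L. gauss (partial_deriv i (herm I l ?g) * ?p ^ j))
      = (\<Sum>l\<le>L'. gauss (partial_deriv i (herm I l ?g) * ?p ^ j))"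
  proof -
    have "herm I L ?g = 0" by (rule herm_vanish[OF g]) (use add.prems d in auto)
    then show ?thesis by (simp add: L)
  qed
  finally have "(\<Sum>l\<le>L. gauss (herm I l (Var i * ?g) * ?p ^ j)) / fact j
      = x i * ((\<Sum>l\<le>L. gauss (herm I l ?g * ?p ^ k)) / fact k)"
    by (simp add: j)
  also have "(\<Sum>l\<le>L. gauss (herm I l ?g * ?p ^ k)) / fact k
      = peval ?g x * (gauss (?p ^ (k - (d - 1))) / fact (k - (d - 1)))"
    by (rule add.IH[OF m]) (use add.prems j d in auto)
  also have "k - (d - 1) = j - d" using j d by simp
  finally show ?case
    by (simp only: xpow_add mult.commute[of ?g] peval_simps peval_Var mult.assoc flip: Var_def)
qed

text \<open>
  The right-hand factor does not depend on \<open>f\<close> except through the difference \<open>j - d\<close>.  Entries of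
  different degree, tested against powers with the same difference, therefore all reproduce their
  argument up to one and the same function of \<open>x\<close>.
\<close>

lemma gauss_herm:
  assumes f: "form_in I d f" and "d \<le> j"
  shows "(\<Sum>l\<le>d. gauss (herm I l f * lin I x ^ j)) / fact j
    = peval f x * (gauss (lin I x ^ (j - d)) / fact (j - d))"
proof -
  let ?c = "lookup f" and ?p = "lin I x"
  have fx: "f = (\<Sum>m\<in>Mon I d. Const (?c m) * xpow m)" by (rule form_in_expand[OF f])
  have "gauss (herm I l f * ?p ^ j) = (\<Sum>m\<in>Mon I d. ?c m * gauss (herm I l (xpow m) * ?p ^ j))" for l
    by (subst fx) (simp add: herm_sum herm_Const_mult sum_distrib_right gauss_sum mult.assoc gauss_Const_mult)
  then have "(\<Sum>l\<le>d. gauss (herm I l f * ?p ^ j)) / fact j =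
      (\<Sum>m\<in>Mon I d. ?c m * ((\<Sum>l\<le>d. gauss (herm I l (xpow m) * ?p ^ j)) / fact j))"
    by (simp add: sum_divide_distrib sum_distrib_left sum.swap[of _ "Mon I d"])
  also have "\<dots> = (\<Sum>m\<in>Mon I d. ?c m * (peval (xpow m) x * (gauss (?p ^ (j - d)) / fact (j - d))))"
    by (intro sum.cong refl arg_cong2[of _ _ _ _ "(*)"] gauss_herm_xpow) (use assms in auto)
  also have "\<dots> = peval (\<Sum>m\<in>Mon I d. Const (?c m) * xpow m) x * (gauss (?p ^ (j - d)) / fact (j - d))"
    by (simp add: peval_simps sum_distrib_right sum_divide_distrib mult.assoc)
  finally show ?thesis using fx by simp
qed

definition corr_coeff :: "'n::finite set \<Rightarrow> nat \<Rightarrow> nat \<Rightarrow> nat \<Rightarrow> real" where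
  "corr_coeff I d j l = inverse (\<Prod>q<l. real (card I + (d - 2 * l + j) + 2 * q))"

text \<open>
  All terms of the Hermite polynomial of \<open>f\<close> raised to degree \<open>d\<close> by powers of the squared norm.  The
  coefficients undo the factors of \<open>gauss_sumsq_power_mult\<close> for test polynomials of degree \<open>j\<close>.
\<close>

definition corrected :: "'n::finite set \<Rightarrow> nat \<Rightarrow> nat \<Rightarrow> 'n rpoly \<Rightarrow> 'n rpoly" where
  "corrected I d j f = (\<Sum>l\<le>d. Const (corr_coeff I d j l) * (sumsq I ^ l * herm I l f))"

lemma form_in_corrected:
  assumes "form_in I d f"
  shows "form_in I d (corrected I d j f)"
proof -
  have "form_in I d (sumsq I ^ l * herm I l f)" for l
  proof (cases "d < 2 * l")
    case False
    then have "form_in I (2 * l + (d - 2 * l)) (sumsq I ^ l * herm I l f)"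
      by (intro form_in_mult form_in_power form_in_sumsq form_in_herm assms)
    then show ?thesis using False by simp
  qed (simp add: herm_vanish[OF assms])
  then show ?thesis unfolding corrected_def by (intro form_in_sum form_in_Const_mult)
qed

lemma prod_nonzeroI:
  fixes f :: "'a \<Rightarrow> real"
  shows "(\<And>a. a \<in> A \<Longrightarrow> f a \<noteq> 0) \<Longrightarrow> (\<Prod>a\<in>A. f a) \<noteq> 0"
  by (induction A rule: infinite_finite_induct) auto

lemma gauss_corrected:
  assumes f: "form_in I d f" and I: "I \<noteq> {}" and "d \<le> j"
  shows "gauss (corrected I d j f * lin I x ^ j) / fact j
    = peval f x * (gauss (lin I x ^ (j - d)) / fact (j - d))"
proof -
  let ?p = "lin I x ^ j"
  have "gauss (Const (corr_coeff I d j l) * (sumsq I ^ l * herm I l f) * ?p) = gauss (herm I l f * ?p)" for l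
  proof -
    have "form_in I (d - 2 * l + j) (herm I l f * ?p)"
      by (intro form_in_mult form_in_herm form_in_lin_power f)
    from gauss_sumsq_power_mult[OF this, of l]
    have "gauss (sumsq I ^ l * (herm I l f * ?p)) = inverse (corr_coeff I d j l) * gauss (herm I l f * ?p)"
      by (simp add: corr_coeff_def)
    moreover have "corr_coeff I d j l \<noteq> 0"
      using I card_gt_0_iff[of I] unfolding corr_coeff_def inverse_nonzero_iff_nonzero
      by (intro prod_nonzeroI) auto
    ultimately show ?thesis by (simp add: mult.assoc gauss_Const_mult)
  qed
  then show ?thesis
    using gauss_herm[OF f \<open>d \<le> j\<close>, of x]
    by (simp add: corrected_def sum_distrib_right gauss_sum)
qed

lemma corr_coeff_0 [simp]: "corr_coeff I d j 0 = 1"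
  by (simp add: corr_coeff_def)

text \<open>
  Already the factor \<open>q = 0\<close> of the denominator is at least \<open>j\<close>, so every correction term disappears
  as the degree of the test polynomials grows.
\<close>

lemma corr_coeff_bound:
  assumes "I \<noteq> {}" "l > 0" "j > 0"
  shows "\<bar>corr_coeff I d j l\<bar> \<le> 1 / real j"
proof -
  obtain k where l: "l = Suc k" using assms by (cases l) auto
  let ?a = "\<lambda>q. real (card I + (d - 2 * l + j) + 2 * q)"
  have I: "card I > 0" using assms by (simp add: card_gt_0_iff)
  have "(\<Prod>q<k. ?a (Suc q)) \<ge> 1" by (rule prod_ge_1) (use I in auto)
  then have "real j * 1 \<le> ?a 0 * (\<Prod>q<k. ?a (Suc q))"
    by (intro mult_mono) auto
  also have "\<dots> = (\<Prod>q<l. ?a q)" unfolding l by (simp only: prod.lessThan_Suc_shift)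
  finally have "real j \<le> (\<Prod>q<l. ?a q)" by simp
  then show ?thesis using assms(3)
    by (simp add: corr_coeff_def inverse_eq_divide frac_le)
qed

lemma peval_bounded:
  obtains C where "C \<ge> 0" "\<And>u. (\<And>i. \<bar>u i\<bar> \<le> 1) \<Longrightarrow> \<bar>peval f u\<bar> \<le> C"
proof
  let ?C = "\<Sum>m\<in>keys f. \<bar>lookup f m\<bar>"
  show "?C \<ge> 0" by (simp add: sum_nonneg)
  fix u :: "'a \<Rightarrow> real" assume u: "\<And>i. \<bar>u i\<bar> \<le> 1"
  have "\<bar>\<Prod>i\<in>UNIV. u i ^ lookup m i\<bar> \<le> 1" for m
    unfolding abs_prod using u by (intro prod_le_1) (auto simp: power_abs intro: power_le_one)
  then show "\<bar>peval f u\<bar> \<le> ?C"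
    unfolding peval_conv_sum
    by (intro order_trans[OF sum_abs] sum_mono) (simp add: abs_mult mult_left_le)
qed

lemma corrected_tendsto:
  assumes I: "I \<noteq> {}" and "\<epsilon> > 0"
  shows "\<forall>\<^sub>F j in sequentially. \<forall>u. (\<forall>i. \<bar>u i\<bar> \<le> 1) \<longrightarrow> \<bar>peval (corrected I d j f) u - peval f u\<bar> \<le> \<epsilon>"
proof -
  have "\<exists>C. C \<ge> 0 \<and> (\<forall>u. (\<forall>i. \<bar>u i\<bar> \<le> 1) \<longrightarrow> \<bar>peval (sumsq I ^ l * herm I l f) u\<bar> \<le> C)" for l
    using peval_bounded[of "sumsq I ^ l * herm I l f"] by metis
  then obtain C where C: "\<And>l. C l \<ge> 0"
    "\<And>l u. (\<And>i. \<bar>u i\<bar> \<le> 1) \<Longrightarrow> \<bar>peval (sumsq I ^ l * herm I l f) u\<bar> \<le> C l"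
    by metis
  have "((\<lambda>j. (\<Sum>l\<in>{1..d}. C l) / real j) \<longlongrightarrow> 0) sequentially"
    by (rule lim_const_over_n)
  then have "\<forall>\<^sub>F j in sequentially. (\<Sum>l\<in>{1..d}. C l) / real j < \<epsilon>"
    using \<open>\<epsilon> > 0\<close> by (rule order_tendstoD)
  moreover have "\<forall>\<^sub>F j in sequentially. j > (0::nat)" by (rule eventually_gt_at_top)
  ultimately show ?thesis
  proof eventually_elim
    case (elim j)
    show ?case
    proof (intro allI impI)
      fix u :: "'a \<Rightarrow> real" assume u: "\<forall>i. \<bar>u i\<bar> \<le> 1"
      let ?t = "\<lambda>l. corr_coeff I d j l * peval (sumsq I ^ l * herm I l f) u"
      have "{..d} = insert 0 {1..d}" by auto
      then have "peval (corrected I d j f) u = peval f u + (\<Sum>l\<in>{1..d}. ?t l)"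
        by (simp add: corrected_def peval_simps)
      moreover have "\<bar>\<Sum>l\<in>{1..d}. ?t l\<bar> \<le> (\<Sum>l\<in>{1..d}. (1 / real j) * C l)"
        unfolding abs_mult
        by (intro order_trans[OF sum_abs] sum_mono, unfold abs_mult)
          (intro mult_mono corr_coeff_bound C I, use elim u in auto)
      ultimately show "\<bar>peval (corrected I d j f) u - peval f u\<bar> \<le> \<epsilon>"
        using elim(1) by (simp add: sum_divide_distrib)
    qed
  qed
qed

section \<open>The Bezoutian\<close>

text \<open>
  The coefficient of \<open>s\<^sup>a t\<^sup>b\<close> in \<open>(H(s) H'(t) - H'(s) H(t)) / (s - t)\<close>, where \<open>H\<close> has coefficients \<open>h\<close>.
  It is an integer polynomial in the coefficients, so it can be formed over a polynomial ring and
  evaluated afterwards.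
\<close>

definition bezoutian :: "(nat \<Rightarrow> 'a::comm_ring_1) \<Rightarrow> nat \<Rightarrow> nat \<Rightarrow> 'a" where
  "bezoutian h a b = (\<Sum>i\<le>a. of_nat (a - i + 1) * h (a - i + 1) * h (b + 1 + i)
     - of_nat (b + 2 + i) * h (b + 2 + i) * h (a - i))"

lemma bezoutian_0: "bezoutian h 0 b = h 1 * h (b + 1) - of_nat (b + 2) * h (b + 2) * h 0"
  by (simp add: bezoutian_def)

lemma bezoutian_Suc: "bezoutian h (Suc a) b = bezoutian h a (Suc b)
    + (of_nat (a + 2) * h (a + 2) * h (b + 1) - of_nat (b + 2) * h (b + 2) * h (a + 1))"
  unfolding bezoutian_def sum.atMost_Suc_shift by (simp add: algebra_simps)

text \<open>
  Multiplication by \<open>s - t\<close> gives a recursion that determines the Bezoutian from its numerator.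
\<close>

lemma bezoutian_unique:
  assumes 0: "\<And>b. C 0 b = h 1 * h (b + 1) - of_nat (b + 2) * h (b + 2) * h 0"
    and Suc: "\<And>a b. C (Suc a) b = C a (Suc b)
      + (of_nat (a + 2) * h (a + 2) * h (b + 1) - of_nat (b + 2) * h (b + 2) * h (a + 1))"
  shows "bezoutian h a b = C a b"
  by (induction a arbitrary: b) (simp_all only: 0 Suc bezoutian_0 bezoutian_Suc)

lemma (in comm_ring_hom) hom_bezoutian: "hom (bezoutian h a b) = bezoutian (\<lambda>i. hom (h i)) a b"
  by (simp add: bezoutian_def hom_distribs)

lemma form_in_of_nat_mult: "form_in I d f \<Longrightarrow> form_in I d (of_nat n * f)"
  using form_in_Const_mult[of I d f "of_nat n"] by (simp add: Const_hom.hom_of_nat)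

lemma form_in_bezoutian:
  assumes h: "\<And>a. a \<le> d \<Longrightarrow> form_in I (d - a) (h a)" "\<And>a. a > d \<Longrightarrow> h a = 0" and ab: "a < d" "b < d"
  shows "form_in I (2 * d - 2 - a - b) (bezoutian h a b)"
proof -
  have *: "form_in I (2 * d - p - q) (of_nat n * h p * h q)" for p q n
  proof (cases "p \<le> d \<and> q \<le> d")
    case True
    then have "form_in I ((d - p) + (d - q)) (of_nat n * h p * h q)"
      by (intro form_in_mult form_in_of_nat_mult h) auto
    moreover have "(d - p) + (d - q) = 2 * d - p - q" using True by auto
    ultimately show ?thesis by simp
  qed (use h(2) in \<open>auto simp: not_le\<close>)
  show ?thesis
    unfolding bezoutian_def
  proof (intro form_in_sum form_in_diff)
    fix i assume "i \<in> {..a}"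
    then have "2 * d - (a - i + 1) - (b + 1 + i) = 2 * d - 2 - a - b"
      "2 * d - (b + 2 + i) - (a - i) = 2 * d - 2 - a - b" by auto
    then show "form_in I (2 * d - 2 - a - b) (of_nat (a - i + 1) * h (a - i + 1) * h (b + 1 + i))"
      "form_in I (2 * d - 2 - a - b) (of_nat (b + 2 + i) * h (b + 2 + i) * h (a - i))"
      using * by metis+
  qed
qed

text \<open>
  All complex roots are real and simple.
\<close>

definition split_simple :: "real poly \<Rightarrow> bool" where
  "split_simple p \<longleftrightarrow> p \<noteq> 0 \<and> card {r. poly p r = 0} = degree p"

text \<open>
  The quotient of \<open>p\<close> by the linear factor of the root \<open>r\<close>, as a product over the other roots.
\<close>

definition root_quot :: "real poly \<Rightarrow> real \<Rightarrow> real poly" where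
  "root_quot p r = Polynomial.smult (lead_coeff p) (\<Prod>s\<in>{s. poly p s = 0} - {r}. [:- s, 1:])"

lemma prod_linear_dvd:
  fixes p :: "real poly"
  assumes "finite R" "\<And>r. r \<in> R \<Longrightarrow> poly p r = 0"
  shows "(\<Prod>r\<in>R. [:- r, 1:]) dvd p"
  using assms
proof (induction R arbitrary: p rule: finite_induct)
  case (insert r R)
  then obtain q where q: "p = [:- r, 1:] * q" by (metis poly_eq_0_iff_dvd dvdE insertI1)
  have "poly q s = 0" if "s \<in> R" for s
  proof -
    have "poly p s = 0" "s \<noteq> r" using insert that by auto
    then show ?thesis by (auto simp: q)
  qed
  then have "(\<Prod>r\<in>R. [:- r, 1:]) dvd q" using insert by blast
  then have "[:- r, 1:] * (\<Prod>r\<in>R. [:- r, 1:]) dvd [:- r, 1:] * q" by (rule mult_dvd_mono[OF dvd_refl])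
  then show ?case by (simp only: q prod.insert[OF insert.hyps])
qed simp

lemma smult_sum_right: "Polynomial.smult c (\<Sum>a\<in>A. f a) = (\<Sum>a\<in>A. Polynomial.smult c (f a))"
  by (induction A rule: infinite_finite_induct) (auto simp: smult_add_right)

lemma degree_prod_linear: "finite R \<Longrightarrow> degree (\<Prod>r\<in>R. [:- r, 1::real:]) = card R"
  by (subst degree_prod_eq_sum_degree) auto

lemma lead_coeff_prod_linear: "lead_coeff (\<Prod>r\<in>R. [:- r, 1::real:]) = 1"
  by (simp add: lead_coeff_prod)

context
  fixes p :: "real poly" and R d
  assumes split: "split_simple p"
  defines "R \<equiv> {r. poly p r = 0}" and "d \<equiv> degree p"
begin

lemma finite_R: "finite R"
  using split poly_roots_finite unfolding split_simple_def R_def by blast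

lemma split_eq: "p = Polynomial.smult (lead_coeff p) (\<Prod>r\<in>R. [:- r, 1:])"
proof -
  obtain q where q: "p = (\<Prod>r\<in>R. [:- r, 1:]) * q"
    using prod_linear_dvd[OF finite_R, of p] by (auto simp: R_def)
  have nz: "p \<noteq> 0" "card R = degree p" using split by (auto simp: split_simple_def R_def)
  then have "q \<noteq> 0" using q by auto
  then have "degree p = card R + degree q"
    by (subst q, subst degree_mult_eq) (auto simp: degree_prod_linear[OF finite_R] finite_R)
  then obtain c where c: "q = [:c:]" using nz by (metis add_cancel_right_right degree_eq_zeroE)
  have "lead_coeff p = c" unfolding q c by (simp add: lead_coeff_mult lead_coeff_prod_linear)
  moreover have "p = Polynomial.smult c (\<Prod>r\<in>R. [:- r, 1:])"
    unfolding q c by simp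
  ultimately show ?thesis by metis
qed

lemma root_quot_mult: "r \<in> R \<Longrightarrow> p = [:- r, 1:] * root_quot p r"
  unfolding root_quot_def R_def[symmetric] mult_smult_right
  by (subst prod.remove[OF finite_R, symmetric]) (auto simp flip: split_eq)

lemma pderiv_eq_sum_root_quot: "pderiv p = (\<Sum>r\<in>R. root_quot p r)"
  by (subst split_eq)
    (simp add: pderiv_smult pderiv_prod pderiv_pCons root_quot_def R_def pCons_0_0 one_pCons[symmetric] smult_sum_right)

lemma coeff_p:
  assumes "r \<in> R"
  shows "coeff p a
    = (if a = 0 then 0 else coeff (root_quot p r) (a - 1)) - r * coeff (root_quot p r) a"
proof -
  have "coeff p a = coeff ([:- r, 1:] * root_quot p r) a"
    using root_quot_mult[OF assms] by simp
  also have "\<dots> = coeff (pCons 0 (root_quot p r)) a - r * coeff (root_quot p r) a"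
    by simp
  finally show ?thesis by (simp add: coeff_pCons split: nat.splits)
qed

lemma coeff_p_deriv:
  "real (a + 1) * coeff p (a + 1) = (\<Sum>r\<in>R. coeff (root_quot p r) a)"
  using arg_cong[OF pderiv_eq_sum_root_quot, of "\<lambda>q. coeff q a"]
  by (simp add: coeff_pderiv Polynomial.coeff_sum)

text \<open>
  With \<open>\<ell>\<^sub>r = H(t) / (t - r)\<close> one has \<open>H' = \<Sum>\<^sub>r \<ell>\<^sub>r\<close>, hence the numerator of the Bezoutian is
  \<open>(s - t) \<Sum>\<^sub>r \<ell>\<^sub>r(s) \<ell>\<^sub>r(t)\<close>.
\<close>

lemma bezoutian_eq_sum_root_quot:
  "bezoutian (coeff p) a b
    = (\<Sum>r\<in>R. coeff (root_quot p r) a * coeff (root_quot p r) b)"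
proof (rule bezoutian_unique)
  let ?l = "\<lambda>r. coeff (root_quot p r)" and ?h = "coeff p"
  have h: "?h a * (\<Sum>r\<in>R. ?l r b) = (\<Sum>r\<in>R. ((if a = 0 then 0 else ?l r (a - 1)) - r * ?l r a) * ?l r b)" for a b
    unfolding sum_distrib_left by (intro sum.cong refl) (use coeff_p in simp)
  have N: "real (a + 1) * ?h (a + 1) * ?h b - real (b + 1) * ?h (b + 1) * ?h a
     = (\<Sum>r\<in>R. (if b = 0 then 0 else ?l r (b - 1)) * ?l r a - (if a = 0 then 0 else ?l r (a - 1)) * ?l r b)"
    for a b
    unfolding coeff_p_deriv
    by (simp only: mult.commute[of "sum _ _"] h flip: sum_subtractf)
      (intro sum.cong refl, simp add: algebra_simps)
  show "(\<Sum>r\<in>R. ?l r 0 * ?l r b) = ?h 1 * ?h (b + 1) - of_nat (b + 2) * ?h (b + 2) * ?h 0" for b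
    using N[of 0 "b + 1"] by (simp add: mult.commute)
  show "(\<Sum>r\<in>R. ?l r (Suc a) * ?l r b) = (\<Sum>r\<in>R. ?l r a * ?l r (Suc b)) +
      (of_nat (a + 2) * ?h (a + 2) * ?h (b + 1) - of_nat (b + 2) * ?h (b + 2) * ?h (a + 1))" for a b
    using N[of "a + 1" "b + 1"] by (simp add: sum_subtractf mult.commute)
qed

lemma bezoutian_sym: "bezoutian (coeff p) a b = bezoutian (coeff p) b a"
  by (simp add: bezoutian_eq_sum_root_quot mult.commute)

lemma degree_root_quot: "r \<in> R \<Longrightarrow> degree (root_quot p r) = d - 1"
  and coeff_root_quot_top: "r \<in> R \<Longrightarrow> coeff (root_quot p r) (d - 1) = lead_coeff p"
proof -
  assume r: "r \<in> R"
  have "lead_coeff p \<noteq> 0" "card R = d" using split by (auto simp: split_simple_def R_def d_def)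
  moreover have "degree (\<Prod>s\<in>R - {r}. [:- s, 1:]) = card (R - {r})"
    by (rule degree_prod_linear) (simp add: finite_R)
  ultimately show *: "degree (root_quot p r) = d - 1"
    using r finite_R by (simp add: root_quot_def R_def[symmetric])
  have "lead_coeff (root_quot p r) = lead_coeff p"
    by (simp add: root_quot_def lead_coeff_prod_linear)
  then show "coeff (root_quot p r) (d - 1) = lead_coeff p" using * by simp
qed

text \<open>
  The left-hand side is the product of the companion matrix of \<open>p\<close> with the Bezoutian, that is, \<open>s\<close>
  times the Bezoutian reduced modulo \<open>H(s)\<close>.  Since \<open>s \<ell>\<^sub>r(s) = r \<ell>\<^sub>r(s)\<close> modulo \<open>H(s)\<close>, the companion
  matrix multiplies the summand of \<open>r\<close> by \<open>r\<close>, which leaves a symmetric matrix.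
\<close>

lemma bezoutian_companion:
  "(if a = 0 then 0 else bezoutian (coeff p) (a - 1) b)
      - coeff p a / lead_coeff p * bezoutian (coeff p) (d - 1) b
    = (\<Sum>r\<in>R. r * coeff (root_quot p r) a * coeff (root_quot p r) b)"
proof -
  let ?l = "\<lambda>r. coeff (root_quot p r)"
  have nz: "lead_coeff p \<noteq> 0" using split by (auto simp: split_simple_def)
  have "(if a = 0 then 0 else bezoutian (coeff p) (a - 1) b)
      = (\<Sum>r\<in>R. (if a = 0 then 0 else ?l r (a - 1)) * ?l r b)"
    by (simp add: bezoutian_eq_sum_root_quot)
  moreover have "coeff p a / lead_coeff p * bezoutian (coeff p) (d - 1) b
      = (\<Sum>r\<in>R. coeff p a * ?l r b)"
    using nz by (auto simp: bezoutian_eq_sum_root_quot coeff_root_quot_top[simplified] sum_distrib_left intro!: sum.cong)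
  ultimately show ?thesis
    by (simp only: flip: sum_subtractf)
      (intro sum.cong refl, simp add: coeff_p algebra_simps)
qed

lemma bezoutian_companion_sym:
  "(if a = 0 then 0 else bezoutian (coeff p) (a - 1) b)
      - coeff p a / lead_coeff p * bezoutian (coeff p) (d - 1) b
    = (if b = 0 then 0 else bezoutian (coeff p) (b - 1) a)
      - coeff p b / lead_coeff p * bezoutian (coeff p) (d - 1) a"
  unfolding bezoutian_companion by (simp add: mult_ac)

text \<open>
  The Bezoutian is a sum of squares of the functionals given by the quotients \<open>\<ell>\<^sub>r\<close>.  By Lagrange
  interpolation these span all polynomials of degree below \<open>d\<close>, so they have no common zero.
\<close>

lemma bezoutian_pos:
  assumes "a < d" "\<xi> a \<noteq> 0"
  shows "(\<Sum>a<d. \<Sum>b<d. bezoutian (coeff p) a b * \<xi> a * \<xi> b) > 0"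
proof -
  let ?l = "\<lambda>r. coeff (root_quot p r)"
  define S where "S r = (\<Sum>a<d. ?l r a * \<xi> a)" for r
  have "(\<Sum>a<d. \<Sum>b<d. bezoutian (coeff p) a b * \<xi> a * \<xi> b) =
      (\<Sum>a<d. \<Sum>b<d. \<Sum>r\<in>R. (?l r a * \<xi> a) * (?l r b * \<xi> b))"
    by (simp add: bezoutian_eq_sum_root_quot sum_distrib_right sum_distrib_left mult_ac)
  also have "\<dots> = (\<Sum>r\<in>R. \<Sum>a<d. \<Sum>b<d. (?l r a * \<xi> a) * (?l r b * \<xi> b))"
    by (simp add: sum.swap[of _ R])
  also have "\<dots> = (\<Sum>r\<in>R. S r * S r)"
    by (simp add: S_def sum_product)
  finally have eq: "(\<Sum>a<d. \<Sum>b<d. bezoutian (coeff p) a b * \<xi> a * \<xi> b) = (\<Sum>r\<in>R. S r * S r)" .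
  have "\<exists>r\<in>R. S r \<noteq> 0"
  proof (rule ccontr)
    assume "\<not> ?thesis"
    then have S0: "S r = 0" if "r \<in> R" for r using that by blast
    \<comment> \<open>Lagrange interpolation of the monomial \<open>t\<^sup>a\<close> at the roots\<close>
    define g where "g r = r ^ a / poly (root_quot p r) r" for r
    define q where "q = monom 1 a - (\<Sum>r\<in>R. Polynomial.smult (g r) (root_quot p r))"
    have nz: "lead_coeff p \<noteq> 0" using split by (auto simp: split_simple_def)
    have own: "poly (root_quot p r) r \<noteq> 0" if "r \<in> R" for r
      using nz finite_R by (simp add: root_quot_def R_def[symmetric] poly_prod)
    have other: "poly (root_quot p r) s = 0" if "r \<in> R" "s \<in> R" "s \<noteq> r" for r s
      using that finite_R by (auto simp: root_quot_def R_def[symmetric] poly_prod intro!: disjI2 bexI[of _ s])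
    have "degree q < d"
    proof -
      have "degree (Polynomial.smult (g r) (root_quot p r)) \<le> d - 1" if "r \<in> R" for r
        using degree_root_quot[OF that] degree_smult_le by metis
      then have "degree (\<Sum>r\<in>R. Polynomial.smult (g r) (root_quot p r)) \<le> d - 1"
        by (intro degree_sum_le finite_R)
      moreover have "degree (monom (1::real) a) \<le> d - 1" using assms degree_monom_le[of "1::real" a] by simp
      ultimately have "degree q \<le> d - 1" unfolding q_def by (rule degree_diff_le[rotated])
      then show ?thesis using assms by simp
    qed
    moreover have "R \<subseteq> {s. poly q s = 0}"
    proof clarify
      fix s assume s: "s \<in> R"
      have "(\<Sum>r\<in>R. g r * poly (root_quot p r) s) = (\<Sum>r\<in>R. if r = s then s ^ a else 0)"
        by (intro sum.cong refl) (use other own s in \<open>auto simp: g_def\<close>)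
      then show "poly q s = 0" using s finite_R
        by (simp add: q_def poly_sum poly_monom)
    qed
    moreover have "card R = d" using split by (simp add: split_simple_def R_def d_def)
    ultimately have "q = 0"
      using card_mono[OF poly_roots_finite[of q], of R] card_poly_roots_bound[of q] by fastforce
    then have "monom 1 a = (\<Sum>r\<in>R. Polynomial.smult (g r) (root_quot p r))" by (simp add: q_def)
    then have c: "coeff (monom 1 a) b = (\<Sum>r\<in>R. g r * ?l r b)" for b
      by (simp add: Polynomial.coeff_sum)
    have "\<xi> a = (\<Sum>b<d. coeff (monom 1 a) b * \<xi> b)"
      using assms by (simp add: if_distrib[of "\<lambda>x. x * _"] cong: if_cong)
    also have "\<dots> = (\<Sum>r\<in>R. g r * S r)"
      unfolding c S_def sum_distrib_left sum_distrib_right by (subst sum.swap) (simp add: mult_ac)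
    also have "\<dots> = 0" by (simp add: S0)
    finally show False using assms by simp
  qed
  then show ?thesis unfolding eq
    by (metis (no_types, lifting) finite_R not_square_less_zero not_real_square_gt_zero
        linorder_not_less sum_pos2)
qed

end

section \<open>Positive definiteness for large degree\<close>

text \<open>
  The entry \<open>(a, b)\<close> of the Gram matrix carries the factor \<open>1 / (2 k - a - b)!\<close>.  Up to a factor
  \<open>(2 k)\<^bsup>a+b\<^esup> / (2 k)!\<close>, which does not affect definiteness, it is this ratio with \<open>n = 2 k\<close> and
  \<open>c = a + b\<close>.
\<close>

definition fact_ratio :: "nat \<Rightarrow> nat \<Rightarrow> real" where
  "fact_ratio n c = fact n / (fact (n - c) * real n ^ c)"

lemma fact_ratio_tendsto: "(\<lambda>n. fact_ratio n c) \<longlonglongrightarrow> 1"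
proof (induction c)
  case 0
  show ?case by (simp add: fact_ratio_def)
next
  case (Suc c)
  have "(\<lambda>n. real (n - c) / real n) \<longlonglongrightarrow> 1"
  proof (rule Lim_transform_eventually)
    show "(\<lambda>n. 1 - real c / real n) \<longlonglongrightarrow> 1"
      using tendsto_diff[OF tendsto_const lim_const_over_n[of "real c"], of 1] by simp
    show "\<forall>\<^sub>F n in sequentially. 1 - real c / real n = real (n - c) / real n"
      using eventually_gt_at_top[of c] by eventually_elim (simp add: of_nat_diff field_simps)
  qed
  from tendsto_mult[OF Suc this]
  have "(\<lambda>n. fact_ratio n c * (real (n - c) / real n)) \<longlonglongrightarrow> 1" by simp
  moreover have "\<forall>\<^sub>F n in sequentially. fact_ratio n c * (real (n - c) / real n) = fact_ratio n (Suc c)"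
    using eventually_gt_at_top[of c]
  proof eventually_elim
    case (elim n)
    then have "fact (n - c) = real (n - c) * fact (n - Suc c)"
      by (metis Suc_diff_Suc fact_Suc of_nat_fact of_nat_mult)
    then show ?case using elim by (simp add: fact_ratio_def)
  qed
  ultimately show ?case by (rule Lim_transform_eventually)
qed

lemma corrected_scaled_tendsto:
  assumes I: "I \<noteq> {}" and "\<epsilon> > 0"
  shows "\<forall>\<^sub>F k in sequentially. \<forall>u. (\<forall>i. \<bar>u i\<bar> \<le> 1) \<longrightarrow>
    \<bar>peval (corrected I d (2 * k - c) f) u * fact_ratio (2 * k) c - peval f u\<bar> \<le> \<epsilon>"
proof -
  obtain C where C: "C \<ge> 0" "\<And>u. (\<And>i. \<bar>u i\<bar> \<le> 1) \<Longrightarrow> \<bar>peval f u\<bar> \<le> C"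
    using peval_bounded[of f] by blast
  define \<delta> where "\<delta> = min 1 (\<epsilon> / (C + 2))"
  have \<delta>: "\<delta> > 0" "\<delta> \<le> 1" "\<delta> * (C + 2) \<le> \<epsilon>"
  proof -
    have "\<delta> \<le> \<epsilon> / (C + 2)" by (simp add: \<delta>_def)
    then show "\<delta> * (C + 2) \<le> \<epsilon>" using C(1) by (simp add: pos_le_divide_eq)
  qed (use assms C(1) in \<open>auto simp: \<delta>_def\<close>)
  have f2: "filterlim (\<lambda>k::nat. 2 * k) at_top sequentially"
    by (rule filterlim_subseq) (auto simp: strict_mono_def)
  have "filterlim (\<lambda>k. 2 * k - c) at_top sequentially"
    by (rule filterlim_compose[OF filterlim_minus_const_nat_at_top f2])
  from eventually_compose_filterlim[OF corrected_tendsto[OF I \<delta>(1), of d f] this]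
  have 1: "\<forall>\<^sub>F k in sequentially. \<forall>u. (\<forall>i. \<bar>u i\<bar> \<le> 1) \<longrightarrow>
    \<bar>peval (corrected I d (2 * k - c) f) u - peval f u\<bar> \<le> \<delta>" .
  have "(\<lambda>k. fact_ratio (2 * k) c) \<longlonglongrightarrow> 1"
    by (rule filterlim_compose[OF fact_ratio_tendsto f2])
  then have "\<forall>\<^sub>F k in sequentially. dist (fact_ratio (2 * k) c) 1 < \<delta>"
    using \<delta>(1) by (rule tendstoD)
  with 1 show ?thesis
  proof eventually_elim
    case (elim k)
    show ?case
    proof (intro allI impI)
      fix u :: "'a \<Rightarrow> real" assume u: "\<forall>i. \<bar>u i\<bar> \<le> 1"
      let ?x = "peval (corrected I d (2 * k - c) f) u" and ?y = "peval f u" and ?r = "fact_ratio (2 * k) c"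
      have a: "\<bar>?x - ?y\<bar> \<le> \<delta>" "\<bar>?y\<bar> \<le> C" "\<bar>?r - 1\<bar> \<le> \<delta>"
        using elim u C by (auto simp: dist_real_def)
      have "\<bar>?x * ?r - ?y\<bar> = \<bar>(?x - ?y) + ?x * (?r - 1)\<bar>" by (simp add: algebra_simps)
      also have "\<dots> \<le> \<delta> + (C + 1) * \<delta>"
      proof -
        have "\<bar>?x * (?r - 1)\<bar> \<le> (C + 1) * \<delta>"
          unfolding abs_mult by (rule mult_mono) (use a \<delta> C in auto)
        then show ?thesis using a(1) by linarith
      qed
      also have "\<dots> \<le> \<epsilon>" using \<delta> by (simp add: algebra_simps)
      finally show "\<bar>?x * ?r - ?y\<bar> \<le> \<epsilon>" .
    qed
  qed
qed

text \<open>
  The unit sphere in the coordinates from \<open>A\<close>, inside a space of functions.  The redundant bounds on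
  the coordinates make compactness a consequence of Tychonoff's theorem.
\<close>

definition unit_box :: "'a set \<Rightarrow> ('a \<Rightarrow> real) set" where
  "unit_box A = (\<Pi>\<^sub>E a\<in>UNIV. if a \<in> A then {-1..1} else {0}) \<inter> {u. (\<Sum>a\<in>A. u a ^ 2) = 1}"

lemma unit_boxI:
  assumes "finite A" "\<And>a. a \<notin> A \<Longrightarrow> u a = 0" "(\<Sum>a\<in>A. u a ^ 2) = 1"
  shows "u \<in> unit_box A"
proof -
  have "\<bar>u a\<bar> \<le> 1" if "a \<in> A" for a
    using member_le_sum[of a A "\<lambda>a. u a ^ 2"] assms that by (simp add: abs_square_le_1)
  then show ?thesis using assms by (auto simp: unit_box_def abs_le_iff)
qed

lemma compact_unit_box: "compact (unit_box A)"
proof -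
  have "compact (\<Pi>\<^sub>E a\<in>UNIV. if a \<in> A then {-1..1} else {0::real})"
    using compactin_PiE[of "\<lambda>_. euclidean" UNIV "\<lambda>a. if a \<in> A then {-1..1} else {0::real}"]
    by (simp add: euclidean_product_topology)
  moreover have "closed {u. (\<Sum>a\<in>A. u a ^ 2) = (1::real)}"
    by (intro closed_Collect_eq continuous_intros continuous_on_product_coordinates)
  ultimately show ?thesis unfolding unit_box_def by (rule compact_Int_closed)
qed

lemma normalize_to_unit_box:
  assumes "finite A" "a \<in> A" "u a \<noteq> 0"
  obtains r v where "r > 0" "v \<in> unit_box A" "\<And>a. a \<in> A \<Longrightarrow> u a = r * v a"
proof -
  define r where "r = sqrt (\<Sum>a\<in>A. u a ^ 2)"
  have "(\<Sum>a\<in>A. u a ^ 2) > 0"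
    by (rule sum_pos2[OF assms(1,2)]) (use assms(3) in auto)
  then have r: "r > 0" "r ^ 2 = (\<Sum>a\<in>A. u a ^ 2)" by (auto simp: r_def)
  show ?thesis
  proof (rule that[OF r(1)])
    show "(\<lambda>a. if a \<in> A then u a / r else 0) \<in> unit_box A"
      using r by (intro unit_boxI assms(1)) (auto simp: power_divide simp flip: sum_divide_distrib)
  qed (use r in auto)
qed

text \<open>
  On a product of two unit spheres the form of \<open>B\<close> has a positive minimum, and the corrected entries
  converge to \<open>B\<close> uniformly there.  All other pairs \<open>(u, \<xi>)\<close> reduce to this case by scaling.
\<close>

lemma corrected_pos_def:
  fixes B :: "nat \<Rightarrow> nat \<Rightarrow> 'n::finite rpoly"
  assumes I: "I \<noteq> {}"
    and form: "\<And>a b. a < d \<Longrightarrow> b < d \<Longrightarrow> form_in I (2 * d - 2 - a - b) (B a b)"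
    and pos: "\<And>u \<xi> i a. i \<in> I \<Longrightarrow> u i \<noteq> 0 \<Longrightarrow> a < d \<Longrightarrow> \<xi> a \<noteq> 0 \<Longrightarrow>
      (\<Sum>a<d. \<Sum>b<d. peval (B a b) u * \<xi> a * \<xi> b) > 0"
  shows "\<forall>\<^sub>F k in sequentially. \<forall>u \<xi>. (\<exists>i\<in>I. u i \<noteq> 0) \<longrightarrow> (\<exists>a<d. \<xi> a \<noteq> 0) \<longrightarrow>
    (\<Sum>a<d. \<Sum>b<d. peval (corrected I (2 * d - 2 - a - b) (2 * k - (a + b)) (B a b)) u
        / fact (2 * k - (a + b)) * \<xi> a * \<xi> b) > 0"
proof (cases "d = 0")
  case True
  then show ?thesis by simp
next
  case False
  let ?T = "unit_box I \<times> unit_box {..<d}"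
  define Q where "Q = (\<lambda>(u, \<xi>). \<Sum>a<d. \<Sum>b<d. peval (B a b) u * \<xi> a * \<xi> b)"
  obtain i where i: "i \<in> I" using I by auto
  have "(\<lambda>j. if j = i then 1 else 0) \<in> unit_box I" "(\<lambda>a. if a = 0 then 1 else 0) \<in> unit_box {..<d}"
    using i False by (auto intro!: unit_boxI split: if_splits simp: if_distrib[of "\<lambda>x. x ^ 2"] cong: if_cong)
  then have ne: "?T \<noteq> {}" by auto
  have box: "\<exists>a\<in>A. v a \<noteq> 0" "\<And>a. \<bar>v a\<bar> \<le> 1" if "v \<in> unit_box A" for A :: "'x set" and v
  proof -
    show "\<exists>a\<in>A. v a \<noteq> 0"
    proof (rule ccontr)
      assume "\<not> ?thesis"
      then have "(\<Sum>a\<in>A. v a ^ 2) = 0" by (intro sum.neutral) auto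
      then show False using that by (simp add: unit_box_def)
    qed
    show "\<bar>v a\<bar> \<le> 1" for a
      using that by (auto simp: unit_box_def PiE_iff abs_le_iff split: if_splits dest!: spec[of _ a])
  qed
  have "continuous_on ?T Q"
    unfolding Q_def case_prod_unfold
    by (intro continuous_intros continuous_on_compose2[OF continuous_on_peval[of UNIV]]
        continuous_on_compose2[OF continuous_on_product_coordinates]) auto
  from continuous_attains_inf[OF compact_Times[OF compact_unit_box compact_unit_box] ne this]
  obtain t where t: "t \<in> ?T" "\<And>s. s \<in> ?T \<Longrightarrow> Q t \<le> Q s" by blast
  define \<delta> where "\<delta> = Q t"
  have \<delta>: "\<delta> > 0"
  proof -
    obtain u \<xi> where t': "t = (u, \<xi>)" by (cases t)
    then obtain i a where "i \<in> I" "u i \<noteq> 0" "a < d" "\<xi> a \<noteq> 0"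
      using t(1) box(1)[of u I] box(1)[of \<xi> "{..<d}"] by auto
    from pos[where i = i and u = u and a = a and \<xi> = \<xi>, OF this] show ?thesis by (simp add: \<delta>_def Q_def t')
  qed
  have min: "\<delta> \<le> (\<Sum>a<d. \<Sum>b<d. peval (B a b) u * \<xi> a * \<xi> b)"
    if "u \<in> unit_box I" "\<xi> \<in> unit_box {..<d}" for u \<xi>
    using t(2)[of "(u, \<xi>)"] that by (simp add: \<delta>_def Q_def)
  \<comment> \<open>there are \<open>d\<^sup>2\<close> entries, so an error of \<open>\<epsilon>\<close> in each changes the form by at most \<open>\<delta> / 2\<close>\<close>
  define \<epsilon> where "\<epsilon> = \<delta> / (2 * real d ^ 2)"
  have \<epsilon>: "\<epsilon> > 0" using \<delta> False by (simp add: \<epsilon>_def)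
  let ?M = "\<lambda>k a b. corrected I (2 * d - 2 - a - b) (2 * k - (a + b)) (B a b)"
  have "\<forall>\<^sub>F k in sequentially. \<forall>a\<in>{..<d}. \<forall>b\<in>{..<d}. \<forall>u. (\<forall>i. \<bar>u i\<bar> \<le> 1) \<longrightarrow>
    \<bar>peval (?M k a b) u * fact_ratio (2 * k) (a + b) - peval (B a b) u\<bar> \<le> \<epsilon>"
    by (intro eventually_ball_finite ballI corrected_scaled_tendsto I \<epsilon>) auto
  then show ?thesis
    using eventually_gt_at_top[of d]
  proof eventually_elim
    case (elim k)
    show ?case
    proof (intro allI impI)
      fix u :: "'n \<Rightarrow> real" and \<xi> :: "nat \<Rightarrow> real"
      assume "\<exists>i\<in>I. u i \<noteq> 0" "\<exists>a<d. \<xi> a \<noteq> 0"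
      then obtain i a0 where ia: "i \<in> I" "u i \<noteq> 0" "a0 < d" "\<xi> a0 \<noteq> 0" by blast
      have k: "real (2 * k) > 0" using elim(2) by simp
      obtain r v where r: "r > 0" and v: "v \<in> unit_box I" and u: "\<And>i. i \<in> I \<Longrightarrow> u i = r * v i"
        using normalize_to_unit_box[of I i u] ia by auto
      \<comment> \<open>the weights of the rows absorb the different degrees of the entries\<close>
      define \<zeta> where "\<zeta> a = r ^ (d - 1 - a) * real (2 * k) ^ a * \<xi> a" for a
      have "\<zeta> a0 \<noteq> 0" using ia r k by (simp add: \<zeta>_def)
      then obtain s \<eta> where s: "s > 0" and \<eta>: "\<eta> \<in> unit_box {..<d}" and \<zeta>: "\<And>a. a \<in> {..<d} \<Longrightarrow> \<zeta> a = s * \<eta> a"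
        using normalize_to_unit_box[of "{..<d}" a0 \<zeta>] ia by auto
      let ?N = "\<lambda>a b. peval (?M k a b) v * fact_ratio (2 * k) (a + b)"
      have "peval (?M k a b) u / fact (2 * k - (a + b)) * \<xi> a * \<xi> b
          = s ^ 2 / fact (2 * k) * (?N a b * \<eta> a * \<eta> b)" if ab: "a < d" "b < d" for a b
      proof -
        define X Y where "X = peval (?M k a b) u" and "Y = peval (?M k a b) v"
        have "X = peval (?M k a b) (\<lambda>i. r * v i)"
          unfolding X_def by (rule peval_form_cong[OF form_in_corrected[OF form[OF ab]] u])
        also have "\<dots> = r ^ (2 * d - 2 - a - b) * Y"
          unfolding Y_def by (rule peval_form_scale[OF form_in_corrected[OF form[OF ab]]])
        also have "2 * d - 2 - a - b = (d - 1 - a) + (d - 1 - b)" using ab by auto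
        finally have "X / fact (2 * k - (a + b)) * \<xi> a * \<xi> b
            = Y * fact_ratio (2 * k) (a + b) / fact (2 * k) * \<zeta> a * \<zeta> b"
          using k by (simp add: fact_ratio_def \<zeta>_def power_add divide_simps)
        then show ?thesis unfolding X_def Y_def using ab by (simp add: \<zeta> power2_eq_square)
      qed
      then have "(\<Sum>a<d. \<Sum>b<d. peval (?M k a b) u / fact (2 * k - (a + b)) * \<xi> a * \<xi> b)
         = s ^ 2 / fact (2 * k) * (\<Sum>a<d. \<Sum>b<d. ?N a b * \<eta> a * \<eta> b)"
        by (simp add: sum_distrib_left)
      moreover have "(\<Sum>a<d. \<Sum>b<d. ?N a b * \<eta> a * \<eta> b) \<ge> \<delta> / 2"
      proof -
        have "\<bar>(\<Sum>a<d. \<Sum>b<d. ?N a b * \<eta> a * \<eta> b) - (\<Sum>a<d. \<Sum>b<d. peval (B a b) v * \<eta> a * \<eta> b)\<bar>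
            = \<bar>\<Sum>a<d. \<Sum>b<d. (?N a b - peval (B a b) v) * \<eta> a * \<eta> b\<bar>"
          by (simp add: algebra_simps flip: sum_subtractf)
        also have "\<dots> \<le> (\<Sum>a<d. \<Sum>b<d. \<epsilon>)"
        proof (intro order_trans[OF sum_abs] sum_mono)
          fix a b assume "a \<in> {..<d}" "b \<in> {..<d}"
          then have "\<bar>?N a b - peval (B a b) v\<bar> \<le> \<epsilon>" using elim(1) box(2)[OF v] by auto
          moreover have "\<bar>\<eta> a\<bar> \<le> 1" "\<bar>\<eta> b\<bar> \<le> 1" using box(2)[OF \<eta>] by auto
          ultimately have "\<bar>?N a b - peval (B a b) v\<bar> * \<bar>\<eta> a\<bar> * \<bar>\<eta> b\<bar> \<le> \<epsilon> * 1 * 1"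
            by (intro mult_mono) auto
          then show "\<bar>(?N a b - peval (B a b) v) * \<eta> a * \<eta> b\<bar> \<le> \<epsilon>"
            by (simp add: abs_mult)
        qed
        also have "\<dots> = \<delta> / 2" using False by (simp add: \<epsilon>_def power2_eq_square)
        finally show ?thesis using min[OF v \<eta>] by linarith
      qed
      ultimately show "(\<Sum>a<d. \<Sum>b<d. peval (?M k a b) u / fact (2 * k - (a + b)) * \<xi> a * \<xi> b) > 0"
        using \<delta> s by simp
    qed
  qed
qed

section \<open>Splitting off a linear factor symmetrically\<close>

text \<open>
  One family of coefficients \<open>K\<^sub>i(\<alpha>, \<beta>)\<close> that solves two problems at once: contracting the index \<open>\<alpha>\<close>
  with \<open>x\<^sup>\<alpha>\<close> gives \<open>F\<close>, and contracting the index \<open>\<beta>\<close> gives \<open>G\<close>.  In terms of biforms,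
  \<open>F(x, y) = \<Sum>\<^sub>i x\<^sub>i K\<^sub>i(x, y)\<close> and \<open>G(x, y) = \<Sum>\<^sub>i y\<^sub>i K\<^sub>i(x, y)\<close>.
\<close>

definition bisplit :: "'n::finite set \<Rightarrow> nat \<Rightarrow> nat \<Rightarrow> (('n \<Rightarrow>\<^sub>0 nat) \<Rightarrow> 'n rpoly) \<Rightarrow> (('n \<Rightarrow>\<^sub>0 nat) \<Rightarrow> 'n rpoly) \<Rightarrow> bool" where
  "bisplit I m l F G \<longleftrightarrow> (\<exists>K.
     (\<forall>\<beta>\<in>Mon I l. F \<beta> = (\<Sum>i\<in>I. Var i * (\<Sum>\<alpha>\<in>Mon I m. Const (K i \<alpha> \<beta>) * xpow \<alpha>))) \<and>
     (\<forall>\<alpha>\<in>Mon I m. G \<alpha> = (\<Sum>i\<in>I. Var i * (\<Sum>\<beta>\<in>Mon I l. Const (K i \<alpha> \<beta>) * xpow \<beta>))))"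

lemma bisplit_cong:
  assumes "\<And>\<beta>. \<beta> \<in> Mon I l \<Longrightarrow> F \<beta> = F' \<beta>" "\<And>\<alpha>. \<alpha> \<in> Mon I m \<Longrightarrow> G \<alpha> = G' \<alpha>"
  shows "bisplit I m l F G \<Longrightarrow> bisplit I m l F' G'"
  using assms unfolding bisplit_def by simp

lemma bisplit_0: "bisplit I m l (\<lambda>_. 0) (\<lambda>_. 0)"
  unfolding bisplit_def by (rule exI[of _ "\<lambda>_ _ _. 0"]) simp

lemma bisplit_add:
  assumes "bisplit I m l F G" "bisplit I m l F' G'"
  shows "bisplit I m l (\<lambda>\<beta>. F \<beta> + F' \<beta>) (\<lambda>\<alpha>. G \<alpha> + G' \<alpha>)"
proof -
  from assms obtain K K' where "\<forall>\<beta>\<in>Mon I l. F \<beta> = (\<Sum>i\<in>I. Var i * (\<Sum>\<alpha>\<in>Mon I m. Const (K i \<alpha> \<beta>) * xpow \<alpha>))"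
    "\<forall>\<alpha>\<in>Mon I m. G \<alpha> = (\<Sum>i\<in>I. Var i * (\<Sum>\<beta>\<in>Mon I l. Const (K i \<alpha> \<beta>) * xpow \<beta>))"
    "\<forall>\<beta>\<in>Mon I l. F' \<beta> = (\<Sum>i\<in>I. Var i * (\<Sum>\<alpha>\<in>Mon I m. Const (K' i \<alpha> \<beta>) * xpow \<alpha>))"
    "\<forall>\<alpha>\<in>Mon I m. G' \<alpha> = (\<Sum>i\<in>I. Var i * (\<Sum>\<beta>\<in>Mon I l. Const (K' i \<alpha> \<beta>) * xpow \<beta>))"
    unfolding bisplit_def by blast
  then show ?thesis unfolding bisplit_def
    by (intro exI[of _ "\<lambda>i \<alpha> \<beta>. K i \<alpha> \<beta> + K' i \<alpha> \<beta>"])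
      (simp add: Const_hom.hom_add distrib_right distrib_left sum.distrib)
qed

lemma bisplit_scale:
  assumes "bisplit I m l F G"
  shows "bisplit I m l (\<lambda>\<beta>. Const c * F \<beta>) (\<lambda>\<alpha>. Const c * G \<alpha>)"
proof -
  from assms obtain K where "\<forall>\<beta>\<in>Mon I l. F \<beta> = (\<Sum>i\<in>I. Var i * (\<Sum>\<alpha>\<in>Mon I m. Const (K i \<alpha> \<beta>) * xpow \<alpha>))"
    "\<forall>\<alpha>\<in>Mon I m. G \<alpha> = (\<Sum>i\<in>I. Var i * (\<Sum>\<beta>\<in>Mon I l. Const (K i \<alpha> \<beta>) * xpow \<beta>))"
    unfolding bisplit_def by blast
  then show ?thesis unfolding bisplit_def
    by (intro exI[of _ "\<lambda>i \<alpha> \<beta>. c * K i \<alpha> \<beta>"])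
      (simp add: Const_hom.hom_mult sum_distrib_left mult_ac)
qed

lemma bisplit_sum:
  assumes "\<And>a. a \<in> A \<Longrightarrow> bisplit I m l (F a) (G a)"
  shows "bisplit I m l (\<lambda>\<beta>. \<Sum>a\<in>A. F a \<beta>) (\<lambda>\<alpha>. \<Sum>a\<in>A. G a \<alpha>)"
  using assms by (induction A rule: infinite_finite_induct) (auto simp: bisplit_0 bisplit_add)

definition unit_at :: "('n::finite \<Rightarrow>\<^sub>0 nat) \<Rightarrow> ('n \<Rightarrow>\<^sub>0 nat) \<Rightarrow> ('n \<Rightarrow>\<^sub>0 nat) \<Rightarrow> 'n rpoly" where
  "unit_at \<mu> \<nu> \<alpha> = (if \<alpha> = \<mu> then xpow \<nu> else 0)"

text \<open>
  A single coefficient \<open>K\<^sub>i(\<alpha>, \<beta>) = 1\<close> contributes \<open>x\<^sub>i x\<^sup>\<alpha> y\<^sup>\<beta>\<close> to \<open>F\<close> and \<open>x\<^sup>\<alpha> y\<^sub>i y\<^sup>\<beta>\<close> to \<open>G\<close>.  So a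
  variable can be moved from \<open>x\<close> in \<open>F\<close> to \<open>y\<close> in \<open>G\<close>.
\<close>

lemma bisplit_edge:
  assumes "i \<in> I" "\<alpha> \<in> Mon I m" "\<beta> \<in> Mon I l"
  shows "bisplit I m l (unit_at \<beta> (\<alpha> + unit_exp i)) (unit_at \<alpha> (\<beta> + unit_exp i))"
  unfolding bisplit_def
proof (intro exI conjI ballI)
  let ?K = "\<lambda>i' \<alpha>' \<beta>'. if i' = i \<and> \<alpha>' = \<alpha> \<and> \<beta>' = \<beta> then 1 else 0 :: real"
  fix \<beta>' assume "\<beta>' \<in> Mon I l"
  have "(\<Sum>\<alpha>'\<in>Mon I m. Const (?K i' \<alpha>' \<beta>') * xpow \<alpha>') = (if i' = i \<and> \<beta>' = \<beta> then xpow \<alpha> else 0)" for i'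
    using assms by (cases "i' = i \<and> \<beta>' = \<beta>") (auto simp: if_distrib[of Const] if_distrib[of "\<lambda>x. x * _"] cong: if_cong)
  then show "unit_at \<beta> (\<alpha> + unit_exp i) \<beta>' = (\<Sum>i'\<in>I. Var i' * (\<Sum>\<alpha>'\<in>Mon I m. Const (?K i' \<alpha>' \<beta>') * xpow \<alpha>'))"
    using assms by (cases "\<beta>' = \<beta>") (auto simp: unit_at_def xpow_add Var_def mult.commute if_distrib[of "(*) _"] cong: if_cong)
next
  let ?K = "\<lambda>i' \<alpha>' \<beta>'. if i' = i \<and> \<alpha>' = \<alpha> \<and> \<beta>' = \<beta> then 1 else 0 :: real"
  fix \<alpha>' assume "\<alpha>' \<in> Mon I m"
  have "(\<Sum>\<beta>'\<in>Mon I l. Const (?K i' \<alpha>' \<beta>') * xpow \<beta>') = (if i' = i \<and> \<alpha>' = \<alpha> then xpow \<beta> else 0)" for i'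
    using assms by (cases "i' = i \<and> \<alpha>' = \<alpha>") (auto simp: if_distrib[of Const] if_distrib[of "\<lambda>x. x * _"] cong: if_cong)
  then show "unit_at \<alpha> (\<beta> + unit_exp i) \<alpha>' = (\<Sum>i'\<in>I. Var i' * (\<Sum>\<beta>'\<in>Mon I l. Const (?K i' \<alpha>' \<beta>') * xpow \<beta>'))"
    using assms by (cases "\<alpha>' = \<alpha>") (auto simp: unit_at_def xpow_add Var_def mult.commute if_distrib[of "(*) _"] cong: if_cong)
qed

lemma minus_unit_exp:
  "lookup \<mu> i > 0 \<Longrightarrow> \<mu> = (\<mu> - unit_exp i) + unit_exp i"
  by (intro poly_mapping_eqI) (auto simp: lookup_add lookup_minus lookup_single when_def)

lemma Mon_minus_unit_exp:
  assumes "\<mu> \<in> Mon I (Suc m)" "lookup \<mu> i > 0"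
  shows "i \<in> I" "\<mu> - unit_exp i \<in> Mon I m"
proof -
  show "i \<in> I" using assms by (auto simp: Mon_def in_keys_iff subset_eq)
  have "mdeg \<mu> = mdeg (\<mu> - unit_exp i) + 1"
    using arg_cong[OF minus_unit_exp[OF assms(2)], of mdeg] by simp
  moreover have "keys (\<mu> - unit_exp i) \<subseteq> keys \<mu>"
    by (auto simp: in_keys_iff lookup_minus)
  ultimately show "\<mu> - unit_exp i \<in> Mon I m" using assms(1) by (auto simp: Mon_def)
qed

lemma exponent_eqI_le:
  assumes "\<And>i. lookup \<mu> i \<le> lookup \<mu>' i" "mdeg \<mu> = mdeg \<mu>'"
  shows "\<mu> = \<mu>'"
proof (rule poly_mapping_eqI, rule ccontr)
  fix i assume "lookup \<mu> i \<noteq> lookup \<mu>' i"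
  then have "lookup \<mu> i < lookup \<mu>' i" using assms(1)[of i] by simp
  then have "mdeg \<mu> < mdeg \<mu>'" unfolding mdeg_def
    by (intro sum_strict_mono_ex1) (use assms(1) in auto)
  then show False using assms(2) by simp
qed

text \<open>
  The difference of two edges with the same contribution to \<open>F\<close> exchanges a variable of \<open>x\<close> with one
  of \<open>y\<close> in \<open>G\<close>.  Such exchanges connect all monomials with the same total exponent; each step reduces
  the excess of \<open>\<mu>\<close> over \<open>\<mu>'\<close>.
\<close>

lemma bisplit_exchange:
  assumes "\<mu> \<in> Mon I m" "\<mu>' \<in> Mon I m" "\<nu> \<in> Mon I (Suc l)" "\<nu>' \<in> Mon I (Suc l)" "\<mu> + \<nu> = \<mu>' + \<nu>'"
  shows "bisplit I m l (\<lambda>_. 0) (\<lambda>\<alpha>. unit_at \<mu> \<nu> \<alpha> - unit_at \<mu>' \<nu>' \<alpha>)"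
  using assms
proof (induction "mdeg (\<mu> - \<mu>')" arbitrary: \<mu> \<nu>)
  case 0
  then have "lookup \<mu> i \<le> lookup \<mu>' i" for i
    by (simp add: mdeg_def lookup_minus)
  then have "\<mu> = \<mu>'" using 0 by (intro exponent_eqI_le) (auto simp: Mon_def)
  then show ?case using 0 by (simp add: bisplit_0)
next
  case (Suc n)
  note sums = arg_cong[OF Suc.prems(5), of "\<lambda>f. lookup f _", unfolded lookup_add]
  have "\<exists>i. lookup (\<mu> - \<mu>') i \<noteq> 0"
    using Suc.hyps(2) unfolding mdeg_def by (metis nat.simps(3) sum.neutral)
  then obtain i where i: "lookup \<mu> i > lookup \<mu>' i"
    by (auto simp: lookup_minus not_le)
  have "\<exists>j. lookup \<mu> j < lookup \<mu>' j"
  proof (rule ccontr)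
    assume "\<not> ?thesis"
    then have "\<mu>' = \<mu>" using Suc.prems by (intro exponent_eqI_le) (auto simp: Mon_def not_less)
    then show False using i by simp
  qed
  then obtain j where j: "lookup \<mu> j < lookup \<mu>' j" ..
  have \<nu>j: "lookup \<nu> j > 0" using sums[of j] j by simp
  have ij: "i \<noteq> j" using i j by auto
  define \<alpha> \<beta> where "\<alpha> = \<mu> - unit_exp i" and "\<beta> = \<nu> - unit_exp j"
  have \<mu>: "\<mu> = \<alpha> + unit_exp i" and \<nu>: "\<nu> = \<beta> + unit_exp j"
    unfolding \<alpha>_def \<beta>_def
    by (rule minus_unit_exp, use i in linarith) (rule minus_unit_exp[OF \<nu>j])
  have "mdeg \<mu> > 0" using \<mu> by simp
  then obtain m' where m: "m = Suc m'" using Suc.prems(1) by (cases m) (auto simp: Mon_def)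
  have I: "i \<in> I" "j \<in> I" "\<alpha> \<in> Mon I m'" "\<beta> \<in> Mon I l"
    using Mon_minus_unit_exp[of \<mu> I m' i] Mon_minus_unit_exp[of \<nu> I l j] Suc.prems i \<nu>j m
    by (auto simp: \<alpha>_def \<beta>_def)
  have new: "\<alpha> + unit_exp j \<in> Mon I m" "\<beta> + unit_exp i \<in> Mon I (Suc l)"
    using Mon_add[OF I(3) Mon_single[OF I(2), of 1]] Mon_add[OF I(4) Mon_single[OF I(1), of 1]] m by auto
  let ?\<mu> = "\<alpha> + unit_exp j" and ?\<nu> = "\<beta> + unit_exp i"
  have "bisplit I m l (unit_at \<beta> (\<mu> + unit_exp j)) (unit_at \<mu> (\<beta> + unit_exp j))"
    "bisplit I m l (unit_at \<beta> (?\<mu> + unit_exp i)) (unit_at ?\<mu> (\<beta> + unit_exp i))"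
    using bisplit_edge I new Suc.prems by auto
  note bisplit_add[OF this(1) bisplit_scale[OF this(2), of "- 1"]]
  moreover have "\<mu> + unit_exp j = ?\<mu> + unit_exp i" by (simp add: \<mu> add_ac)
  ultimately have 1: "bisplit I m l (\<lambda>_. 0) (\<lambda>\<alpha>. unit_at \<mu> \<nu> \<alpha> - unit_at ?\<mu> ?\<nu> \<alpha>)"
    by (simp add: Const_hom.hom_uminus \<nu>)
  have "bisplit I m l (\<lambda>_. 0) (\<lambda>\<alpha>. unit_at ?\<mu> ?\<nu> \<alpha> - unit_at \<mu>' \<nu>' \<alpha>)"
  proof (rule Suc.hyps(1))
    have "\<mu> - \<mu>' = (?\<mu> - \<mu>') + unit_exp i"
      using i j ij by (intro poly_mapping_eqI)
        (auto simp: \<alpha>_def lookup_add lookup_minus lookup_single when_def)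
    from arg_cong[OF this, of mdeg] show "n = mdeg (?\<mu> - \<mu>')" using Suc.hyps(2) by simp
    show "?\<mu> + ?\<nu> = \<mu>' + \<nu>'" using Suc.prems(5) by (simp add: \<mu> \<nu> add_ac)
  qed (use new Suc.prems in auto)
  from bisplit_add[OF 1 this] show ?case by simp
qed

lemma Mon_Suc_split:
  assumes "\<mu> \<in> Mon I (Suc m)"
  obtains i where "i \<in> I" "lookup \<mu> i > 0" "\<mu> - unit_exp i \<in> Mon I m" "\<mu> = (\<mu> - unit_exp i) + unit_exp i"
proof -
  have "mdeg \<mu> = Suc m" using assms by (simp add: Mon_def)
  then have "\<exists>i. lookup \<mu> i \<noteq> 0" unfolding mdeg_def by (metis nat.simps(3) sum.neutral)
  then obtain i where "lookup \<mu> i > 0" by auto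
  with that show ?thesis using Mon_minus_unit_exp[OF assms] minus_unit_exp by metis
qed

text \<open>
  The necessary condition \<open>F(x, x) = G(x, x)\<close> is sufficient.  Modulo solvable pairs every monomial can
  be moved to \<open>G\<close> and exchanged for a representative of its total exponent, and the condition says that
  the representatives cancel.
\<close>

theorem bisplit_exists:
  fixes F G :: "('n::finite \<Rightarrow>\<^sub>0 nat) \<Rightarrow> 'n rpoly"
  assumes F: "\<And>\<beta>. \<beta> \<in> Mon I l \<Longrightarrow> form_in I (Suc m) (F \<beta>)"
    and G: "\<And>\<alpha>. \<alpha> \<in> Mon I m \<Longrightarrow> form_in I (Suc l) (G \<alpha>)"
    and eq: "(\<Sum>\<beta>\<in>Mon I l. F \<beta> * xpow \<beta>) = (\<Sum>\<alpha>\<in>Mon I m. G \<alpha> * xpow \<alpha>)"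
  shows "bisplit I m l F G"
proof -
  define f where "f \<mu> \<nu> = (Const (lookup (F \<nu>) \<mu>) :: 'n rpoly)" for \<mu> \<nu>
  define g where "g \<mu> \<nu> = (Const (lookup (G \<mu>) \<nu>) :: 'n rpoly)" for \<mu> \<nu>
  have Fx: "F \<beta> = (\<Sum>\<mu>\<in>Mon I (Suc m). f \<mu> \<beta> * xpow \<mu>)" if "\<beta> \<in> Mon I l" for \<beta>
    unfolding f_def by (rule form_in_expand[OF F[OF that]])
  have Gx: "G \<alpha> = (\<Sum>\<nu>\<in>Mon I (Suc l). g \<alpha> \<nu> * xpow \<nu>)" if "\<alpha> \<in> Mon I m" for \<alpha>
    unfolding g_def by (rule form_in_expand[OF G[OF that]])
  \<comment> \<open>a representative of each total exponent\<close>
  define P where "P \<gamma> p \<longleftrightarrow> fst p \<in> Mon I m \<and> snd p \<in> Mon I (Suc l) \<and> fst p + snd p = \<gamma>" for \<gamma> p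
  define r where "r \<gamma> = (SOME p. P \<gamma> p)" for \<gamma>
  have r: "P (\<mu> + \<nu>) (r (\<mu> + \<nu>))" if "\<mu> \<in> Mon I m" "\<nu> \<in> Mon I (Suc l)" for \<mu> \<nu>
    unfolding r_def by (rule someI[of _ "(\<mu>, \<nu>)"]) (use that in \<open>simp add: P_def\<close>)
  define H where "H \<gamma> = unit_at (fst (r \<gamma>)) (snd (r \<gamma>))" for \<gamma>
  have 1: "bisplit I m l (\<lambda>_. 0) (\<lambda>\<alpha>. unit_at \<mu> \<nu> \<alpha> - H (\<mu> + \<nu>) \<alpha>)"
    if "\<mu> \<in> Mon I m" "\<nu> \<in> Mon I (Suc l)" for \<mu> \<nu>
    unfolding H_def by (rule bisplit_exchange) (use r[OF that] that in \<open>auto simp: P_def\<close>)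
  have 2: "bisplit I m l (unit_at \<nu> \<mu>) (H (\<mu> + \<nu>))"
    if \<mu>: "\<mu> \<in> Mon I (Suc m)" and \<nu>: "\<nu> \<in> Mon I l" for \<mu> \<nu>
  proof -
    obtain i where i: "i \<in> I" "\<mu> - unit_exp i \<in> Mon I m" and e: "\<mu> = (\<mu> - unit_exp i) + unit_exp i"
      using Mon_Suc_split[OF \<mu>] by metis
    let ?\<alpha> = "\<mu> - unit_exp i"
    have \<nu>': "\<nu> + unit_exp i \<in> Mon I (Suc l)" using Mon_add[OF \<nu> Mon_single[OF i(1), of 1]] by simp
    have "?\<alpha> + (\<nu> + unit_exp i) = \<mu> + \<nu>" by (subst (2) e) (simp only: add_ac)
    with bisplit_add[OF bisplit_edge[OF i \<nu>] bisplit_scale[OF 1[OF i(2) \<nu>'], of "- 1"]]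
    show ?thesis by (simp add: Const_hom.hom_uminus e[symmetric] del: One_nat_def)
  qed
  \<comment> \<open>after moving everything to representatives only the total exponents matter\<close>
  have \<Phi>_Sum: "(\<Sum>k\<in>keys (\<Sum>a\<in>A. Const (c a) * xpow (e a)). Const (lookup (\<Sum>a\<in>A. Const (c a) * xpow (e a)) k) * H k \<alpha>)
      = (\<Sum>a\<in>A. Const (c a) * H (e a) \<alpha>)"
    if "finite A" for A :: "(('n \<Rightarrow>\<^sub>0 nat) \<times> ('n \<Rightarrow>\<^sub>0 nat)) set" and c e \<alpha>
    using that
  proof (induction A rule: finite_induct)
    case (insert a A)
    have "(\<Sum>k\<in>keys (Const (c a) * xpow (e a)). Const (lookup (Const (c a) * xpow (e a)) k) * H k \<alpha>)
        = Const (c a) * H (e a) \<alpha>"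
      unfolding single_eq_Const_xpow[symmetric]
      by (rule sum_keys_single[of "\<lambda>k c. Const c * H k \<alpha>"]) simp
    with insert show ?case
      by (simp add: sum_keys_add[of "\<lambda>k c. Const c * H k \<alpha>"] Const_hom.hom_add distrib_right)
  qed simp
  have H: "(\<Sum>(\<mu>, \<nu>)\<in>Mon I (Suc m) \<times> Mon I l. f \<mu> \<nu> * H (\<mu> + \<nu>) \<alpha>)
      = (\<Sum>(\<mu>, \<nu>)\<in>Mon I m \<times> Mon I (Suc l). g \<mu> \<nu> * H (\<mu> + \<nu>) \<alpha>)" for \<alpha>
  proof -
    have "(\<Sum>(\<mu>, \<nu>)\<in>Mon I (Suc m) \<times> Mon I l. f \<mu> \<nu> * xpow (\<mu> + \<nu>)) = (\<Sum>\<beta>\<in>Mon I l. F \<beta> * xpow \<beta>)"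
      by (simp add: Fx xpow_add sum_distrib_right mult.assoc flip: sum.cartesian_product)
        (rule sum.swap)
    also have "\<dots> = (\<Sum>(\<mu>, \<nu>)\<in>Mon I m \<times> Mon I (Suc l). g \<mu> \<nu> * xpow (\<mu> + \<nu>))"
      by (simp add: eq Gx xpow_add sum_distrib_right sum_distrib_left mult_ac flip: sum.cartesian_product)
    finally show ?thesis
      using \<Phi>_Sum[of "Mon I (Suc m) \<times> Mon I l" "\<lambda>(\<mu>, \<nu>). lookup (F \<nu>) \<mu>" "\<lambda>(\<mu>, \<nu>). \<mu> + \<nu>" \<alpha>]
        \<Phi>_Sum[of "Mon I m \<times> Mon I (Suc l)" "\<lambda>(\<mu>, \<nu>). lookup (G \<mu>) \<nu>" "\<lambda>(\<mu>, \<nu>). \<mu> + \<nu>" \<alpha>]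
      by (simp add: f_def g_def case_prod_unfold)
  qed
  have "bisplit I m l (\<lambda>\<beta>. \<Sum>p\<in>Mon I (Suc m) \<times> Mon I l. f (fst p) (snd p) * unit_at (snd p) (fst p) \<beta>)
      (\<lambda>\<alpha>. \<Sum>p\<in>Mon I (Suc m) \<times> Mon I l. f (fst p) (snd p) * H (fst p + snd p) \<alpha>)"
    unfolding f_def by (intro bisplit_sum bisplit_scale 2) auto
  moreover have "bisplit I m l (\<lambda>\<beta>. \<Sum>p\<in>Mon I m \<times> Mon I (Suc l). g (fst p) (snd p) * 0)
      (\<lambda>\<alpha>. \<Sum>p\<in>Mon I m \<times> Mon I (Suc l). g (fst p) (snd p) * (unit_at (fst p) (snd p) \<alpha> - H (fst p + snd p) \<alpha>))"
    unfolding g_def by (intro bisplit_sum bisplit_scale 1) auto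
  ultimately show ?thesis
  proof (rule bisplit_cong[rotated 2, OF bisplit_add])
    fix \<beta> assume \<beta>: "\<beta> \<in> Mon I l"
    have "(\<Sum>\<mu>\<in>Mon I (Suc m). \<Sum>\<nu>\<in>Mon I l. f \<mu> \<nu> * unit_at \<nu> \<mu> \<beta>) = F \<beta>"
      using \<beta> by (simp add: unit_at_def Fx if_distrib[of "(*) _"] cong: if_cong)
    then show "(\<Sum>p\<in>Mon I (Suc m) \<times> Mon I l. f (fst p) (snd p) * unit_at (snd p) (fst p) \<beta>)
        + (\<Sum>p\<in>Mon I m \<times> Mon I (Suc l). g (fst p) (snd p) * 0) = F \<beta>"
      by (simp add: sum.cartesian_product case_prod_unfold)
  next
    fix \<alpha> assume \<alpha>: "\<alpha> \<in> Mon I m"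
    have "(\<Sum>\<mu>\<in>Mon I m. \<Sum>\<nu>\<in>Mon I (Suc l). g \<mu> \<nu> * unit_at \<mu> \<nu> \<alpha>)
        = (\<Sum>\<mu>\<in>Mon I m. if \<alpha> = \<mu> then \<Sum>\<nu>\<in>Mon I (Suc l). g \<mu> \<nu> * xpow \<nu> else 0)"
      by (intro sum.cong refl) (auto simp: unit_at_def)
    also have "\<dots> = G \<alpha>" using \<alpha> by (simp add: Gx)
    finally show "(\<Sum>p\<in>Mon I (Suc m) \<times> Mon I l. f (fst p) (snd p) * H (fst p + snd p) \<alpha>)
        + (\<Sum>p\<in>Mon I m \<times> Mon I (Suc l). g (fst p) (snd p) * (unit_at (fst p) (snd p) \<alpha> - H (fst p + snd p) \<alpha>)) = G \<alpha>"
      using H[of \<alpha>] by (simp add: sum.cartesian_product case_prod_unfold right_diff_distrib sum_subtractf)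
  qed
qed

section \<open>The Gram matrix and the pencil\<close>

text \<open>
  The multinomial coefficients, counted as words with letters from \<open>I\<close> and given content.
\<close>

primrec multinom :: "'n::finite set \<Rightarrow> nat \<Rightarrow> ('n \<Rightarrow>\<^sub>0 nat) \<Rightarrow> real" where
  "multinom I 0 \<beta> = 1"
| "multinom I (Suc j) \<beta> = (\<Sum>i\<in>{i\<in>I. lookup \<beta> i > 0}. multinom I j (\<beta> - unit_exp i))"

lemma multinom_pos: "\<beta> \<in> Mon I j \<Longrightarrow> multinom I j \<beta> > 0"
proof (induction j arbitrary: \<beta>)
  case (Suc j)
  obtain i where "i \<in> I" "lookup \<beta> i > 0"
    using Mon_Suc_split[OF Suc.prems] by metis
  moreover have "multinom I j (\<beta> - unit_exp i) > 0" if "lookup \<beta> i > 0" for i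
    using Suc Mon_minus_unit_exp that by metis
  ultimately show ?case by (auto intro!: sum_pos2[of _ i] intro: less_imp_le)
qed simp

lemma lin_power_expand:
  "lin I x ^ j = (\<Sum>\<alpha>\<in>Mon I j. Const (multinom I j \<alpha> * peval (xpow \<alpha>) x) * xpow \<alpha>)"
proof (induction j)
  case 0
  have "Mon I 0 = {0}"
    by (auto simp: Mon_def intro: exponent_eqI_le) (auto intro!: exponent_eqI_le[of 0, symmetric])
  then show ?case by simp
next
  case (Suc j)
  let ?t = "\<lambda>i \<beta>. Const (multinom I j (\<beta> - unit_exp i) * peval (xpow \<beta>) x) * xpow \<beta>"
  have i: "(\<Sum>\<alpha>\<in>Mon I j. Const (x i) * Var i * (Const (multinom I j \<alpha> * peval (xpow \<alpha>) x) * xpow \<alpha>))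
      = (\<Sum>\<beta>\<in>{\<beta>\<in>Mon I (Suc j). lookup \<beta> i > 0}. ?t i \<beta>)" if "i \<in> I" for i
  proof (rule sum.reindex_bij_witness[where j = "\<lambda>\<alpha>. \<alpha> + unit_exp i" and i = "\<lambda>\<beta>. \<beta> - unit_exp i"])
    fix \<alpha> assume \<alpha>: "\<alpha> \<in> Mon I j"
    show "\<alpha> + unit_exp i \<in> {\<beta>\<in>Mon I (Suc j). lookup \<beta> i > 0}"
      using Mon_add[OF \<alpha> Mon_single[OF that, of 1]] by (simp add: lookup_add)
    show "?t i (\<alpha> + unit_exp i) = Const (x i) * Var i * (Const (multinom I j \<alpha> * peval (xpow \<alpha>) x) * xpow \<alpha>)"
      by (simp add: xpow_add peval_simps Const_hom.hom_mult mult_ac flip: Var_def One_nat_def)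
  qed (use Mon_minus_unit_exp in \<open>auto simp: minus_unit_exp[symmetric] simp del: One_nat_def\<close>)
  have "lin I x ^ Suc j = (\<Sum>i\<in>I. \<Sum>\<alpha>\<in>Mon I j. Const (x i) * Var i * (Const (multinom I j \<alpha> * peval (xpow \<alpha>) x) * xpow \<alpha>))"
    unfolding power_Suc Suc by (subst lin_def) (rule sum_product)
  also have "\<dots> = (\<Sum>i\<in>I. \<Sum>\<beta>\<in>{\<beta>\<in>Mon I (Suc j). lookup \<beta> i > 0}. ?t i \<beta>)"
    by (rule sum.cong[OF refl]) (rule i)
  also have "\<dots> = (\<Sum>\<beta>\<in>Mon I (Suc j). \<Sum>i\<in>{i\<in>I. lookup \<beta> i > 0}. ?t i \<beta>)"
    by (rule sum.swap_restrict) auto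
  finally show ?case
    by (simp add: sum_distrib_right Const_hom.hom_sum)
qed

text \<open>
  The matrix \<open>M(u)\<close> in the Gaussian average.  It has degree \<open>2 d - 2 - a - b\<close> in \<open>u\<close> and is tested
  against \<open>(u \<bullet> x)\<^bsup>k-a\<^esup> (u \<bullet> y)\<^bsup>k-b\<^esup>\<close>.
\<close>

definition kernel_block :: "'n::finite set \<Rightarrow> nat \<Rightarrow> nat \<Rightarrow> (nat \<Rightarrow> nat \<Rightarrow> 'n rpoly) \<Rightarrow> nat \<Rightarrow> nat \<Rightarrow> 'n rpoly" where
  "kernel_block I d k B a b = corrected I (2 * d - 2 - a - b) (2 * k - (a + b)) (B a b)"

text \<open>
  The pair \<open>(a, \<alpha>)\<close> stands for the monomial \<open>t\<^sup>a x\<^sup>\<alpha>\<close> of degree \<open>k\<close>.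
\<close>

definition gram_index :: "'n::finite set \<Rightarrow> nat \<Rightarrow> nat \<Rightarrow> (nat \<times> ('n \<Rightarrow>\<^sub>0 nat)) set" where
  "gram_index I d k = (SIGMA a:{..<d}. Mon I (k - a))"

text \<open>
  The matrix of the biform whose blocks are the averages of
  \<open>M\<^sub>a\<^sub>b(u) (u \<bullet> x)\<^bsup>k-a\<^esup> (u \<bullet> y)\<^bsup>k-b\<^esup> / (2 k - a - b)!\<close> in the basis of monomials.
\<close>

definition gram :: "'n::finite set \<Rightarrow> nat \<Rightarrow> nat \<Rightarrow> (nat \<Rightarrow> nat \<Rightarrow> 'n rpoly)
    \<Rightarrow> nat \<times> ('n \<Rightarrow>\<^sub>0 nat) \<Rightarrow> nat \<times> ('n \<Rightarrow>\<^sub>0 nat) \<Rightarrow> real" where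
  "gram I d k B p q = multinom I (k - fst p) (snd p) * multinom I (k - fst q) (snd q)
    * (gauss (kernel_block I d k B (fst p) (fst q) * xpow (snd p) * xpow (snd q)) / fact (2 * k - (fst p + fst q)))"

lemma finite_gram_index [simp]: "finite (gram_index I d k)"
  by (simp add: gram_index_def)

lemma sum_gram_index: "(\<Sum>p\<in>gram_index I d k. f p) = (\<Sum>a<d. \<Sum>\<alpha>\<in>Mon I (k - a). f (a, \<alpha>))"
  unfolding gram_index_def by (subst sum.Sigma) auto

text \<open>
  The quadratic form of the Gram matrix at \<open>c\<close> is the expectation of the form of \<open>M(u)\<close> at a vector of
  polynomials in \<open>u\<close>.  Its entries are forms of positive degree and do not all vanish identically.
\<close>

lemma gram_pos:
  assumes k: "k \<ge> d"
    and pos: "\<And>u \<xi>. \<exists>i\<in>I. u i \<noteq> 0 \<Longrightarrow> \<exists>a<d. \<xi> a \<noteq> 0 \<Longrightarrow>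
    (\<Sum>a<d. \<Sum>b<d. peval (kernel_block I d k B a b) u / fact (2 * k - (a + b)) * \<xi> a * \<xi> b) > 0"
    and c: "p0 \<in> gram_index I d k" "c p0 \<noteq> 0"
  shows "(\<Sum>p\<in>gram_index I d k. \<Sum>q\<in>gram_index I d k. gram I d k B p q * c p * c q) > 0"
proof -
  define C where "C a = (\<Sum>\<alpha>\<in>Mon I (k - a). Const (multinom I (k - a) \<alpha> * c (a, \<alpha>)) * xpow \<alpha>)" for a
  define Q where "Q = (\<Sum>a<d. \<Sum>b<d. Const (1 / fact (2 * k - (a + b))) * kernel_block I d k B a b * C a * C b)"
  have C: "form_in I (k - a) (C a)" for a
    unfolding C_def by (intro form_in_sum form_in_Const_mult form_in_xpow)
  have "gauss (kernel_block I d k B a b * C a * C b) / fact (2 * k - (a + b))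
      = (\<Sum>\<alpha>\<in>Mon I (k - a). \<Sum>\<beta>\<in>Mon I (k - b). gram I d k B (a, \<alpha>) (b, \<beta>) * c (a, \<alpha>) * c (b, \<beta>))" for a b
  proof -
    have "kernel_block I d k B a b * C a * C b = (\<Sum>\<alpha>\<in>Mon I (k - a). \<Sum>\<beta>\<in>Mon I (k - b).
        Const (multinom I (k - a) \<alpha> * c (a, \<alpha>) * (multinom I (k - b) \<beta> * c (b, \<beta>)))
          * (kernel_block I d k B a b * xpow \<alpha> * xpow \<beta>))"
      unfolding C_def mult.assoc sum_product by (simp add: sum_distrib_left Const_hom.hom_mult mult_ac)
    then show ?thesis
      by (simp only: gauss_sum gauss_Const_mult) (simp add: gram_def sum_divide_distrib mult_ac)
  qed
  then have "(\<Sum>p\<in>gram_index I d k. \<Sum>q\<in>gram_index I d k. gram I d k B p q * c p * c q) =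
      (\<Sum>a<d. \<Sum>b<d. gauss (kernel_block I d k B a b * C a * C b) / fact (2 * k - (a + b)))"
    by (simp add: sum_gram_index sum.swap[of _ "Mon I _" "{..<d}"])
  also have "\<dots> = gauss Q"
    by (simp only: Q_def gauss_sum gauss_Const_mult mult.assoc) simp
  finally have eq: "(\<Sum>p\<in>gram_index I d k. \<Sum>q\<in>gram_index I d k. gram I d k B p q * c p * c q) = gauss Q" .
  have Q: "peval Q u = (\<Sum>a<d. \<Sum>b<d. peval (kernel_block I d k B a b) u / fact (2 * k - (a + b))
      * peval (C a) u * peval (C b) u)" for u
    by (simp add: Q_def peval_simps)
  have C0: "peval (C a) u = 0" if "a < d" "\<not> (\<exists>i\<in>I. u i \<noteq> 0)" for a u
    by (rule peval_form_zero[OF C]) (use that k in auto)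
  have pos': "peval Q u > 0" if "a < d" "peval (C a) u \<noteq> 0" for u a
    unfolding Q by (rule pos) (use C0 that in blast)+
  have "peval Q u \<ge> 0" for u
  proof (cases "\<exists>a<d. peval (C a) u \<noteq> 0")
    case False
    then show ?thesis by (simp add: Q)
  qed (use pos' in \<open>auto intro: less_imp_le\<close>)
  moreover have "\<exists>u. peval Q u \<noteq> 0"
  proof -
    obtain a \<alpha> where p0: "p0 = (a, \<alpha>)" and a: "a < d" and \<alpha>: "\<alpha> \<in> Mon I (k - a)"
      using c(1) by (auto simp: gram_index_def)
    have "lookup (C a) \<alpha> = (\<Sum>\<beta>\<in>Mon I (k - a). if \<beta> = \<alpha> then multinom I (k - a) \<alpha> * c (a, \<alpha>) else 0)"
      unfolding C_def lookup_sum lookup_Const_mult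
      by (intro sum.cong refl) (auto simp: xpow_def lookup_single)
    then have "lookup (C a) \<alpha> \<noteq> 0"
      using \<alpha> c(2) multinom_pos[OF \<alpha>] by (simp add: p0)
    then have "C a \<noteq> 0" by auto
    then obtain u where "peval (C a) u \<noteq> 0" using peval_eq_imp_eq[of "C a" 0] by auto
    then show ?thesis using pos'[OF a] by (metis less_irrefl)
  qed
  ultimately show ?thesis unfolding eq using gauss_pos by blast
qed

definition diag_factor :: "'n::finite set \<Rightarrow> nat \<Rightarrow> nat \<Rightarrow> ('n \<Rightarrow> real) \<Rightarrow> real" where
  "diag_factor I d k x = gauss (lin I x ^ (2 * (k - d + 1))) / fact (2 * (k - d + 1))"

text \<open>
  On the diagonal the two powers of \<open>u \<bullet> x\<close> merge and the correction reproduces \<open>B\<close>.  The scalar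
  factor is the same for all blocks, since the difference of the degrees is always \<open>2 (k - d + 1)\<close>.
\<close>

lemma gram_diag:
  assumes I: "I \<noteq> {}" and k: "k \<ge> d" and ab: "a < d" "b < d"
    and form: "form_in I (2 * d - 2 - a - b) (B a b)"
  shows "(\<Sum>\<alpha>\<in>Mon I (k - a). \<Sum>\<beta>\<in>Mon I (k - b). gram I d k B (a, \<alpha>) (b, \<beta>) * peval (xpow \<alpha>) x * peval (xpow \<beta>) x)
    = diag_factor I d k x * peval (B a b) x"
proof -
  let ?M = "kernel_block I d k B a b" and ?j = "2 * k - (a + b)"
  have j: "?j = (k - a) + (k - b)" using ab k by auto
  have "lin I x ^ ?j = lin I x ^ (k - a) * lin I x ^ (k - b)"
    by (simp only: j power_add)
  then have "?M * lin I x ^ ?j = (\<Sum>\<alpha>\<in>Mon I (k - a). \<Sum>\<beta>\<in>Mon I (k - b).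
      Const (multinom I (k - a) \<alpha> * peval (xpow \<alpha>) x * (multinom I (k - b) \<beta> * peval (xpow \<beta>) x))
        * (?M * xpow \<alpha> * xpow \<beta>))"
    by (simp only: lin_power_expand[of I x "k - a"] lin_power_expand[of I x "k - b"] sum_product)
      (simp add: sum_distrib_left Const_hom.hom_mult mult_ac)
  then have "gauss (?M * lin I x ^ ?j) / fact ?j
      = (\<Sum>\<alpha>\<in>Mon I (k - a). \<Sum>\<beta>\<in>Mon I (k - b). gram I d k B (a, \<alpha>) (b, \<beta>) * peval (xpow \<alpha>) x * peval (xpow \<beta>) x)"
    by (simp only: gauss_sum gauss_Const_mult) (simp add: gram_def sum_divide_distrib mult_ac)
  then have "(\<Sum>\<alpha>\<in>Mon I (k - a). \<Sum>\<beta>\<in>Mon I (k - b). gram I d k B (a, \<alpha>) (b, \<beta>) * peval (xpow \<alpha>) x * peval (xpow \<beta>) x)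
      = gauss (?M * lin I x ^ ?j) / fact ?j" by (rule sym)
  also have "\<dots> = peval (B a b) x * (gauss (lin I x ^ (?j - (2 * d - 2 - a - b))) / fact (?j - (2 * d - 2 - a - b)))"
    unfolding kernel_block_def by (rule gauss_corrected[OF form I]) (use ab k in auto)
  also have "?j - (2 * d - 2 - a - b) = 2 * (k - d + 1)" using ab k by auto
  finally show ?thesis unfolding diag_factor_def by (simp only: mult.commute)
qed

lemma diag_factor_0: "(\<And>i. i \<in> I \<Longrightarrow> x i = 0) \<Longrightarrow> diag_factor I d k x = 0"
  by (simp add: diag_factor_def lin_def)

lemma gram_sym:
  assumes "\<And>a b. a < d \<Longrightarrow> b < d \<Longrightarrow> B a b = B b a" "p \<in> gram_index I d k" "q \<in> gram_index I d k"
  shows "gram I d k B p q = gram I d k B q p"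
proof -
  obtain a \<alpha> b \<beta> where p: "p = (a, \<alpha>)" "q = (b, \<beta>)" "a < d" "b < d"
    using assms by (auto simp: gram_index_def)
  have "kernel_block I d k B a b = kernel_block I d k B b a"
    unfolding kernel_block_def by (simp add: assms(1)[OF p(3,4)] diff_commute[of _ a b] add.commute)
  then show ?thesis by (simp add: p gram_def mult_ac add.commute)
qed

text \<open>
  Multiplication by \<open>t\<close> modulo \<open>H\<^sub>x\<close> turns the blocks of the Gram matrix into \<open>F\<close>.  On the diagonal this
  is a multiple of the companion matrix times the Bezoutian, hence symmetric, so \<open>F\<close> splits into
  coefficients \<open>T\<^sub>i\<close>.  Averaging \<open>T\<^sub>i\<close> with its transpose preserves both splittings and gives the
  symmetric matrices \<open>L\<^sub>i\<close>.
\<close>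

theorem exists_definite_pencil:
  fixes \<eta> :: "nat \<Rightarrow> 'n::finite rpoly"
  assumes I: "I \<noteq> {}" and d: "d > 0"
    and form: "\<And>a. a \<le> d \<Longrightarrow> form_in I (d - a) (\<eta> a)" and zero: "\<And>a. a > d \<Longrightarrow> \<eta> a = 0"
    and lead: "\<eta> d = Const c" "c \<noteq> 0"
    and split: "\<And>x i. i \<in> I \<Longrightarrow> x i \<noteq> 0 \<Longrightarrow> split_simple (\<Sum>a\<le>d. monom (peval (\<eta> a) x) a)"
  obtains J :: "(nat \<times> ('n \<Rightarrow>\<^sub>0 nat)) set" and K L where "finite J"
    "\<And>p q. p \<in> J \<Longrightarrow> q \<in> J \<Longrightarrow> K p q = K q p" "\<And>i p q. p \<in> J \<Longrightarrow> q \<in> J \<Longrightarrow> L i p q = L i q p"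
    "\<And>c p. p \<in> J \<Longrightarrow> c p \<noteq> 0 \<Longrightarrow> (\<Sum>p\<in>J. \<Sum>q\<in>J. K p q * c p * c q) > 0"
    "\<And>x t i. i \<in> I \<Longrightarrow> x i \<noteq> 0 \<Longrightarrow> (\<Sum>a\<le>d. peval (\<eta> a) x * t ^ a) = 0 \<Longrightarrow>
      \<exists>v. (\<exists>p\<in>J. v p \<noteq> 0) \<and> (\<forall>q\<in>J. (\<Sum>p\<in>J. (t * K q p - (\<Sum>i\<in>I. x i * L i q p)) * v p) = 0)"
proof -
  define B where "B a b = bezoutian \<eta> a b" for a b
  define P where "P x = (\<Sum>a\<le>d. monom (peval (\<eta> a) x) a)" for x
  have coeff_P: "coeff (P x) a = peval (\<eta> a) x" for x a
    using zero[of a] by (cases "a \<le> d") (auto simp: P_def Polynomial.coeff_sum)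
  have degree_P: "degree (P x) = d" and lead_P: "lead_coeff (P x) = c" for x
  proof -
    have "coeff (P x) d \<noteq> 0" using lead by (simp add: coeff_P)
    moreover have "degree (P x) \<le> d" by (rule degree_le) (simp add: coeff_P zero)
    ultimately show "degree (P x) = d" by (metis le_antisym le_degree)
    then show "lead_coeff (P x) = c" using lead by (simp add: coeff_P)
  qed
  have B: "peval (B a b) x = bezoutian (coeff (P x)) a b" for a b x
    unfolding B_def by (simp add: peval_hom.hom_bezoutian coeff_P[abs_def])
  have P: "split_simple (P x)" if "i \<in> I" "x i \<noteq> 0" for x i
    unfolding P_def by (rule split[of i x, OF that])
  have form_B: "form_in I (2 * d - 2 - a - b) (B a b)" if "a < d" "b < d" for a b
    unfolding B_def by (rule form_in_bezoutian[OF form zero that])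
  have B_sym: "B a b = B b a" if ab: "a < d" "b < d" for a b
  proof (cases "a = b")
    case False
    show ?thesis
    proof (rule peval_eq_imp_eq)
      fix x
      show "peval (B a b) x = peval (B b a) x"
      proof (cases "\<exists>i\<in>I. x i \<noteq> 0")
        case True
        then show ?thesis unfolding B using bezoutian_sym P by blast
      next
        case xI: False
        have "2 * d - 2 - a - b > 0" "2 * d - 2 - b - a > 0" using ab False by auto
        then show ?thesis
          using xI peval_form_zero[OF form_B[OF ab], of x] peval_form_zero[OF form_B[OF ab(2,1)], of x] by auto
      qed
    qed
  qed simp
  have "\<forall>\<^sub>F k in sequentially. k \<ge> d \<and> (\<forall>u \<xi>. (\<exists>i\<in>I. u i \<noteq> 0) \<longrightarrow> (\<exists>a<d. \<xi> a \<noteq> 0) \<longrightarrow>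
    (\<Sum>a<d. \<Sum>b<d. peval (kernel_block I d k B a b) u / fact (2 * k - (a + b)) * \<xi> a * \<xi> b) > 0)"
    unfolding kernel_block_def
  proof (intro eventually_conj eventually_ge_at_top corrected_pos_def I form_B)
    fix u :: "'n \<Rightarrow> real" and \<xi> :: "nat \<Rightarrow> real" and i a
    assume "i \<in> I" "u i \<noteq> 0" "a < d" "\<xi> a \<noteq> 0"
    then show "(\<Sum>a<d. \<Sum>b<d. peval (B a b) u * \<xi> a * \<xi> b) > 0"
      unfolding B using bezoutian_pos[OF P[of i u], of a \<xi>] by (simp add: degree_P)
  qed auto
  from eventually_happens'[OF sequentially_bot this] obtain k where
    k': "k \<ge> d \<and> (\<forall>u \<xi>. (\<exists>i\<in>I. u i \<noteq> 0) \<longrightarrow> (\<exists>a<d. \<xi> a \<noteq> 0) \<longrightarrow>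
      (\<Sum>a<d. \<Sum>b<d. peval (kernel_block I d k B a b) u / fact (2 * k - (a + b)) * \<xi> a * \<xi> b) > 0)" ..
  then have k: "k \<ge> d" ..
  from k' have pos: "(\<Sum>a<d. \<Sum>b<d. peval (kernel_block I d k B a b) u / fact (2 * k - (a + b)) * \<xi> a * \<xi> b) > 0"
    if "\<exists>i\<in>I. u i \<noteq> 0" "\<exists>a<d. \<xi> a \<noteq> 0" for u \<xi> using that by simp
  let ?J = "gram_index I d k" and ?K = "gram I d k B"
  define \<kappa> where "\<kappa> a q = (\<Sum>\<alpha>\<in>Mon I (k - a). Const (?K (a, \<alpha>) q) * xpow \<alpha>)" for a q
  have form_\<kappa>: "form_in I (k - a) (\<kappa> a q)" for a q
    unfolding \<kappa>_def by (intro form_in_sum form_in_Const_mult form_in_xpow)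
  \<comment> \<open>the blocks of the matrix of multiplication by the distinguished variable, modulo the polynomial\<close>
  define F where "F a b \<beta> = (if a = 0 then 0 else \<kappa> (a - 1) (b, \<beta>)) - Const (1 / c) * \<eta> a * \<kappa> (d - 1) (b, \<beta>)" for a b \<beta>
  have form_F: "form_in I (Suc (k - a)) (F a b \<beta>)" if "a < d" for a b \<beta>
  proof -
    have "form_in I (Suc (k - a)) (\<kappa> (a - 1) (b, \<beta>))" if "a \<noteq> 0"
    proof -
      have "k - (a - 1) = Suc (k - a)" using that \<open>a < d\<close> k by auto
      then show ?thesis using form_\<kappa>[of "a - 1"] by metis
    qed
    moreover have "form_in I (Suc (k - a)) (Const (1 / c) * \<eta> a * \<kappa> (d - 1) (b, \<beta>))"
    proof -
      have "form_in I (0 + (d - a) + (k - (d - 1))) (Const (1 / c) * \<eta> a * \<kappa> (d - 1) (b, \<beta>))"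
        using that by (intro form_in_mult form_in_Const form form_\<kappa>) auto
      moreover have "0 + (d - a) + (k - (d - 1)) = Suc (k - a)" using that k by auto
      ultimately show ?thesis by metis
    qed
    ultimately show ?thesis unfolding F_def by (intro form_in_diff) auto
  qed
  have peval_\<kappa>: "(\<Sum>\<beta>\<in>Mon I (k - b). peval (\<kappa> a (b, \<beta>)) x * peval (xpow \<beta>) x) = diag_factor I d k x * peval (B a b) x"
    if "a < d" "b < d" for a b x
    using gram_diag[where B = B and x = x, OF I k that form_B[OF that]]
    by (simp add: \<kappa>_def peval_simps sum_distrib_right sum.swap[of _ "Mon I (k - a)"])
  have peval_F: "peval (\<Sum>\<beta>\<in>Mon I (k - b). F a b \<beta> * xpow \<beta>) x = diag_factor I d k x *
      ((if a = 0 then 0 else peval (B (a - 1) b) x) - peval (\<eta> a) x / c * peval (B (d - 1) b) x)"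
    if ab: "a < d" "b < d" for a b x
  proof -
    have "peval (\<Sum>\<beta>\<in>Mon I (k - b). F a b \<beta> * xpow \<beta>) x =
       (if a = 0 then 0 else (\<Sum>\<beta>\<in>Mon I (k - b). peval (\<kappa> (a - 1) (b, \<beta>)) x * peval (xpow \<beta>) x))
       - peval (\<eta> a) x / c * (\<Sum>\<beta>\<in>Mon I (k - b). peval (\<kappa> (d - 1) (b, \<beta>)) x * peval (xpow \<beta>) x)"
      by (simp add: F_def peval_simps left_diff_distrib sum_subtractf sum_distrib_left mult.assoc)
    then show ?thesis using ab d by (simp add: peval_\<kappa> right_diff_distrib)
  qed
  have F_eq: "(\<Sum>\<beta>\<in>Mon I (k - b). F a b \<beta> * xpow \<beta>) = (\<Sum>\<alpha>\<in>Mon I (k - a). F b a \<alpha> * xpow \<alpha>)"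
    if ab: "a < d" "b < d" for a b
  proof (rule peval_eq_imp_eq)
    fix x
    show "peval (\<Sum>\<beta>\<in>Mon I (k - b). F a b \<beta> * xpow \<beta>) x = peval (\<Sum>\<alpha>\<in>Mon I (k - a). F b a \<alpha> * xpow \<alpha>) x"
    proof (cases "\<exists>i\<in>I. x i \<noteq> 0")
      case True
      then have "split_simple (P x)" using P by blast
      from bezoutian_companion_sym[OF this, of a b] show ?thesis
        unfolding peval_F[OF ab] peval_F[OF ab(2,1)] by (simp only: B degree_P lead_P coeff_P lead(1) peval_Const)
    next
      case False
      then show ?thesis
        unfolding peval_F[OF ab] peval_F[OF ab(2,1)] by (simp add: diag_factor_0)
    qed
  qed
  define S where "S a b T \<longleftrightarrow>
     (\<forall>\<beta>\<in>Mon I (k - b). F a b \<beta> = (\<Sum>i\<in>I. Var i * (\<Sum>\<alpha>\<in>Mon I (k - a). Const (T i \<alpha> \<beta>) * xpow \<alpha>))) \<and>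
     (\<forall>\<alpha>\<in>Mon I (k - a). F b a \<alpha> = (\<Sum>i\<in>I. Var i * (\<Sum>\<beta>\<in>Mon I (k - b). Const (T i \<alpha> \<beta>) * xpow \<beta>)))" for a b T
  define T where "T a b = (SOME T. S a b T)" for a b
  have T: "S a b (T a b)" if "a < d" "b < d" for a b
  proof -
    have "bisplit I (k - a) (k - b) (F a b) (F b a)"
      using that by (intro bisplit_exists form_F F_eq)
    then have "\<exists>T. S a b T" by (simp only: bisplit_def S_def)
    then show ?thesis unfolding T_def by (rule someI_ex)
  qed
  have T1: "F a b \<beta> = (\<Sum>i\<in>I. Var i * (\<Sum>\<alpha>\<in>Mon I (k - a). Const (T a b i \<alpha> \<beta>) * xpow \<alpha>))"
    if "a < d" "b < d" "\<beta> \<in> Mon I (k - b)" for a b \<beta>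
    using T[OF that(1,2)] that(3) unfolding S_def by (elim conjE bspec)
  have T2: "F b a \<alpha> = (\<Sum>i\<in>I. Var i * (\<Sum>\<beta>\<in>Mon I (k - b). Const (T a b i \<alpha> \<beta>) * xpow \<beta>))"
    if "a < d" "b < d" "\<alpha> \<in> Mon I (k - a)" for a b \<alpha>
    using T[OF that(1,2)] that(3) unfolding S_def by (elim conjE bspec)
  define L where "L i p q = (T (fst p) (fst q) i (snd p) (snd q) + T (fst q) (fst p) i (snd q) (snd p)) / 2" for i p q
  have K_sym: "?K p q = ?K q p" if "p \<in> ?J" "q \<in> ?J" for p q
    by (rule gram_sym[OF B_sym that])
  show ?thesis
  proof (rule that[of ?J ?K L])
    show "(\<Sum>p\<in>?J. \<Sum>q\<in>?J. ?K p q * c p * c q) > 0" if "p \<in> ?J" "c p \<noteq> 0" for c p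
      by (rule gram_pos[where ?p0.0 = p]) (use k pos that in auto)
    show "\<exists>v. (\<exists>p\<in>?J. v p \<noteq> 0) \<and> (\<forall>q\<in>?J. (\<Sum>p\<in>?J. (t * ?K q p - (\<Sum>i\<in>I. x i * L i q p)) * v p) = 0)"
      if i: "i \<in> I" "x i \<noteq> 0" and root: "(\<Sum>a\<le>d. peval (\<eta> a) x * t ^ a) = 0" for x t i
    proof (intro exI conjI ballI)
      let ?v = "\<lambda>p. t ^ fst p * peval (xpow (snd p)) x"
      have "(0, single i k) \<in> ?J"
        using Mon_single[OF i(1)] d by (simp add: gram_index_def)
      moreover have "peval (xpow (single i k)) x = x i ^ k"
      proof -
        have "(\<Prod>j\<in>UNIV. x j ^ lookup (single i k) j) = (\<Prod>j\<in>UNIV. if j = i then x i ^ k else 1)"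
          by (rule prod.cong) (auto simp: lookup_single)
        then show ?thesis by (simp add: peval_xpow)
      qed
      ultimately show "\<exists>p\<in>?J. ?v p \<noteq> 0" using i(2) by (intro bexI) auto
      fix q assume q: "q \<in> ?J"
      then obtain b \<beta> where q': "q = (b, \<beta>)" "b < d" "\<beta> \<in> Mon I (k - b)" by (auto simp: gram_index_def)
      have "(\<Sum>p\<in>?J. ?K q p * ?v p) = (\<Sum>p\<in>?J. ?K p q * ?v p)"
        by (intro sum.cong refl) (use K_sym q in simp)
      also have "\<dots> = (\<Sum>a<d. t ^ a * peval (\<kappa> a q) x)"
        by (simp add: sum_gram_index \<kappa>_def peval_simps sum_distrib_left mult_ac)
      finally have Kv: "(\<Sum>p\<in>?J. ?K q p * ?v p) = (\<Sum>a<d. t ^ a * peval (\<kappa> a q) x)" .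
      have "(\<Sum>\<alpha>\<in>Mon I (k - a). (\<Sum>i\<in>I. x i * L i q (a, \<alpha>)) * peval (xpow \<alpha>) x) = peval (F a b \<beta>) x" if "a < d" for a
      proof -
        have "(\<Sum>\<alpha>\<in>Mon I (k - a). (\<Sum>i\<in>I. x i * L i q (a, \<alpha>)) * peval (xpow \<alpha>) x) =
            (\<Sum>i\<in>I. x i * (\<Sum>\<alpha>\<in>Mon I (k - a). T b a i \<beta> \<alpha> * peval (xpow \<alpha>) x)) / 2
            + (\<Sum>i\<in>I. x i * (\<Sum>\<alpha>\<in>Mon I (k - a). T a b i \<alpha> \<beta> * peval (xpow \<alpha>) x)) / 2"
          by (simp add: L_def q' sum_distrib_right sum_distrib_left sum.swap[of _ I] sum_divide_distrib
              algebra_simps add_divide_distrib sum.distrib)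
        also have "(\<Sum>i\<in>I. x i * (\<Sum>\<alpha>\<in>Mon I (k - a). T b a i \<beta> \<alpha> * peval (xpow \<alpha>) x)) = peval (F a b \<beta>) x"
          by (subst T2[OF q'(2) that q'(3)]) (simp add: peval_simps)
        also have "(\<Sum>i\<in>I. x i * (\<Sum>\<alpha>\<in>Mon I (k - a). T a b i \<alpha> \<beta> * peval (xpow \<alpha>) x)) = peval (F a b \<beta>) x"
          by (subst T1[OF that q'(2) q'(3)]) (simp add: peval_simps)
        finally show ?thesis by simp
      qed
      then have "(\<Sum>p\<in>?J. (\<Sum>i\<in>I. x i * L i q p) * ?v p) = (\<Sum>a<d. t ^ a * peval (F a b \<beta>) x)"
        by (simp add: sum_gram_index mult.left_commute[of _ "t ^ _"] flip: sum_distrib_left)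
      also have "\<dots> = (\<Sum>a<d. t ^ a * (if a = 0 then 0 else peval (\<kappa> (a - 1) q) x))
          - (\<Sum>a<d. peval (\<eta> a) x * t ^ a) / c * peval (\<kappa> (d - 1) q) x"
        by (simp add: F_def q' peval_simps right_diff_distrib sum_subtractf sum_distrib_right sum_distrib_left
            sum_divide_distrib mult_ac if_distrib[of "\<lambda>p. peval p x"] cong: if_cong)
      also have "(\<Sum>a<d. peval (\<eta> a) x * t ^ a) = - c * t ^ d"
        using root lead by (simp add: lessThan_Suc_atMost[symmetric])
      also have "(\<Sum>a<d. t ^ a * (if a = 0 then 0 else peval (\<kappa> (a - 1) q) x)) - - c * t ^ d / c * peval (\<kappa> (d - 1) q) x
          = t * (\<Sum>a<d. t ^ a * peval (\<kappa> a q) x)"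
      proof -
        obtain d' where d': "d = Suc d'" using d by (cases d) auto
        show ?thesis using lead(2) unfolding d' by (subst sum.lessThan_Suc_shift)
          (simp add: sum_distrib_left algebra_simps)
      qed
      finally have Lv: "(\<Sum>p\<in>?J. (\<Sum>i\<in>I. x i * L i q p) * ?v p) = t * (\<Sum>a<d. t ^ a * peval (\<kappa> a q) x)" .
      have "(\<Sum>p\<in>?J. (t * ?K q p - (\<Sum>i\<in>I. x i * L i q p)) * ?v p)
          = t * (\<Sum>p\<in>?J. ?K q p * ?v p) - (\<Sum>p\<in>?J. (\<Sum>i\<in>I. x i * L i q p) * ?v p)"
        by (simp add: left_diff_distrib sum_subtractf sum_distrib_left mult.assoc)
      then show "(\<Sum>p\<in>?J. (t * ?K q p - (\<Sum>i\<in>I. x i * L i q p)) * ?v p) = 0"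
        unfolding Kv Lv by simp
    qed
  qed (use K_sym in \<open>auto simp: L_def\<close>)
qed

section \<open>Smooth hyperbolic polynomials have simple roots\<close>

lemma poly_complex_of_real: "poly (map_poly complex_of_real p) (complex_of_real r) = complex_of_real (poly p r)"
  by (induction p) (auto simp: map_poly_pCons)

lemma map_poly_complex_mult:
  "map_poly complex_of_real (p * q) = map_poly complex_of_real p * map_poly complex_of_real q"
  by (rule poly_eqI) (simp add: coeff_map_poly coeff_mult)

lemma real_rooted_mult:
  assumes "real_rooted (p * q)"
  shows "real_rooted p" "real_rooted q"
  using assms by (auto simp: real_rooted_def map_poly_complex_mult)

lemma real_rooted_split:
  assumes "real_rooted p" "p \<noteq> 0"
  obtains rs where "p = Polynomial.smult (lead_coeff p) (\<Prod>r\<leftarrow>rs. [:- r, 1:])" "degree p = length rs"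
proof -
  have "\<exists>rs. p = Polynomial.smult (lead_coeff p) (\<Prod>r\<leftarrow>rs. [:- r, 1:]) \<and> degree p = length rs"
    using assms
  proof (induction "degree p" arbitrary: p)
    case 0
    then obtain c where "p = [:c:]" by (metis degree_eq_zeroE)
    then show ?case by (intro exI[of _ "[]"]) simp
  next
    case (Suc n)
    have "degree (map_poly complex_of_real p) = Suc n"
      using Suc.hyps(2) by (simp add: degree_map_poly)
    then have "\<not> constant (poly (map_poly complex_of_real p))"
      by (simp add: constant_degree)
    then obtain z where z: "poly (map_poly complex_of_real p) z = 0"
      using fundamental_theorem_of_algebra by blast
    then have "z \<in> \<real>" using Suc.prems by (simp add: real_rooted_def)
    then obtain r where "z = complex_of_real r" by (elim Reals_cases)
    then have "poly p r = 0" using z by (simp add: poly_complex_of_real)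
    then obtain q where q: "p = [:- r, 1:] * q" by (metis poly_eq_0_iff_dvd dvdE)
    have q0: "q \<noteq> 0" using q Suc.prems by auto
    then have "degree p = 1 + degree q" unfolding q by (subst degree_mult_eq) auto
    moreover have "real_rooted q" using real_rooted_mult Suc.prems q by metis
    ultimately obtain rs where rs: "q = Polynomial.smult (lead_coeff q) (\<Prod>r\<leftarrow>rs. [:- r, 1:])" "degree q = length rs"
      using Suc.hyps q0 by (metis Suc_inject plus_1_eq_Suc)
    have l: "lead_coeff p = lead_coeff q" unfolding q lead_coeff_mult by simp
    have "p = [:- r, 1:] * Polynomial.smult (lead_coeff q) (\<Prod>r\<leftarrow>rs. [:- r, 1:])"
      using q rs(1) by metis
    then have "p = Polynomial.smult (lead_coeff p) (\<Prod>r\<leftarrow>r # rs. [:- r, 1:])"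
      unfolding l by (simp only: mult_smult_right list.map prod_list.Cons)
    moreover have "degree p = length (r # rs)" using \<open>degree p = 1 + degree q\<close> rs(2) by simp
    ultimately show ?case by blast
  qed
  then show ?thesis using that by blast
qed

lemma poly_prod_linear: "poly (\<Prod>r\<leftarrow>rs. [:- r, 1:]) t = (\<Prod>r\<leftarrow>rs. t - r :: real)"
  by (induction rs) (auto simp: algebra_simps)

lemma coeff_linear_mult:
  fixes r :: "'a::comm_ring_1"
  shows
  "coeff ([:- r, 1:] * q) n
     = (if n = 0 then 0 else coeff q (n - 1)) - r * coeff q n"
proof -
  have "[:- r, 1:] * q = pCons 0 q - Polynomial.smult r q" by simp
  then show ?thesis by (simp add: coeff_pCons split: nat.splits)
qed

text \<open>
  Newton's formula for the sum of the squares of the reciprocals of the roots.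
\<close>

lemma low_coeffs_real_roots:
  fixes l :: real and rs
  defines "p \<equiv> Polynomial.smult l (\<Prod>r\<leftarrow>rs. [:- r, 1:])"
  assumes "0 \<notin> set rs"
  shows "coeff p 1 ^ 2 - 2 * coeff p 0 * coeff p 2
    = coeff p 0 ^ 2 * (\<Sum>r\<leftarrow>rs. 1 / r ^ 2)"
proof -
  have "coeff q 1 ^ 2 - 2 * coeff q 0 * coeff q 2
    = coeff q 0 ^ 2 * (\<Sum>r\<leftarrow>rs. 1 / r ^ 2)" if "q = (\<Prod>r\<leftarrow>rs. [:- r, 1:])" for q
    using that assms(2)
  proof (induction rs arbitrary: q)
    case (Cons r rs)
    let ?q = "\<Prod>r\<leftarrow>rs. [:- r, 1:]"
    have IH: "coeff ?q 1 ^ 2 - 2 * coeff ?q 0 * coeff ?q 2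
        = coeff ?q 0 ^ 2 * (\<Sum>r\<leftarrow>rs. 1 / r ^ 2)"
      using Cons by simp
    have r: "r \<noteq> 0" using Cons.prems by simp
    have q: "q = [:- r, 1:] * ?q" using Cons.prems(1) by (simp only: list.map prod_list.Cons)
    have "coeff q 1 ^ 2 - 2 * coeff q 0 * coeff q 2 =
        coeff ?q 0 ^ 2 + r ^ 2 * (coeff ?q 1 ^ 2 - 2 * coeff ?q 0 * coeff ?q 2)"
      unfolding q coeff_linear_mult by (simp add: power2_eq_square algebra_simps)
    also have "\<dots> = coeff q 0 ^ 2 * (1 / r ^ 2 + (\<Sum>r\<leftarrow>rs. 1 / r ^ 2))"
      unfolding IH unfolding q coeff_linear_mult using r by (simp add: power_mult_distrib field_simps)
    finally show ?case by simp
  qed simp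
  from this[OF refl] show ?thesis unfolding p_def
    by (simp add: power_mult_distrib) (simp add: power2_eq_square algebra_simps)
qed

text \<open>
  If the constant coefficient is small, some root is small, and then the sum of the squared reciprocals
  is large.
\<close>

lemma small_root_bound:
  assumes p: "real_rooted p" "p \<noteq> 0" and d: "degree p > 0" and a0: "coeff p 0 \<noteq> 0"
    and \<delta>: "\<delta> > 0" "\<bar>coeff p 0\<bar> < \<bar>lead_coeff p\<bar> * \<delta> ^ degree p"
  shows "coeff p 0 ^ 2 \<le> \<delta> ^ 2 * (coeff p 1 ^ 2 - 2 * coeff p 0 * coeff p 2)"
proof -
  obtain rs where rs: "p = Polynomial.smult (lead_coeff p) (\<Prod>r\<leftarrow>rs. [:- r, 1:])" "degree p = length rs"
    using real_rooted_split[OF p] by blast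
  have "poly p 0 = lead_coeff p * (\<Prod>r\<leftarrow>rs. - r)"
    by (subst rs(1)) (simp add: poly_prod_linear)
  then have a0': "coeff p 0 = lead_coeff p * (\<Prod>r\<leftarrow>rs. - r)"
    by (simp add: poly_0_coeff_0)
  have nz: "0 \<notin> set rs"
  proof
    assume "0 \<in> set rs"
    then have "(\<Prod>r\<leftarrow>rs. - r) = 0" by (auto simp: prod_list_zero_iff)
    then show False using a0 a0' by simp
  qed
  have "\<exists>r\<in>set rs. \<bar>r\<bar> < \<delta>"
  proof (rule ccontr)
    assume "\<not> ?thesis"
    then have "\<forall>r\<in>set rs. \<delta> \<le> \<bar>r\<bar>" by auto
    then have "\<delta> ^ length rs \<le> \<bar>\<Prod>r\<leftarrow>rs. - r\<bar>"
      by (induction rs) (auto simp: abs_mult intro!: mult_mono simp: \<delta>(1) less_imp_le)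
    then have "\<bar>lead_coeff p\<bar> * \<delta> ^ degree p \<le> \<bar>coeff p 0\<bar>"
      unfolding a0' rs(2) abs_mult by (rule mult_left_mono) simp
    then show False using \<delta>(2) by simp
  qed
  then obtain r where r: "r \<in> set rs" "\<bar>r\<bar> < \<delta>" by blast
  have r0: "r \<noteq> 0" using r nz by auto
  have "1 / r ^ 2 \<le> (\<Sum>r\<leftarrow>rs. 1 / r ^ 2)"
    by (rule member_le_sum_list) (use r in auto)
  moreover have "1 / \<delta> ^ 2 \<le> 1 / r ^ 2"
    using r r0 \<delta>(1) by (intro divide_left_mono) (auto simp: abs_le_square_iff[symmetric])
  ultimately have "coeff p 0 ^ 2 * (1 / \<delta> ^ 2) \<le> coeff p 0 ^ 2 * (\<Sum>r\<leftarrow>rs. 1 / r ^ 2)"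
    by (intro mult_left_mono) auto
  also have "\<dots> = coeff p 1 ^ 2 - 2 * coeff p 0 * coeff p 2"
    using low_coeffs_real_roots[OF nz, of "lead_coeff p"] rs(1) by simp
  finally show ?thesis using \<delta>(1) by (simp add: field_simps)
qed

text \<open>
  A curve of zeros \<open>s \<mapsto> r(s)\<close> with \<open>r'(0) = 0\<close> cannot occur in a real-rooted family.  For \<open>r\<close> of the sign
  that makes the product of the coefficients of index 0 and 2 nonnegative up to order \<open>r\<^sup>2\<close>, the
  quantity \<open>a\<^sub>1\<^sup>2 - 2 a\<^sub>0 a\<^sub>2\<close> is at most of order \<open>r\<^sup>2\<close>.  By the previous lemma it dominates
  \<open>a\<^sub>0\<^sup>2\<close> divided by an arbitrarily small constant, so \<open>a\<^sub>0\<close> cannot be of exact order \<open>r\<close>.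
\<close>

lemma real_rooted_family_no_turning_point:
  fixes P :: "real \<Rightarrow> real poly" and b g A :: "real poly"
  assumes rr: "\<And>r. real_rooted (P r)" and deg: "\<And>r. degree (P r) = d" "d > 0"
    and lc: "\<And>r. lead_coeff (P r) = l" "l \<noteq> 0"
    and c0: "\<And>r. coeff (P r) 0 = r * poly b r"
    and c1: "\<And>r. coeff (P r) 1 = r * poly g r"
    and c2: "\<And>r. coeff (P r) 2 = poly A r"
  shows "poly b 0 = 0"
proof (rule ccontr)
  assume b0: "poly b 0 \<noteq> 0"
  \<comment> \<open>\<open>\<sigma>\<close> is the sign of \<open>r\<close> for which \<open>a\<^sub>0 a\<^sub>2\<close> is nonnegative to first order\<close>
  define \<sigma> :: real where "\<sigma> = (if poly (b * A) 0 \<ge> 0 then 1 else - 1)"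
  have \<sigma>: "\<sigma> ^ 2 = 1" "\<sigma> * poly (b * A) 0 \<ge> 0" "\<sigma> \<noteq> 0" by (auto simp: \<sigma>_def)
  obtain m where m: "b * A = pCons (poly (b * A) 0) m"
    by (metis pCons_cases poly_pCons mult_zero_left add.right_neutral)
  define U where "U = g * g - Polynomial.smult 2 m"
  define C where "C = \<bar>poly U 0\<bar> + 1"
  define \<delta> where "\<delta> = \<bar>poly b 0\<bar> / (2 * sqrt C)"
  have C: "C > 0" by (simp add: C_def)
  have \<delta>: "\<delta> > 0" "\<delta> ^ 2 * C = poly b 0 ^ 2 / 4"
    using b0 C by (auto simp: \<delta>_def power_divide power_mult_distrib)
  have tends: "((\<lambda>\<rho>. poly q (\<sigma> * \<rho>)) \<longlongrightarrow> poly q 0) (at_right 0)" for q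
  proof -
    have "isCont (\<lambda>\<rho>. poly q (\<sigma> * \<rho>)) 0" by (intro continuous_intros)
    then have "((\<lambda>\<rho>. poly q (\<sigma> * \<rho>)) \<longlongrightarrow> poly q (\<sigma> * 0)) (at 0)" unfolding isCont_def .
    then show ?thesis by (auto intro: filterlim_at_split[THEN iffD1, THEN conjunct2])
  qed
  have "\<forall>\<^sub>F \<rho> in at_right 0. poly U (\<sigma> * \<rho>) < C"
    by (rule order_tendstoD(2)[OF tends]) (simp add: C_def)
  moreover have "\<forall>\<^sub>F \<rho> in at_right 0. poly b 0 ^ 2 / 4 < poly (b * b) (\<sigma> * \<rho>)"
    by (rule order_tendstoD(1)[OF tends]) (use b0 in \<open>auto simp: power2_eq_square zero_less_mult_iff linorder_neq_iff\<close>)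
  moreover have "\<forall>\<^sub>F \<rho> in at_right 0. poly ([:0, 1:] * b) (\<sigma> * \<rho>) < \<bar>l\<bar> * \<delta> ^ d"
    by (rule order_tendstoD(2)[OF tends]) (use lc(2) \<delta> in simp)
  moreover have "\<forall>\<^sub>F \<rho> in at_right 0. poly ([:0, 1:] * b) (\<sigma> * \<rho>) > - (\<bar>l\<bar> * \<delta> ^ d)"
    by (rule order_tendstoD(1)[OF tends]) (use lc(2) \<delta> in simp)
  moreover have "\<forall>\<^sub>F \<rho> in at_right 0. \<rho> > (0::real)"
    by (simp add: eventually_at_right_less)
  ultimately have "\<forall>\<^sub>F \<rho> in at_right (0::real). False"
  proof eventually_elim
    case (elim \<rho>)
    define r where "r = \<sigma> * \<rho>"
    have r: "r \<noteq> 0" "r ^ 2 = \<rho> ^ 2" using elim(5) \<sigma> by (auto simp: r_def power_mult_distrib)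
    have "poly b 0 ^ 2 / 4 > 0" using b0 by simp
    then have "poly b r \<noteq> 0" using elim(2) unfolding r_def[symmetric] by auto
    then have nz: "coeff (P r) 0 \<noteq> 0" using r by (simp add: c0)
    have "\<bar>coeff (P r) 0\<bar> < \<bar>lead_coeff (P r)\<bar> * \<delta> ^ degree (P r)"
      using elim(3,4) by (simp add: c0 lc(1)[unfolded deg] deg flip: r_def)
    then have "coeff (P r) 0 ^ 2
        \<le> \<delta> ^ 2 * (coeff (P r) 1 ^ 2 - 2 * coeff (P r) 0 * coeff (P r) 2)"
      using nz deg \<delta>(1) rr by (intro small_root_bound) auto
    also have "coeff (P r) 1 ^ 2 - 2 * coeff (P r) 0 * coeff (P r) 2
        = r ^ 2 * poly (g * g) r - 2 * r * poly (b * A) r"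
      by (simp add: c0 c1[simplified] c2 power2_eq_square)
    also have "poly (b * A) r = poly (b * A) 0 + r * poly m r"
      by (subst m) simp
    also have "r ^ 2 * poly (g * g) r - 2 * r * (poly (b * A) 0 + r * poly m r)
        = r ^ 2 * poly U r - 2 * \<rho> * (\<sigma> * poly (b * A) 0)"
      by (simp add: U_def r_def algebra_simps power2_eq_square)
    also have "\<dots> \<le> r ^ 2 * C"
    proof -
      have "r ^ 2 * poly U r \<le> r ^ 2 * C" using elim(1) by (intro mult_left_mono) (auto simp: r_def)
      moreover have "0 \<le> 2 * \<rho> * (\<sigma> * poly (b * A) 0)" 
        by (rule mult_nonneg_nonneg[OF _ \<sigma>(2)]) (use elim(5) in simp)
      ultimately show ?thesis by linarith
    qed
    finally have "r ^ 2 * (poly b r) ^ 2 \<le> \<delta> ^ 2 * (r ^ 2 * C)"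
      by (simp add: c0 power_mult_distrib mult_left_mono)
    then have "r ^ 2 * (poly b r) ^ 2 \<le> r ^ 2 * (\<delta> ^ 2 * C)" by (simp add: mult_ac)
    then have "(poly b r) ^ 2 \<le> \<delta> ^ 2 * C" by (rule mult_left_le_imp_le) (use r(1) in simp)
    then show False using elim(2) \<delta>(2) by (simp add: r_def power2_eq_square)
  qed
  then show False by simp
qed

lemma coeff_line_poly_polynomial:
  "\<exists>A. \<forall>r j. coeff (line_poly f e (p + r *\<^sub>R a)) j = poly (A j) r"
proof (induction f rule: rpoly_induct)
  case (single m c)
  show ?case unfolding single_eq_Const_xpow
  proof (induction m rule: exponent_induct)
    case zero
    show ?case by (intro exI[of _ "\<lambda>j. if j = 0 then [:c:] else 0"]) (auto simp: coeff_pCons split: nat.splits)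
  next
    case (add m i)
    then obtain A where A: "\<And>r j. coeff (line_poly (Const c * xpow m) e (p + r *\<^sub>R a)) j = poly (A j) r"
      by blast
    have "Const c * xpow (m + single i 1) = Const c * xpow m * Var i"
      by (simp add: xpow_add Var_def mult.assoc)
    then have "line_poly (Const c * xpow (m + single i 1)) e (p + r *\<^sub>R a)
       = Polynomial.smult (vec_nth p i + r * vec_nth a i) (line_poly (Const c * xpow m) e (p + r *\<^sub>R a))
         + pCons 0 (Polynomial.smult (vec_nth e i) (line_poly (Const c * xpow m) e (p + r *\<^sub>R a)))" for r
      by (simp only: line_poly_hom.hom_mult[of "_ * _"] line_poly_Var) (simp add: mult.commute)
    then show ?case
      by (intro exI[of _ "\<lambda>j. [:vec_nth p i, vec_nth a i:] * A j + (if j = 0 then 0 else Polynomial.smult (vec_nth e i) (A (j - 1)))"])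
        (auto simp: A coeff_pCons algebra_simps split: nat.splits)
  qed
next
  case (add f g)
  then obtain A B where "\<And>r j. coeff (line_poly f e (p + r *\<^sub>R a)) j = poly (A j) r"
    "\<And>r j. coeff (line_poly g e (p + r *\<^sub>R a)) j = poly (B j) r" by metis
  then show ?case
    by (intro exI[of _ "\<lambda>j. A j + B j"]) (simp add: line_poly_hom.hom_add)
qed

lemma line_poly_xpow:
  "degree (line_poly (xpow m) e v) \<le> mdeg m \<and>
   coeff (line_poly (xpow m) e v) (mdeg m) = mpoly_eval (xpow m) e"
proof (induction m rule: exponent_induct)
  case zero
  show ?case by (simp add: mpoly_eval_peval)
next
  case (add m i)
  let ?L = "line_poly (xpow m) e v"
  have eq: "line_poly (xpow (m + single i 1)) e v = [:vec_nth v i, vec_nth e i:] * ?L"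
    by (simp only: xpow_add line_poly_hom.hom_mult mult.commute[of ?L] flip: Var_def) simp
  have "degree ([:vec_nth v i, vec_nth e i:] * ?L) \<le> 1 + mdeg m"
    using add degree_mult_le[of "[:vec_nth v i, vec_nth e i:]" ?L] by (auto split: if_splits)
  moreover have "coeff ([:vec_nth v i, vec_nth e i:] * ?L) (Suc (mdeg m)) = vec_nth e i * mpoly_eval (xpow m) e"
    using add by (simp add: coeff_eq_0)
  moreover have "mpoly_eval (xpow (m + single i 1)) e = vec_nth e i * mpoly_eval (xpow m) e"
    by (simp only: mpoly_eval_peval peval_simps xpow_add peval_Var mult.commute flip: Var_def)
  ultimately show ?case unfolding eq by simp
qed

lemma
  assumes "form_in UNIV d f"
  shows degree_line_poly_le: "degree (line_poly f e v) \<le> d"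
    and coeff_line_poly_top: "coeff (line_poly f e v) d = mpoly_eval f e"
proof -
  have eq: "line_poly f e v = (\<Sum>m\<in>Mon UNIV d. Polynomial.smult (lookup f m) (line_poly (xpow m) e v))"
    by (subst form_in_expand[OF assms]) (simp add: line_poly_hom.hom_sum line_poly_hom.hom_mult)
  show "degree (line_poly f e v) \<le> d"
    unfolding eq
  proof (rule degree_sum_le[OF finite_Mon])
    fix m :: "'a \<Rightarrow>\<^sub>0 nat" assume "m \<in> Mon UNIV d"
    then show "degree (Polynomial.smult (lookup f m) (line_poly (xpow m) e v)) \<le> d"
      using line_poly_xpow[of m e v] degree_smult_le[of "lookup f m" "line_poly (xpow m) e v"]
      by (auto simp: Mon_def)
  qed
  have "coeff (line_poly f e v) d = (\<Sum>m\<in>Mon UNIV d. lookup f m * mpoly_eval (xpow m) e)"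
    unfolding eq Polynomial.coeff_sum
    by (intro sum.cong refl) (use line_poly_xpow in \<open>auto simp: Mon_def\<close>)
  also have "\<dots> = mpoly_eval f e"
    by (subst (2) form_in_expand[OF assms]) (simp add: mpoly_eval_peval peval_simps)
  finally show "coeff (line_poly f e v) d = mpoly_eval f e" .
qed

lemma degree_line_poly:
  assumes "form_in UNIV d f" "mpoly_eval f e \<noteq> 0"
  shows "degree (line_poly f e v) = d" "lead_coeff (line_poly f e v) = mpoly_eval f e"
  using degree_line_poly_le[OF assms(1), of e v] coeff_line_poly_top[OF assms(1), of e v] assms(2)
  by (metis le_antisym le_degree)+

text \<open>
  The lines parallel to \<open>e\<close> through \<open>p + r \<nabla>h(p)\<close> form a real-rooted family.  If \<open>\<nabla>h(p)\<close> were
  orthogonal to \<open>e\<close>, the coefficient of index 1 would vanish at \<open>r = 0\<close> while the constant coefficient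
  has derivative \<open>\<bar>\<nabla>h(p)\<bar>\<^sup>2\<close>.
\<close>

lemma hyperbolic_smooth_transversal:
  assumes form: "form_in UNIV d h" and d: "d > 0" and hyp: "hyperbolic_wrt h e"
    and zero: "mpoly_eval h p = 0" and smooth: "gradient h p \<noteq> 0"
  shows "gradient h p \<bullet> e \<noteq> 0"
proof
  assume e0: "gradient h p \<bullet> e = 0"
  let ?a = "gradient h p"
  have he: "mpoly_eval h e \<noteq> 0" and rr: "\<And>v. real_rooted (line_poly h e v)"
    using hyp by (auto simp: hyperbolic_wrt_def)
  obtain A where A: "\<And>r j. coeff (line_poly h e (p + r *\<^sub>R ?a)) j = poly (A j) r"
    using coeff_line_poly_polynomial by metis
  have "poly (A 0) r = poly (line_poly h ?a p) r" for r
    by (simp add: poly_line_poly flip: A) (simp add: poly_line_poly flip: poly_0_coeff_0)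
  then have A0: "A 0 = line_poly h ?a p" by (simp add: poly_eq_poly_eq_iff[symmetric] ext)
  have "poly (A 0) 0 = 0" "poly (A 1) 0 = 0"
    using A[of 0 1] e0 coeff_1_line_poly[of h e p] zero by (auto simp: A0 poly_line_poly)
  then obtain b g where b: "A 0 = pCons 0 b" and g: "A 1 = pCons 0 g"
    by (metis pCons_cases poly_pCons mult_zero_left add.right_neutral)
  have "poly b 0 = 0"
    by (rule real_rooted_family_no_turning_point[where P = "\<lambda>r. line_poly h e (p + r *\<^sub>R ?a)" and g = g and A = "A 2"])
      (use rr degree_line_poly[OF form he] he d A b g in auto)
  then have "coeff (line_poly h ?a p) 1 = 0"
    by (simp add: b flip: A0) (simp add: poly_0_coeff_0)
  then show False using smooth coeff_1_line_poly[of h ?a p] by simp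
qed

lemma real_rooted_simple_roots:
  assumes "real_rooted p" "p \<noteq> 0" and simple: "\<And>r. poly p r = 0 \<Longrightarrow> poly (pderiv p) r \<noteq> 0"
  shows "split_simple p"
proof -
  obtain rs where rs: "p = Polynomial.smult (lead_coeff p) (\<Prod>r\<leftarrow>rs. [:- r, 1:])" "degree p = length rs"
    using real_rooted_split[OF assms(1,2)] by blast
  have "distinct rs"
  proof (rule ccontr)
    assume "\<not> distinct rs"
    then obtain xs ys zs y where "rs = xs @ [y] @ ys @ [y] @ zs" using not_distinct_decomp by blast
    then have "(\<Prod>r\<leftarrow>rs. [:- r, 1:]) = [:- y, 1:] * ([:- y, 1:] * ((\<Prod>r\<leftarrow>xs. [:- r, 1:]) * (\<Prod>r\<leftarrow>ys. [:- r, 1:]) * (\<Prod>r\<leftarrow>zs. [:- r, 1:])))"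
      by (simp only: map_append prod_list.append list.map prod_list.Cons prod_list.Nil mult_1_right) (simp only: mult_ac)
    then obtain q where "p = [:- y, 1:] * ([:- y, 1:] * q)"
      using rs(1) by (metis mult_smult_right)
    then have "poly p y = 0" "poly (pderiv p) y = 0"
      by (simp_all add: pderiv_mult pderiv_pCons del: mult_pCons_left)
    then show False using simple by blast
  qed
  moreover have "{r. poly p r = 0} = set rs"
  proof -
    have "poly p r = lead_coeff p * (\<Prod>s\<leftarrow>rs. r - s)" for r
      by (subst rs(1)) (simp add: poly_prod_linear)
    then show ?thesis using assms(2) by (auto simp: prod_list_zero_iff)
  qed
  ultimately show ?thesis using assms(2) rs(2) by (simp add: split_simple_def distinct_card)
qed

theorem hyperbolic_smooth_split:
  assumes form: "form_in UNIV d h" and d: "d > 0" and hyp: "hyperbolic_wrt h e"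
    and smooth: "\<And>v. v \<noteq> 0 \<Longrightarrow> gradient h v \<noteq> 0" and v: "\<And>t. v \<noteq> t *\<^sub>R e"
  shows "split_simple (line_poly h e v)"
proof (rule real_rooted_simple_roots)
  have he: "mpoly_eval h e \<noteq> 0" using hyp by (simp add: hyperbolic_wrt_def)
  show "real_rooted (line_poly h e v)" using hyp by (simp add: hyperbolic_wrt_def)
  show "line_poly h e v \<noteq> 0" using degree_line_poly[OF form he, of v] he by auto
  fix r assume r: "poly (line_poly h e v) r = 0"
  have "v + r *\<^sub>R e \<noteq> 0" using v[of "- r"] by (metis eq_neg_iff_add_eq_0 scaleR_minus_left)
  moreover have "mpoly_eval h (v + r *\<^sub>R e) = 0" using r by (simp add: poly_line_poly)
  ultimately have "gradient h (v + r *\<^sub>R e) \<bullet> e \<noteq> 0"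
    using hyperbolic_smooth_transversal[OF form d hyp] smooth by blast
  then show "poly (pderiv (line_poly h e v)) r \<noteq> 0"
    by (simp add: pderiv_line_poly poly_sum poly_line_poly gradient_def inner_vec_def mult.commute)
qed

section \<open>Determinants of definite pencils\<close>

lemma scalar_prod_mult_vec:
  fixes A :: "real mat"
  assumes "A \<in> carrier_mat N N" "x \<in> carrier_vec N"
  shows "scalar_prod x (A *\<^sub>v x) = (\<Sum>r<N. \<Sum>s<N. A $$ (r, s) * vec_index x r * vec_index x s)"
  using assms by (auto simp: scalar_prod_def sum_distrib_left mult_ac atLeast0LessThan intro!: sum.cong)

lemma pos_def_mat_mat:
  assumes sym: "\<And>r s. r < N \<Longrightarrow> s < N \<Longrightarrow> S r s = S s r"
    and pos: "\<And>c r. r < N \<Longrightarrow> c r \<noteq> 0 \<Longrightarrow> (\<Sum>r<N. \<Sum>s<N. S r s * c r * c s) > 0"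
  shows "pos_def_mat N (mat N N (\<lambda>(r, s). S r s))"
  unfolding pos_def_mat_def
proof (intro conjI ballI impI)
  show "transpose_mat (mat N N (\<lambda>(r, s). S r s)) = mat N N (\<lambda>(r, s). S r s)"
    by (rule eq_matI) (auto simp: sym)
  fix x :: "real Matrix.vec" assume x: "x \<in> carrier_vec N" "x \<noteq> 0\<^sub>v N"
  then obtain r where "r < N" "vec_index x r \<noteq> 0" by (metis carrier_vecD eq_vecI index_zero_vec)
  from pos[of r "vec_index x", OF this] show "scalar_prod x (mat N N (\<lambda>(r, s). S r s) *\<^sub>v x) > 0"
    by (subst scalar_prod_mult_vec[OF _ x(1)]) auto
qed simp

lemma pos_def_mat_det: "pos_def_mat N A \<Longrightarrow> Determinant.det A \<noteq> 0"
proof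
  assume A: "pos_def_mat N A" and "Determinant.det A = 0"
  then have c: "A \<in> carrier_mat N N" by (simp add: pos_def_mat_def)
  with \<open>Determinant.det A = 0\<close> obtain x where "x \<in> carrier_vec N" "x \<noteq> 0\<^sub>v N" "A *\<^sub>v x = 0\<^sub>v N"
    using det_0_iff_vec_prod_zero_field by blast
  then show False using A by (auto simp: pos_def_mat_def)
qed

text \<open>
  Pairing a kernel vector \<open>w\<close> of \<open>S + z T\<close> with its conjugate gives \<open>w\<^sup>* S w + z (w\<^sup>* T w) = 0\<close> with real
  \<open>w\<^sup>* S w\<close> and positive \<open>w\<^sup>* T w\<close>.  The proof takes the imaginary part.
\<close>

lemma definite_pencil_real_eigenvalue:
  fixes S T :: "nat \<Rightarrow> nat \<Rightarrow> real" and z :: complex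
  assumes S: "\<And>r s. r < N \<Longrightarrow> s < N \<Longrightarrow> S r s = S s r"
    and T: "\<And>r s. r < N \<Longrightarrow> s < N \<Longrightarrow> T r s = T s r"
    and pos: "\<And>c r. r < N \<Longrightarrow> c r \<noteq> 0 \<Longrightarrow> (\<Sum>r<N. \<Sum>s<N. T r s * c r * c s) > 0"
    and det: "Determinant.det (mat N N (\<lambda>(r, s). complex_of_real (S r s) + z * complex_of_real (T r s))) = 0"
  shows "z \<in> \<real>"
proof -
  let ?M = "mat N N (\<lambda>(r, s). complex_of_real (S r s) + z * complex_of_real (T r s))"
  have "?M \<in> carrier_mat N N" by simp
  then obtain w where w: "w \<in> carrier_vec N" "w \<noteq> 0\<^sub>v N" "?M *\<^sub>v w = 0\<^sub>v N"
    using det det_0_iff_vec_prod_zero_field by blast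
  define \<alpha> where "\<alpha> r = Re (vec_index w r)" for r
  define \<beta> where "\<beta> r = Im (vec_index w r)" for r
  define S' where "S' r s = S r s + Re z * T r s" for r s
  have row: "(\<Sum>s<N. (complex_of_real (S r s) + z * complex_of_real (T r s)) * vec_index w s) = 0" if "r < N" for r
  proof -
    have "vec_index (?M *\<^sub>v w) r = 0" using w that by simp
    then show ?thesis using w(1) that by (simp add: scalar_prod_def atLeast0LessThan)
  qed
  have re: "(\<Sum>s<N. S' r s * \<alpha> s - Im z * T r s * \<beta> s) = 0" if "r < N" for r
    using arg_cong[OF row[OF that], of Re] by (simp add: \<alpha>_def \<beta>_def S'_def algebra_simps)
  have im: "(\<Sum>s<N. S' r s * \<beta> s + Im z * T r s * \<alpha> s) = 0" if "r < N" for r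
    using arg_cong[OF row[OF that], of Im] by (simp add: \<alpha>_def \<beta>_def S'_def algebra_simps)
  have T_sum: "(\<Sum>r<N. \<Sum>s<N. T r s * c r * c s) \<ge> 0" for c
  proof (cases "\<exists>r<N. c r \<noteq> 0")
    case False
    then show ?thesis by simp
  qed (use pos in \<open>auto intro: less_imp_le\<close>)
  have ex: "\<exists>r<N. \<alpha> r \<noteq> 0 \<or> \<beta> r \<noteq> 0"
  proof (rule ccontr)
    assume "\<not> ?thesis"
    then have "vec_index w r = 0" if "r < N" for r using that by (auto simp: \<alpha>_def \<beta>_def complex_eq_iff)
    then have "w = 0\<^sub>v N" using w(1) by (intro eq_vecI) auto
    then show False using w(2) by simp
  qed
  have "0 = (\<Sum>r<N. \<alpha> r * (\<Sum>s<N. S' r s * \<beta> s + Im z * T r s * \<alpha> s)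
      - \<beta> r * (\<Sum>s<N. S' r s * \<alpha> s - Im z * T r s * \<beta> s))"
    by (simp add: re im)
  also have "\<dots> = (\<Sum>r<N. \<Sum>s<N. S' r s * \<alpha> r * \<beta> s) - (\<Sum>r<N. \<Sum>s<N. S' r s * \<beta> r * \<alpha> s)
      + Im z * ((\<Sum>r<N. \<Sum>s<N. T r s * \<alpha> r * \<alpha> s) + (\<Sum>r<N. \<Sum>s<N. T r s * \<beta> r * \<beta> s))"
    by (simp add: sum_distrib_left algebra_simps flip: sum.distrib sum_subtractf)
  also have "(\<Sum>r<N. \<Sum>s<N. S' r s * \<beta> r * \<alpha> s) = (\<Sum>r<N. \<Sum>s<N. S' r s * \<alpha> r * \<beta> s)"
    by (subst sum.swap) (auto simp: S'_def S T mult_ac intro!: sum.cong)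
  finally have "Im z * ((\<Sum>r<N. \<Sum>s<N. T r s * \<alpha> r * \<alpha> s) + (\<Sum>r<N. \<Sum>s<N. T r s * \<beta> r * \<beta> s)) = 0"
    by simp
  moreover have "(\<Sum>r<N. \<Sum>s<N. T r s * \<alpha> r * \<alpha> s) + (\<Sum>r<N. \<Sum>s<N. T r s * \<beta> r * \<beta> s) > 0"
  proof -
    obtain r where r: "r < N" "\<alpha> r \<noteq> 0 \<or> \<beta> r \<noteq> 0" using ex by blast
    from r(2) show ?thesis
    proof
      assume "\<alpha> r \<noteq> 0"
      from pos[of r \<alpha>, OF r(1) this] T_sum[of \<beta>] show ?thesis by linarith
    next
      assume "\<beta> r \<noteq> 0"
      from pos[of r \<beta>, OF r(1) this] T_sum[of \<alpha>] show ?thesis by linarith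
    qed
  qed
  ultimately have "Im z = 0" by auto
  then show ?thesis by (simp add: complex_is_Real_iff)
qed

lemma linear_matrix_index:
  assumes "r < N" "c < N"
  shows "linear_matrix N A $$ (r, c) = (\<Sum>i\<in>UNIV. Const (A i $$ (r, c)) * Var i)"
  using assms by (simp add: linear_matrix_def single_Var del: One_nat_def)

lemma form_in_det_linear_matrix: "form_in UNIV N (Determinant.det (linear_matrix N A))"
proof -
  have entry: "form_in UNIV 1 (linear_matrix N A $$ (r, c))" if "r < N" "c < N" for r c
    unfolding linear_matrix_index[OF that] by (intro form_in_sum form_in_Const_mult form_in_Var) simp
  have "form_in UNIV N (signof p * (\<Prod>i=0..<N. linear_matrix N A $$ (i, p i)))" if p: "p permutes {0..<N}" for p
  proof -
    have "form_in UNIV (\<Sum>i=0..<N. 1) (\<Prod>i=0..<N. linear_matrix N A $$ (i, p i))"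
      by (intro form_in_prod entry) (use permutes_in_image[OF p] in auto)
    then have "form_in UNIV N (\<Prod>i=0..<N. linear_matrix N A $$ (i, p i))" by simp
    then show ?thesis by (auto simp: sign_def form_in_uminus)
  qed
  then show ?thesis unfolding Determinant.det_def
    by (auto simp: linear_matrix_def[of N] intro!: form_in_sum)
qed

lemma mpoly_eval_det_linear_matrix:
  "mpoly_eval (Determinant.det (linear_matrix N A)) v = Determinant.det (linear_matrix_at N A v)"
proof -
  have "map_mat (\<lambda>f. peval f (vec_nth v)) (linear_matrix N A) = linear_matrix_at N A v"
  proof (rule eq_matI)
    fix r c assume "r < dim_row (linear_matrix_at N A v)" "c < dim_col (linear_matrix_at N A v)"
    then have rc: "r < N" "c < N" by (auto simp: linear_matrix_at_def)
    then have "map_mat (\<lambda>f. peval f (vec_nth v)) (linear_matrix N A) $$ (r, c)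
        = peval (linear_matrix N A $$ (r, c)) (vec_nth v)"
      by (simp add: linear_matrix_def)
    then show "map_mat (\<lambda>f. peval f (vec_nth v)) (linear_matrix N A) $$ (r, c) = linear_matrix_at N A v $$ (r, c)"
      using rc by (simp add: linear_matrix_at_def linear_matrix_index[OF rc] peval_simps mult.commute)
  qed (simp_all add: linear_matrix_def linear_matrix_at_def)
  then show ?thesis using peval_hom.hom_det[of "vec_nth v" "linear_matrix N A"]
    by (simp add: mpoly_eval_peval)
qed

lemma real_rooted_det_linear_matrix:
  assumes sym: "\<And>i. A i \<in> carrier_mat N N \<and> transpose_mat (A i) = A i"
    and pos: "pos_def_mat N (linear_matrix_at N A e)"
  shows "real_rooted (line_poly (Determinant.det (linear_matrix N A)) e v)"
  unfolding real_rooted_def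
proof (intro allI impI)
  fix z assume z: "poly (map_poly complex_of_real (line_poly (Determinant.det (linear_matrix N A)) e v)) z = 0"
  define \<rho> where "\<rho> f = poly (map_poly complex_of_real (line_poly f e v)) z" for f
  have add: "map_poly complex_of_real (p + q) = map_poly complex_of_real p + map_poly complex_of_real q" for p q
    by (rule poly_eqI) (simp add: coeff_map_poly)
  interpret \<rho>: comm_ring_hom \<rho>
    by unfold_locales (auto simp: \<rho>_def line_poly_hom.hom_add line_poly_hom.hom_mult add map_poly_complex_mult)
  define M where "M w r c = (\<Sum>i\<in>UNIV. vec_nth w i * A i $$ (r, c))" for w r c
  have sym': "A i $$ (r, c) = A i $$ (c, r)" if "r < N" "c < N" for i r c
    using sym[of i] that by (metis carrier_matD index_transpose_mat(1))
  have M_sym: "M w r c = M w c r" if "r < N" "c < N" for w r c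
    unfolding M_def using sym' that by auto
  have "map_mat \<rho> (linear_matrix N A) = mat N N (\<lambda>(r, c). complex_of_real (M v r c) + z * complex_of_real (M e r c))"
  proof (rule eq_matI)
    fix r c assume rc: "r < dim_row (mat N N (\<lambda>(r, c). complex_of_real (M v r c) + z * complex_of_real (M e r c)))"
      "c < dim_col (mat N N (\<lambda>(r, c). complex_of_real (M v r c) + z * complex_of_real (M e r c)))"
    then have rc': "r < N" "c < N" by auto
    have "\<rho> (Const a * Var i) = complex_of_real (vec_nth v i * a) + z * complex_of_real (vec_nth e i * a)" for a i
      by (simp add: \<rho>_def line_poly_hom.hom_mult map_poly_pCons algebra_simps)
    then have "\<rho> (linear_matrix N A $$ (r, c)) = complex_of_real (M v r c) + z * complex_of_real (M e r c)"
      by (simp add: linear_matrix_index[OF rc'] \<rho>.hom_sum M_def sum.distrib sum_distrib_left)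
    then show "map_mat \<rho> (linear_matrix N A) $$ (r, c)
        = mat N N (\<lambda>(r, c). complex_of_real (M v r c) + z * complex_of_real (M e r c)) $$ (r, c)"
      using rc' by (simp add: linear_matrix_def)
  qed (simp_all add: linear_matrix_def)
  then have "Determinant.det (mat N N (\<lambda>(r, c). complex_of_real (M v r c) + z * complex_of_real (M e r c))) = 0"
    using \<rho>.hom_det[of "linear_matrix N A"] z by (simp add: \<rho>_def)
  moreover have "(\<Sum>r<N. \<Sum>s<N. M e r s * c r * c s) > 0" if "r < N" "c r \<noteq> 0" for c r
  proof -
    let ?x = "Matrix.vec N c"
    have "?x \<noteq> 0\<^sub>v N" using that by (metis index_vec index_zero_vec(1))
    then have "scalar_prod ?x (linear_matrix_at N A e *\<^sub>v ?x) > 0"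
      using pos by (simp add: pos_def_mat_def)
    moreover have "linear_matrix_at N A e \<in> carrier_mat N N" using pos by (simp add: pos_def_mat_def)
    ultimately show ?thesis
      by (subst (asm) scalar_prod_mult_vec) (auto simp: linear_matrix_at_def M_def)
  qed
  ultimately show "z \<in> \<real>"
    using definite_pencil_real_eigenvalue[of N "M v" "M e" z] M_sym by blast
qed

section \<open>Divisibility from the real zeros\<close>

text \<open>
  The substitution \<open>f(y + t e)\<close> as a polynomial in \<open>t\<close> over the polynomial ring.  With \<open>y = Var\<close> it is the
  restriction to a generic line parallel to \<open>e\<close>; with one entry of \<open>y\<close> set to zero it is the expansion of
  \<open>f\<close> in the coordinates of a complementary hyperplane.
\<close>

definition lift :: "('n::finite \<Rightarrow> 'n rpoly) \<Rightarrow> real ^ 'n \<Rightarrow> 'n rpoly \<Rightarrow> 'n rpoly poly" where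
  "lift y e f = subst_poly (\<lambda>c. [:Const c:]) (\<lambda>i. [:y i, Const (vec_nth e i):]) f"

lemma Const_poly_hom: "comm_ring_hom (\<lambda>c. [:Const c:] :: 'n::finite rpoly poly)"
  by unfold_locales (auto simp: Const_hom.hom_add Const_hom.hom_mult one_pCons)

interpretation lift_hom: comm_ring_hom "lift y e" for y e
  unfolding lift_def by (rule subst_poly_hom[OF Const_poly_hom])

lemma lift_Const [simp]: "lift y e (Const c) = [:Const c:]"
  unfolding lift_def by (rule subst_poly_Const[OF Const_poly_hom])

lemma lift_Var [simp]: "lift y e (Var i) = [:y i, Const (vec_nth e i):]"
  unfolding lift_def by (rule subst_poly_Var[OF Const_poly_hom])

lemma coeff_pair_mult:
  "coeff ([:a, b:] * q) j = a * coeff q j + b * (if j = 0 then 0 else coeff q (j - 1))"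
  for a b :: "'a::comm_ring_1"
  by (simp add: coeff_pCons split: nat.splits)

lemma peval_coeff_lift:
  assumes "\<And>i. peval (y i) x = vec_nth v i"
  shows "peval (coeff (lift y e f) j) x = coeff (line_poly f e v) j"
proof (induction f arbitrary: j rule: rpoly_induct)
  case (single m c)
  show ?case unfolding single_eq_Const_xpow
  proof (induction m arbitrary: j rule: exponent_induct)
    case zero
    show ?case by (simp add: coeff_pCons split: nat.splits)
  next
    case (add m i)
    have eq: "Const c * xpow (m + single i 1) = Var i * (Const c * xpow m)"
      by (simp add: xpow_add Var_def mult_ac)
    show ?case
      unfolding eq lift_hom.hom_mult[of _ _ "Var i"] line_poly_hom.hom_mult[of "Var i"] lift_Var line_poly_Var
        coeff_pair_mult
      using add by (simp add: peval_simps assms)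
  qed
qed (simp add: lift_hom.hom_add line_poly_hom.hom_add peval_simps)

lemma lift_poly_0: "poly (lift Var e f) 0 = f"
proof (rule peval_eq_imp_eq)
  fix x
  have "peval (poly (lift Var e f) 0) x = coeff (line_poly f e (\<chi> i. x i)) 0"
    unfolding poly_0_coeff_0 by (rule peval_coeff_lift) simp
  also have "\<dots> = peval f x"
    by (simp add: poly_line_poly mpoly_eval_peval vec_lambda_inverse flip: poly_0_coeff_0)
  finally show "peval (poly (lift Var e f) 0) x = peval f x" .
qed

definition homogeneous_component :: "nat \<Rightarrow> 'n::finite rpoly \<Rightarrow> 'n rpoly" where
  "homogeneous_component j f = (\<Sum>m\<in>keys f. if mdeg m = j then single m (lookup f m) else 0)"

lemma homogeneous_component_add: "homogeneous_component j (f + g) = homogeneous_component j f + homogeneous_component j g"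
  unfolding homogeneous_component_def by (rule sum_keys_add) (auto simp: single_add)

lemma form_in_homogeneous_component: "form_in UNIV j (homogeneous_component j f)"
  unfolding homogeneous_component_def
  by (intro form_in_sum) (auto simp: form_in_def Mon_def)

lemma homogeneous_component_form: "form_in UNIV d f \<Longrightarrow> homogeneous_component j f = (if j = d then f else 0)"
proof -
  assume f: "form_in UNIV d f"
  have "f = (\<Sum>m\<in>keys f. single m (lookup f m))"
    using rpoly_expand[of f] by (simp add: single_eq_Const_xpow)
  moreover have "mdeg m = d" if "m \<in> keys f" for m
    using f that by (auto simp: form_in_def Mon_def)
  ultimately show ?thesis by (auto simp: homogeneous_component_def)
qed

lemma homogeneous_component_mult_form:
  assumes h: "form_in UNIV d h"
  shows "homogeneous_component j (q * h) = (if d \<le> j then homogeneous_component (j - d) q * h else 0)"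
proof (induction q rule: rpoly_induct)
  case (single m c)
  have f: "form_in UNIV (mdeg m) (single m c)"
    by (auto simp: form_in_def Mon_def)
  show ?case
    using homogeneous_component_form[OF form_in_mult[OF f h], of j] homogeneous_component_form[OF f, of "j - d"] by auto
qed (auto simp: distrib_right homogeneous_component_add)

text \<open>
  A quotient of forms can be taken to be a form, by passing to its component of the right degree.
\<close>

lemma form_factor:
  assumes h: "form_in UNIV d h" and D: "form_in UNIV N D" "D \<noteq> 0" and q: "q * h = D"
  obtains q' k where "form_in UNIV k q'" "q' * h = D"
proof (rule that[OF form_in_homogeneous_component])
  have "D = homogeneous_component N (q * h)" using homogeneous_component_form[OF D(1), of N] q by simp
  then show "homogeneous_component (N - d) q * h = D" using D(2) by (simp add: homogeneous_component_mult_form[OF h] split: if_splits)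
qed

text \<open>
  The complement of a line is dense; a point of the line is reached along a line with direction \<open>w\<close>.
\<close>

lemma vanishing_off_line:
  fixes f :: "'n::finite rpoly"
  assumes w: "\<And>t. w \<noteq> t *\<^sub>R e" and f: "\<And>v. (\<And>t. v \<noteq> t *\<^sub>R e) \<Longrightarrow> mpoly_eval f v = 0"
  shows "f = 0"
proof (rule mpoly_eval_0_imp_0)
  fix v :: "real ^ 'n"
  show "mpoly_eval f v = 0"
  proof (cases "\<exists>s. v = s *\<^sub>R e")
    case True
    then obtain s where v: "v = s *\<^sub>R e" ..
    have "poly (line_poly f w v) t = 0" if "t \<noteq> 0" for t
      unfolding poly_line_poly
    proof (rule f)
      fix r
      have "w = (1 / t) *\<^sub>R (t *\<^sub>R w)" using that by simp
      also have "t *\<^sub>R w = (r - s) *\<^sub>R e" if "v + t *\<^sub>R w = r *\<^sub>R e"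
        using that by (simp add: v algebra_simps eq_diff_eq)
      finally show "v + t *\<^sub>R w \<noteq> r *\<^sub>R e" using w[of "(1 / t) * (r - s)"] by auto
    qed
    then have "UNIV - {0} \<subseteq> {t. poly (line_poly f w v) t = 0}" by auto
    moreover have "infinite (UNIV - {0::real})" by (simp add: infinite_UNIV_char_0)
    ultimately have "line_poly f w v = 0" using poly_roots_finite infinite_super by blast
    then show ?thesis using poly_line_poly[of f w v 0] by simp
  qed (use f in blast)
qed

text \<open>
  Pseudo-division on a generic line parallel to \<open>e\<close> only multiplies by powers of the constant \<open>h(e)\<close>.  On
  a line off the origin the remainder has degree below \<open>d\<close> and vanishes at the \<open>d\<close> roots of \<open>h\<close>.
\<close>

lemma form_dvd_of_zeros:
  fixes h D :: "'n::finite rpoly"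
  assumes h: "form_in UNIV d h" "mpoly_eval h e \<noteq> 0"
    and w: "\<And>t. w \<noteq> t *\<^sub>R e"
    and split: "\<And>v. (\<And>t. v \<noteq> t *\<^sub>R e) \<Longrightarrow> split_simple (line_poly h e v)"
    and zeros: "\<And>v. (\<And>t. v \<noteq> t *\<^sub>R e) \<Longrightarrow> mpoly_eval h v = 0 \<Longrightarrow> mpoly_eval D v = 0"
  obtains q where "q * h = D"
proof -
  let ?P = "lift Var e :: 'n rpoly \<Rightarrow> _" and ?c = "mpoly_eval h e"
  have coeff: "mpoly_eval (coeff (?P f) j) v = coeff (line_poly f e v) j" for f j v
    unfolding mpoly_eval_peval by (rule peval_coeff_lift) simp
  have top: "coeff (?P h) d = Const ?c"
    by (rule peval_eq_imp_eq)
      (use coeff[of h d "vec_lambda _"] coeff_line_poly_top[OF h(1)] in \<open>simp add: mpoly_eval_peval vec_lambda_inverse\<close>)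
  have "degree (?P h) \<le> d"
  proof (rule degree_le, intro allI impI mpoly_eval_0_imp_0)
    fix j v assume "d < j"
    then show "mpoly_eval (coeff (?P h) j) v = 0"
      unfolding coeff using degree_line_poly_le[OF h(1), of e v] by (simp add: coeff_eq_0)
  qed
  moreover have "Const ?c \<noteq> (0 :: 'n rpoly)" using h(2) peval_Const[of ?c] peval_hom.hom_zero by metis
  ultimately have degree: "degree (?P h) = d" and lc: "lead_coeff (?P h) = Const ?c" and nz: "?P h \<noteq> 0"
    using top by (metis le_antisym le_degree, metis le_antisym le_degree, auto)
  obtain Q R where "pseudo_divmod (?P D) (?P h) = (Q, R)" by (cases "pseudo_divmod (?P D) (?P h)")
  note QR = pseudo_divmod[OF nz this]
  define k where "k = Suc (degree (?P D)) - degree (?P h)"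
  have eq: "Polynomial.smult (Const (?c ^ k)) (?P D) = ?P h * Q + R"
    using QR(1) by (simp add: lc k_def Const_hom.hom_power)
  have "coeff R j = 0" for j
  proof (rule vanishing_off_line[OF w])
    fix v assume v: "\<And>t. v \<noteq> t *\<^sub>R e"
    define ev where "ev = map_poly (\<lambda>f. mpoly_eval f v)"
    have ev_coeff: "coeff (ev p) j = mpoly_eval (coeff p j) v" for p j
      unfolding ev_def by (rule coeff_map_poly) (simp add: mpoly_eval_peval)
    have ev_add: "ev (p + q) = ev p + ev q" for p q
      by (rule poly_eqI) (simp add: ev_coeff mpoly_eval_peval peval_simps)
    have ev_mult: "ev (p * q) = ev p * ev q" for p q
      by (rule poly_eqI) (simp add: ev_coeff coeff_mult mpoly_eval_peval peval_simps)
    have ev_smult: "ev (Polynomial.smult (Const a) p) = Polynomial.smult a (ev p)" for a p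
      by (rule poly_eqI) (simp add: ev_coeff mpoly_eval_peval peval_simps)
    have ev_P: "ev (?P f) = line_poly f e v" for f
      by (rule poly_eqI) (simp add: ev_coeff coeff)
    have line: "Polynomial.smult (?c ^ k) (line_poly D e v) = line_poly h e v * ev Q + ev R"
      using arg_cong[OF eq, of ev] by (simp add: ev_add ev_mult ev_smult ev_P)
    have ne: "v + r *\<^sub>R e \<noteq> t *\<^sub>R e" for r t
      using v[of "t - r"] by (simp add: algebra_simps eq_diff_eq)
    have "poly (ev R) r = 0" if r: "poly (line_poly h e v) r = 0" for r
    proof -
      have "mpoly_eval h (v + r *\<^sub>R e) = 0" using r by (simp add: poly_line_poly)
      then have "poly (line_poly D e v) r = 0" unfolding poly_line_poly by (intro zeros ne)
      then show ?thesis using arg_cong[OF line, of "\<lambda>p. poly p r"] r by simp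
    qed
    then have sub: "{r. poly (line_poly h e v) r = 0} \<subseteq> {r. poly (ev R) r = 0}" by auto
    have "ev R = 0"
    proof (rule ccontr)
      assume "ev R \<noteq> 0"
      then have "R \<noteq> 0" by (auto simp: ev_def)
      then have "degree R < d" using QR(2) degree by simp
      moreover have "degree (ev R) \<le> degree R"
        by (rule degree_le) (simp add: ev_coeff coeff_eq_0 mpoly_eval_peval)
      moreover have "card {r. poly (line_poly h e v) r = 0} = d"
        using split[OF v] degree_line_poly[OF h] by (simp add: split_simple_def)
      moreover have "card {r. poly (line_poly h e v) r = 0} \<le> card {r. poly (ev R) r = 0}"
        using sub poly_roots_finite[OF \<open>ev R \<noteq> 0\<close>] by (rule card_mono[rotated])
      ultimately show False using card_poly_roots_bound[OF \<open>ev R \<noteq> 0\<close>] by linarith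
    qed
    then show "mpoly_eval (coeff R j) v = 0" using ev_coeff[of R j] by simp
  qed
  then have "R = 0" by (intro poly_eqI) simp
  with arg_cong[OF eq, of "\<lambda>p. poly p 0"] have "Const (?c ^ k) * D = h * poly Q 0"
    by (simp add: lift_poly_0)
  then have "Const (1 / ?c ^ k) * (Const (?c ^ k) * D) = Const (1 / ?c ^ k) * (h * poly Q 0)"
    by simp
  moreover have "Const (1 / ?c ^ k) * (Const (?c ^ k) * D) = D"
    using h(2) by (simp only: mult.assoc[symmetric] Const_hom.hom_mult[symmetric]) simp
  ultimately have "(Const (1 / ?c ^ k) * poly Q 0) * h = D" by (simp add: mult_ac)
  then show ?thesis by (rule that)
qed

lemma form_in_coeff_lift:
  assumes y: "\<And>i. form_in I 1 (y i)"
  shows "form_in UNIV d f \<Longrightarrow> j \<le> d \<Longrightarrow> form_in I (d - j) (coeff (lift y e f) j)"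
    and "form_in UNIV d f \<Longrightarrow> d < j \<Longrightarrow> coeff (lift y e f) j = 0"
proof -
  have m: "(\<forall>j\<le>mdeg m. form_in I (mdeg m - j) (coeff (lift y e (xpow m)) j)) \<and>
      (\<forall>j>mdeg m. coeff (lift y e (xpow m)) j = 0)" for m
  proof (induction m rule: exponent_induct)
    case zero
    show ?case by (auto simp: coeff_pCons split: nat.splits)
  next
    case (add m i)
    let ?q = "coeff (lift y e (xpow m))" and ?n = "mdeg m"
    have eq: "coeff (lift y e (xpow (m + single i 1))) j
        = y i * ?q j + Const (vec_nth e i) * (if j = 0 then 0 else ?q (j - 1))" for j
      unfolding xpow_add mult.commute[of "xpow m"] Var_def[symmetric] lift_hom.hom_mult lift_Var
        coeff_pair_mult ..
    have 1: "form_in I (Suc ?n - j) (y i * ?q j)" if "j \<le> Suc ?n" for j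
    proof (cases "j = Suc ?n")
      case False
      then have "form_in I (1 + (?n - j)) (y i * ?q j)" using add that y by (intro form_in_mult) auto
      moreover have "1 + (?n - j) = Suc ?n - j" using False that by auto
      ultimately show ?thesis by metis
    qed (use add in simp)
    have 2: "form_in I (Suc ?n - j) (Const (vec_nth e i) * (if j = 0 then 0 else ?q (j - 1)))" if "j \<le> Suc ?n" for j
    proof (cases j)
      case (Suc l)
      then show ?thesis using add that by (auto intro: form_in_Const_mult)
    qed simp
    show ?case
    proof (intro conjI allI impI)
      fix j assume "j \<le> mdeg (m + single i 1)"
      then have "j \<le> Suc ?n" by simp
      from form_in_add[OF 1[OF this] 2[OF this]]
      show "form_in I (mdeg (m + single i 1) - j)
          (coeff (lift y e (xpow (m + single i 1))) j)"
        unfolding eq by simp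
    next
      fix j assume "mdeg (m + single i 1) < j"
      then show "coeff (lift y e (xpow (m + single i 1))) j = 0"
        unfolding eq using add by simp
    qed
  qed
  have c: "coeff (lift y e f) j = (\<Sum>m\<in>Mon UNIV d. Const (lookup f m) * coeff (lift y e (xpow m)) j)"
    if "form_in UNIV d f" for f j d
    by (subst form_in_expand[OF that]) (simp add: lift_hom.hom_sum lift_hom.hom_mult Polynomial.coeff_sum)
  show "form_in I (d - j) (coeff (lift y e f) j)" if "form_in UNIV d f" "j \<le> d"
    unfolding c[OF that(1)] using m that(2) by (intro form_in_sum form_in_Const_mult) (auto simp: Mon_def)
  show "coeff (lift y e f) j = 0" if "form_in UNIV d f" "d < j"
    unfolding c[OF that(1)] using m that(2) by (intro sum.neutral) (auto simp: Mon_def)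
qed

text \<open>
  Every factor of a real-rooted polynomial is real-rooted, so hyperbolicity passes from the determinant
  to \<open>q\<close>.
\<close>

lemma hyperbolic_factor_of_det:
  assumes sym: "\<And>i. A i \<in> carrier_mat N N \<and> transpose_mat (A i) = A i"
    and pos: "pos_def_mat N (linear_matrix_at N A e)"
    and q: "homogeneous_poly q" "q * h = Determinant.det (linear_matrix N A)"
  shows "hyperbolic q" "has_definite_det_rep (q * h)"
proof -
  have "mpoly_eval q e * mpoly_eval h e = mpoly_eval (q * h) e"
    by (simp add: mpoly_eval_peval peval_simps)
  also have "\<dots> \<noteq> 0" unfolding q(2) mpoly_eval_det_linear_matrix by (rule pos_def_mat_det[OF pos])
  finally have "mpoly_eval q e \<noteq> 0" by auto
  moreover have "real_rooted (line_poly q e v)" for v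
    using real_rooted_det_linear_matrix[OF sym pos, of v] unfolding q(2)[symmetric] line_poly_hom.hom_mult
    by (rule real_rooted_mult)
  ultimately show "hyperbolic q" using q(1) unfolding hyperbolic_def hyperbolic_wrt_def by blast
  show "has_definite_det_rep (q * h)"
    unfolding has_definite_det_rep_def using sym pos q(2) by blast
qed

section \<open>The hyperbolic cofactor\<close>

text \<open>
  In one variable \<open>h\<close> is a multiple of \<open>x\<^sup>d\<close>, which is the determinant of \<open>x\<close> times the identity.  There is
  no complement of \<open>e\<close> here on which the general construction could live.
\<close>

lemma det_rep_one_variable:
  fixes h :: "'n::finite rpoly"
  assumes h: "form_in UNIV d h" "mpoly_eval h e \<noteq> 0" and i0: "UNIV = {i0}" "vec_nth e i0 \<noteq> 0"
  shows "\<exists>q :: 'n rpoly. hyperbolic q \<and> has_definite_det_rep (q * h)"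
proof -
  define A :: "'n \<Rightarrow> real mat" where "A i = 1\<^sub>m d" for i
  define c where "c = mpoly_eval h e / vec_nth e i0 ^ d"
  have univ: "i = i0" for i using i0(1) by blast
  have c: "c \<noteq> 0" using h i0 by (simp add: c_def)
  have at: "linear_matrix_at d A v = vec_nth v i0 \<cdot>\<^sub>m 1\<^sub>m d" for v
    by (rule eq_matI) (auto simp: linear_matrix_at_def A_def i0(1))
  have det: "mpoly_eval (Determinant.det (linear_matrix d A)) v = vec_nth v i0 ^ d" for v
    unfolding mpoly_eval_det_linear_matrix at by (simp add: det_smult)
  have h_eval: "mpoly_eval h v = c * vec_nth v i0 ^ d" for v
  proof -
    have "mpoly_eval h v = peval h (\<lambda>i. (vec_nth v i0 / vec_nth e i0) * vec_nth e i)"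
      unfolding mpoly_eval_peval
    proof (intro arg_cong[of _ _ "peval h"] ext)
      show "vec_nth v i = vec_nth v i0 / vec_nth e i0 * vec_nth e i" for i
        using univ[of i] i0(2) by simp
    qed
    then show ?thesis
      by (simp only: peval_form_scale[OF h(1)]) (simp add: mpoly_eval_peval c_def power_divide)
  qed
  define q :: "'n rpoly" where "q = Const (1 / c)"
  have "q * h = Determinant.det (linear_matrix d A)"
  proof -
    have "mpoly_eval (q * h - Determinant.det (linear_matrix d A)) v = 0" for v
      using det[of v] h_eval[of v] c by (simp add: mpoly_eval_peval peval_simps q_def)
    then have "q * h - Determinant.det (linear_matrix d A) = 0" by (rule mpoly_eval_0_imp_0)
    then show ?thesis by simp
  qed
  moreover have "homogeneous_poly q"
    unfolding homogeneous_poly_iff q_def using form_in_Const by blast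
  moreover have "pos_def_mat d (linear_matrix_at d A (\<chi> _. 1))"
  proof -
    have "pos_def_mat d (mat d d (\<lambda>(r, s). if r = s then 1 else 0))"
    proof (rule pos_def_mat_mat)
      fix c :: "nat \<Rightarrow> real" and r assume r: "r < d" "c r \<noteq> 0"
      have "(\<Sum>r<d. \<Sum>s<d. (if r = s then 1 else 0) * c r * c s) = (\<Sum>r<d. c r * c r)"
        by (simp add: if_distrib[of "\<lambda>x. x * _"] cong: if_cong)
      also have "\<dots> > 0" by (rule sum_pos2[of _ r]) (use r in \<open>auto simp: zero_less_mult_iff linorder_neq_iff\<close>)
      finally show "(\<Sum>r<d. \<Sum>s<d. (if r = s then 1 else 0) * c r * c s) > 0" .
    qed auto
    moreover have "linear_matrix_at d A (\<chi> _. 1) = mat d d (\<lambda>(r, s). if r = s then 1 else 0)"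
      unfolding at by (rule eq_matI) auto
    ultimately show ?thesis by simp
  qed
  moreover have "A i \<in> carrier_mat d d \<and> transpose_mat (A i) = A i" for i
    by (simp add: A_def)
  ultimately show ?thesis using hyperbolic_factor_of_det[of A d "\<chi> _. 1" q h] by blast
qed

text \<open>
  The coordinates adapted to \<open>e\<close> are \<open>t = v\<^sub>i\<^sub>0 / e\<^sub>i\<^sub>0\<close> and \<open>x = v - t e\<close>; in particular the pencil at \<open>e\<close>
  itself is \<open>K\<close>.
\<close>

lemma linear_matrix_of_pencil:
  fixes e :: "real ^ 'n::finite" and K :: "nat \<Rightarrow> nat \<Rightarrow> real" and L :: "'n \<Rightarrow> nat \<Rightarrow> nat \<Rightarrow> real"
  assumes e: "vec_nth e i0 \<noteq> 0" and K: "\<And>r s. r < N \<Longrightarrow> s < N \<Longrightarrow> K r s = K s r"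
    and L: "\<And>i r s. r < N \<Longrightarrow> s < N \<Longrightarrow> L i r s = L i s r"
  obtains A :: "'n \<Rightarrow> real mat" where "\<And>i. A i \<in> carrier_mat N N \<and> transpose_mat (A i) = A i"
    "\<And>v. linear_matrix_at N A v = mat N N (\<lambda>(r, s). vec_nth v i0 / vec_nth e i0 * K r s
      - (\<Sum>i\<in>UNIV - {i0}. (vec_nth v i - vec_nth v i0 / vec_nth e i0 * vec_nth e i) * L i r s))"
proof
  define A where "A i = mat N N (\<lambda>(r, s). if i = i0
      then (K r s + (\<Sum>j\<in>UNIV - {i0}. vec_nth e j * L j r s)) / vec_nth e i0 else - L i r s)" for i
  show "A i \<in> carrier_mat N N \<and> transpose_mat (A i) = A i" for i
    unfolding A_def by (intro conjI eq_matI) (auto simp: K L intro!: sum.cong arg_cong2[of _ _ _ _ "(/)"])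
  fix v
  show "linear_matrix_at N A v = mat N N (\<lambda>(r, s). vec_nth v i0 / vec_nth e i0 * K r s
      - (\<Sum>i\<in>UNIV - {i0}. (vec_nth v i - vec_nth v i0 / vec_nth e i0 * vec_nth e i) * L i r s))"
  proof (rule eq_matI)
    fix r s
    let ?R = "mat N N (\<lambda>(r, s). vec_nth v i0 / vec_nth e i0 * K r s
      - (\<Sum>i\<in>UNIV - {i0}. (vec_nth v i - vec_nth v i0 / vec_nth e i0 * vec_nth e i) * L i r s))"
    assume "r < dim_row ?R" "s < dim_col ?R"
    then have rs: "r < N" "s < N" by auto
    let ?\<tau> = "vec_nth v i0 / vec_nth e i0"
    have "linear_matrix_at N A v $$ (r, s) = vec_nth v i0 * A i0 $$ (r, s) + (\<Sum>i\<in>UNIV - {i0}. vec_nth v i * A i $$ (r, s))"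
      using rs by (simp add: linear_matrix_at_def sum.remove[of UNIV i0])
    also have "\<dots> = ?\<tau> * (K r s + (\<Sum>j\<in>UNIV - {i0}. vec_nth e j * L j r s)) - (\<Sum>i\<in>UNIV - {i0}. vec_nth v i * L i r s)"
      using rs by (simp add: A_def sum_negf)
    also have "\<dots> = ?\<tau> * K r s - (\<Sum>i\<in>UNIV - {i0}. (vec_nth v i - ?\<tau> * vec_nth e i) * L i r s)"
      by (simp add: left_diff_distrib sum_subtractf distrib_left sum_distrib_left mult.assoc)
    finally show "linear_matrix_at N A v $$ (r, s) = ?R $$ (r, s)" using rs by simp
  qed (simp_all add: linear_matrix_at_def)
qed

theorem theorem6p18:
  fixes h :: "'n::finite rpoly" and e :: "real ^ 'n"
  assumes "homogeneous_poly h"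
    and "hyperbolic_wrt h e"
    and "\<And>v. v \<noteq> 0 \<Longrightarrow> gradient h v \<noteq> 0"
  shows "\<exists>q :: 'n rpoly. hyperbolic q \<and> has_definite_det_rep (q * h)"
proof -
  obtain d where h: "form_in UNIV d h" using assms(1) by (auto simp: homogeneous_poly_iff)
  have he: "mpoly_eval h e \<noteq> 0" using assms(2) by (simp add: hyperbolic_wrt_def)
  have d: "d > 0"
  proof (rule ccontr)
    assume "\<not> ?thesis"
    then have "gradient h v = 0" for v
      using h form_in_partial_deriv_0[of UNIV h] by (simp add: gradient_def mpoly_eval_peval Finite_Cartesian_Product.vec_eq_iff)
    moreover have "((\<chi> _. 1) :: real ^ 'n) \<noteq> 0" by (simp add: Finite_Cartesian_Product.vec_eq_iff)
    ultimately show False using assms(3) by blast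
  qed
  have "e \<noteq> 0"
    using he peval_form_zero[OF h d, of "vec_nth e"] by (auto simp: mpoly_eval_peval)
  then obtain i0 where i0: "vec_nth e i0 \<noteq> 0" by (auto simp: Finite_Cartesian_Product.vec_eq_iff)
  define I where "I = (UNIV :: 'n set) - {i0}"
  show ?thesis
  proof (cases "I = {}")
    case True
    then have "UNIV = {i0}" by (auto simp: I_def)
    then show ?thesis by (rule det_rep_one_variable[OF h he _ i0])
  next
    case False
    define y where "y i = (if i = i0 then 0 else Var i)" for i :: 'n
    define \<eta> where "\<eta> a = coeff (lift y e h) a" for a
    define emb :: "('n \<Rightarrow> real) \<Rightarrow> real ^ 'n" where "emb x = (\<chi> i. if i = i0 then 0 else x i)" for x
    have y: "form_in I 1 (y i)" for i
      using form_in_Var[of i I] by (simp add: y_def I_def)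
    have \<eta>: "peval (\<eta> a) x = coeff (line_poly h e (emb x)) a" for a x
      unfolding \<eta>_def by (rule peval_coeff_lift) (simp add: y_def emb_def)
    have line: "(\<Sum>a\<le>d. monom (peval (\<eta> a) x) a) = line_poly h e (emb x)" for x
      unfolding \<eta> using degree_line_poly(1)[OF h he] poly_as_sum_of_monoms by metis
    have off: "emb x \<noteq> t *\<^sub>R e" if "i \<in> I" "x i \<noteq> 0" for x t i
    proof
      assume eq: "emb x = t *\<^sub>R e"
      have "t * vec_nth e i0 = 0" using arg_cong[OF eq, of "\<lambda>v. vec_nth v i0"] by (simp add: emb_def)
      then have "t = 0" using i0 by simp
      then have "vec_nth (emb x) i = 0" using eq by simp
      then show False using that by (auto simp: emb_def I_def)
    qed
    have \<eta>_form: "form_in I (d - a) (\<eta> a)" if "a \<le> d" for a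
      unfolding \<eta>_def by (rule form_in_coeff_lift(1)[OF y h that])
    have \<eta>_zero: "\<eta> a = 0" if "d < a" for a
      unfolding \<eta>_def by (rule form_in_coeff_lift(2)[OF y h that])
    have \<eta>_split: "split_simple (\<Sum>a\<le>d. monom (peval (\<eta> a) x) a)" if "i \<in> I" "x i \<noteq> 0" for x i
      unfolding line by (rule hyperbolic_smooth_split[OF h d assms(2,3) off[of i x, OF that]])
    have \<eta>_lead: "\<eta> d = Const (mpoly_eval h e)"
      by (rule peval_eq_imp_eq) (simp add: \<eta> coeff_line_poly_top[OF h])
    obtain J :: "(nat \<times> ('n \<Rightarrow>\<^sub>0 nat)) set" and K L where J: "finite J"
      and K: "\<And>p q. p \<in> J \<Longrightarrow> q \<in> J \<Longrightarrow> K p q = K q p"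
      and L: "\<And>i p q. p \<in> J \<Longrightarrow> q \<in> J \<Longrightarrow> L i p q = L i q p"
      and pos: "\<And>c p. p \<in> J \<Longrightarrow> c p \<noteq> 0 \<Longrightarrow> (\<Sum>p\<in>J. \<Sum>q\<in>J. K p q * c p * c q) > 0"
      and ker: "\<And>x t i. i \<in> I \<Longrightarrow> x i \<noteq> 0 \<Longrightarrow> (\<Sum>a\<le>d. peval (\<eta> a) x * t ^ a) = 0 \<Longrightarrow>
        \<exists>v. (\<exists>p\<in>J. v p \<noteq> 0) \<and> (\<forall>q\<in>J. (\<Sum>p\<in>J. (t * K q p - (\<Sum>i\<in>I. x i * L i q p)) * v p) = 0)"
      by (rule exists_definite_pencil[OF False d \<eta>_form \<eta>_zero \<eta>_lead he \<eta>_split]) (assumption | rule that)+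
    obtain f where f: "bij_betw f {..<card J} J"
      using ex_bij_betw_nat_finite[OF J] by (auto simp: atLeast0LessThan)
    let ?N = "card J"
    have fJ: "f r \<in> J" if "r < ?N" for r using f that by (auto simp: bij_betw_def)
    obtain A where A: "\<And>i. A i \<in> carrier_mat ?N ?N \<and> transpose_mat (A i) = A i"
      "\<And>v. linear_matrix_at ?N A v = mat ?N ?N (\<lambda>(r, s). vec_nth v i0 / vec_nth e i0 * K (f r) (f s)
      - (\<Sum>i\<in>I. (vec_nth v i - vec_nth v i0 / vec_nth e i0 * vec_nth e i) * L i (f r) (f s)))"
      by (rule linear_matrix_of_pencil[where K = "\<lambda>r s. K (f r) (f s)" and L = "\<lambda>i r s. L i (f r) (f s)",
            OF i0 K[OF fJ fJ] L[OF fJ fJ], folded I_def]) (assumption | rule that)+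
    have sum_J: "(\<Sum>p\<in>J. g p) = (\<Sum>r<?N. g (f r))" for g :: "_ \<Rightarrow> real"
      by (rule sum.reindex_bij_betw[OF f, symmetric])
    have "linear_matrix_at ?N A e = mat ?N ?N (\<lambda>(r, s). K (f r) (f s))"
      unfolding A(2) using i0 by (intro eq_matI) auto
    moreover have "pos_def_mat ?N (mat ?N ?N (\<lambda>(r, s). K (f r) (f s)))"
    proof (rule pos_def_mat_mat)
      fix c :: "nat \<Rightarrow> real" and r assume r: "r < ?N" "c r \<noteq> 0"
      let ?c = "\<lambda>p. c (inv_into {..<?N} f p)"
      have inv: "inv_into {..<?N} f (f s) = s" if "s < ?N" for s
        using f that by (simp add: bij_betw_def inv_into_f_f)
      from pos[OF fJ[OF r(1)], of ?c] r show "(\<Sum>r<?N. \<Sum>s<?N. K (f r) (f s) * c r * c s) > 0"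
        by (simp add: sum_J inv)
    qed (use K fJ in auto)
    ultimately have pd: "pos_def_mat ?N (linear_matrix_at ?N A e)" by simp
    have zeros: "mpoly_eval (Determinant.det (linear_matrix ?N A)) v = 0"
      if v: "\<And>t. v \<noteq> t *\<^sub>R e" and hv: "mpoly_eval h v = 0" for v
    proof -
      define t where "t = vec_nth v i0 / vec_nth e i0"
      define x where "x i = vec_nth v i - t * vec_nth e i" for i
      have emb: "emb x + t *\<^sub>R e = v"
        using i0 by (auto simp: Finite_Cartesian_Product.vec_eq_iff emb_def x_def t_def)
      have "\<exists>i\<in>I. x i \<noteq> 0"
      proof (rule ccontr)
        assume "\<not> ?thesis"
        then have "emb x = 0" by (auto simp: Finite_Cartesian_Product.vec_eq_iff emb_def I_def)
        then show False using emb v[of t] by simp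
      qed
      then obtain i where i: "i \<in> I" "x i \<noteq> 0" by blast
      have "(\<Sum>a\<le>d. peval (\<eta> a) x * t ^ a) = poly (line_poly h e (emb x)) t"
        by (simp add: poly_sum poly_monom flip: line)
      also have "\<dots> = 0" by (simp add: poly_line_poly emb hv)
      finally obtain w where w: "\<exists>p\<in>J. w p \<noteq> 0"
        "\<And>q. q \<in> J \<Longrightarrow> (\<Sum>p\<in>J. (t * K q p - (\<Sum>i\<in>I. x i * L i q p)) * w p) = 0"
        using ker[of i x t, OF i] by blast
      let ?w = "Matrix.vec ?N (\<lambda>r. w (f r))" and ?M = "linear_matrix_at ?N A v"
      have M: "?M \<in> carrier_mat ?N ?N" by (simp add: linear_matrix_at_def)
      have "?w \<noteq> 0\<^sub>v ?N"
      proof -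
        obtain p where "p \<in> J" "w p \<noteq> 0" using w(1) by blast
        moreover have "p \<in> f ` {..<?N}" using f \<open>p \<in> J\<close> by (simp add: bij_betw_def)
        ultimately obtain r where "r < ?N" "w (f r) \<noteq> 0" by auto
        then show ?thesis by (metis index_vec index_zero_vec(1))
      qed
      moreover have "?M *\<^sub>v ?w = 0\<^sub>v ?N"
      proof (rule eq_vecI)
        fix r assume "r < dim_vec (0\<^sub>v ?N :: real Matrix.vec)"
        then have r: "r < ?N" by simp
        then have "vec_index (?M *\<^sub>v ?w) r = (\<Sum>s<?N. (t * K (f r) (f s) - (\<Sum>i\<in>I. x i * L i (f r) (f s))) * w (f s))"
          by (simp add: A(2) scalar_prod_def atLeast0LessThan t_def x_def)
        also have "\<dots> = 0" using w(2)[OF fJ[OF r]] by (simp add: sum_J)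
        finally show "vec_index (?M *\<^sub>v ?w) r = vec_index (0\<^sub>v ?N) r" using r by simp
      qed (use M in simp)
      ultimately have "Determinant.det ?M = 0"
        using det_0_iff_vec_prod_zero_field[OF M] by (metis vec_carrier)
      then show ?thesis by (simp add: mpoly_eval_det_linear_matrix)
    qed
    obtain i where i: "i \<in> I" using False by blast
    have w: "emb (\<lambda>_. 1) \<noteq> t *\<^sub>R e" for t by (rule off[OF i]) simp
    obtain q where q: "q * h = Determinant.det (linear_matrix ?N A)"
      by (rule form_dvd_of_zeros[OF h he w hyperbolic_smooth_split[OF h d assms(2,3)] zeros]) (assumption | rule that)+
    have "Determinant.det (linear_matrix ?N A) \<noteq> 0"
    proof
      assume "Determinant.det (linear_matrix ?N A) = 0"
      then have "mpoly_eval (Determinant.det (linear_matrix ?N A)) e = 0" by (simp add: mpoly_eval_peval)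
      then show False using pos_def_mat_det[OF pd] by (simp add: mpoly_eval_det_linear_matrix)
    qed
    then obtain q' k where q': "form_in UNIV k q'" "q' * h = Determinant.det (linear_matrix ?N A)"
      using form_factor[OF h form_in_det_linear_matrix _ q] by blast
    have "homogeneous_poly q'" using q'(1) by (auto simp: homogeneous_poly_iff)
    then show ?thesis using hyperbolic_factor_of_det[OF A(1) pd _ q'(2)] by blast
  qed
qed

end
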